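(* Let $\pi$ be a discrete group and $n\ge 1$ an integer. For any $\mathcal O_{\mathcal D}$-module $\underline M$ and for any cohomology class $\underline\alpha\in H^n_{\mathcal D}(\pi\times\pi,\underline M)$ there exists an $\mathcal O_{\mathcal D}$-morphism $\phi:\underline I^n\to\underline M$ such that $\phi_*(\mathfrak u^n)=\underline\alpha$.
   Context: Let $G=\pi\times\pi$. $\mathcal D$ is the smallest set of subgroups of $G$ which contains the trivial subgroup and the diagonal $\Delta=\{(a,a):a\in\pi\}$ and is closed under conjugation and finite intersections. The orbit category $\mathcal O_{\mathcal D}$ has objects $G/H$, $H\in\mathcal D$, and $G$-equivariant maps as morphisms. An $\mathcal O_{\mathcal D}$-module is a contravariant functor from $\mathcal O_{\mathcal D}$ to abelian groups; morphisms are natural transformations, exactness is objectwise, and the tensor product $\otimes_{\mathbb Z}$ is defined objectwise. $\underline{\mathbb Z}$ is the constant module. $H^n_{\mathcal D}(\pi\times\pi,\underline M)=H^n(\mathrm{Hom}_{\mathcal O_{\mathcal D}}(\underline P_*,\underline M))=\mathrm{Ext}^n_{\mathcal O_{\mathcal D}}(\underline{\mathbb Z},\underline M)$ for any projective $\mathcal O_{\mathcal D}$-resolution $\underline P_*$ of $\underline{\mathbb Z}$ (this is the Bredon cohomology of the classifying space $E_{\mathcal D}(G)$). View $\pi$ as a left $G$-set via $(x,y)\cdot g=xgy^{-1}$. $\underline M_\pi$ is the free $\mathcal O_{\mathcal D}$-module $\underline M_\pi(G/H)=\mathbb Z[\pi^H]$, i.e. the free abelian group on the set of $G$-maps $G/H\to\pi$.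 $\underline I$ is the kernel of the augmentation $\epsilon:\underline M_\pi\to\underline{\mathbb Z}$, and $\underline I^n=\underline I\otimes_{\mathbb Z}\cdots\otimes_{\mathbb Z}\underline I$ ($n$ factors), with $\underline I^0=\underline{\mathbb Z}$. Tensoring $0\to\underline I\to\underline M_\pi\to\underline{\mathbb Z}\to0$ with $\underline I^{r-1}$ gives exact sequences $0\to\underline I^r\to\underline M_\pi\otimes_{\mathbb Z}\underline I^{r-1}\to\underline I^{r-1}\to 0$, and splicing them for $r=1,\dots,n$ gives the exact sequence $$0\to\underline I^n\to\underline M_\pi\otimes_{\mathbb Z}\underline I^{n-1}\to\cdots\to\underline M_\pi\otimes_{\mathbb Z}\underline I\to\underline M_\pi\to\underline{\mathbb Z}\to0,$$ in which the modules $\underline M_\pi\otimes_{\mathbb Z}\underline I^{r}$ are projective. The class $\mathfrak u^n\in H^n_{\mathcal D}(\pi\times\pi,\underline I^n)$ is the class represented by this extension: if $\underline P_*\to\underline{\mathbb Z}$ is a projective resolution, lift $\mathrm{id}_{\underline{\mathbb Z}}$ to a chain map from $\underline P_*$ to this sequence; its degree $n$ component $f:\underline P_n\to\underline I^n$ is a cocycle and $\mathfrak u^n=\{f\}$. $\phi_*$ denotes the map induced by $\phi$ on coefficients. *)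

theory Defs
  imports "HOL-Algebra.Free_Abelian_Groups" "HOL-Algebra.Left_Coset"
begin

text \<open>
  Abelian groups are commutative groups in the (multiplicatively written) sense of HOL-Algebra.
  Equivariant maps and natural transformations are kept extensional, so that their equality is
  equality of functions.
\<close>

section \<open>Orbit categories and modules over them\<close>

definition equivariant_maps ::
  "('g, 'm) monoid_scheme \<Rightarrow> 'x set \<Rightarrow> ('g \<Rightarrow> 'x \<Rightarrow> 'x) \<Rightarrow> 'y set \<Rightarrow> ('g \<Rightarrow> 'y \<Rightarrow> 'y) \<Rightarrow> ('x \<Rightarrow> 'y) set"
  where "equivariant_maps G X a Y b =
    {f \<in> X \<rightarrow>\<^sub>E Y. \<forall>g\<in>carrier G. \<forall>x\<in>X. f (a g x) = b g (f x)}"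

text \<open>An object G/H of the orbit category is the set of left cosets of H; distinct subgroups
  give distinct sets.\<close>

definition orbits :: "('g, 'm) monoid_scheme \<Rightarrow> 'g set set \<Rightarrow> 'g set set set"
  where "orbits G F = (\<lambda>H. lcosets\<^bsub>G\<^esub> H) ` F"

definition orbit_maps ::
  "('g, 'm) monoid_scheme \<Rightarrow> 'g set set \<Rightarrow> 'g set set \<Rightarrow> ('g set \<Rightarrow> 'g set) set"
  where "orbit_maps G X Y = equivariant_maps G X (l_coset G) Y (l_coset G)"

text \<open>The field \<open>arr\<close> takes source and target of a morphism \<open>f : X \<rightarrow> Y\<close> explicitly;
  \<open>arr M X Y f\<close> is the contravariantly induced map \<open>M(Y) \<rightarrow> M(X)\<close>.\<close>

record ('g, 'b) omodule =
  obj :: "'g set set \<Rightarrow> 'b monoid"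
  arr :: "'g set set \<Rightarrow> 'g set set \<Rightarrow> ('g set \<Rightarrow> 'g set) \<Rightarrow> 'b \<Rightarrow> 'b"

definition is_omodule :: "('g, 'm) monoid_scheme \<Rightarrow> 'g set set \<Rightarrow> ('g, 'b) omodule \<Rightarrow> bool"
  where "is_omodule G F M \<longleftrightarrow>
    (\<forall>X\<in>orbits G F. comm_group (obj M X)) \<and>
    (\<forall>X\<in>orbits G F. \<forall>Y\<in>orbits G F. \<forall>f\<in>orbit_maps G X Y.
        arr M X Y f \<in> hom (obj M Y) (obj M X)) \<and>
    (\<forall>X\<in>orbits G F. \<forall>x\<in>carrier (obj M X). arr M X X (\<lambda>C\<in>X. C) x = x) \<and>
    (\<forall>X\<in>orbits G F. \<forall>Y\<in>orbits G F. \<forall>Z\<in>orbits G F.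
        \<forall>f\<in>orbit_maps G X Y. \<forall>g\<in>orbit_maps G Y Z. \<forall>z\<in>carrier (obj M Z).
        arr M X Z (compose X g f) z = arr M X Y f (arr M Y Z g z))"

type_synonym ('g, 'b, 'c) omap = "'g set set \<Rightarrow> 'b \<Rightarrow> 'c"

definition nat_trans ::
  "('g, 'm) monoid_scheme \<Rightarrow> 'g set set \<Rightarrow> ('g, 'b) omodule \<Rightarrow> ('g, 'c) omodule \<Rightarrow> ('g, 'b, 'c) omap set"
  where "nat_trans G F M N =
    {\<eta> \<in> (\<Pi>\<^sub>E X\<in>orbits G F. carrier (obj M X) \<rightarrow>\<^sub>E carrier (obj N X)).
      (\<forall>X\<in>orbits G F. \<eta> X \<in> hom (obj M X) (obj N X)) \<and>
      (\<forall>X\<in>orbits G F. \<forall>Y\<in>orbits G F. \<forall>f\<in>orbit_maps G X Y. \<forall>y\<in>carrier (obj M Y).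
        \<eta> X (arr M X Y f y) = arr N X Y f (\<eta> Y y))}"

definition omod_Hom ::
  "('g, 'm) monoid_scheme \<Rightarrow> 'g set set \<Rightarrow> ('g, 'b) omodule \<Rightarrow> ('g, 'c) omodule \<Rightarrow> ('g, 'b, 'c) omap monoid"
  where "omod_Hom G F M N =
    \<lparr>carrier = nat_trans G F M N,
     monoid.mult = (\<lambda>\<eta> \<theta>. \<lambda>X\<in>orbits G F. \<lambda>x\<in>carrier (obj M X). \<eta> X x \<otimes>\<^bsub>obj N X\<^esub> \<theta> X x),
     one = (\<lambda>X\<in>orbits G F. \<lambda>x\<in>carrier (obj M X). \<one>\<^bsub>obj N X\<^esub>)\<rparr>"

text \<open>\<open>omap_comp G F L \<eta> \<theta>\<close> is \<open>\<eta>\<close> after \<open>\<theta>\<close>, where L is the source of \<open>\<theta>\<close>.\<close>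

definition omap_comp ::
  "('g, 'm) monoid_scheme \<Rightarrow> 'g set set \<Rightarrow> ('g, 'b) omodule \<Rightarrow>
    ('g, 'c, 'd) omap \<Rightarrow> ('g, 'b, 'c) omap \<Rightarrow> ('g, 'b, 'd) omap"
  where "omap_comp G F L \<eta> \<theta> = (\<lambda>X\<in>orbits G F. compose (carrier (obj L X)) (\<eta> X) (\<theta> X))"

definition omap_epi ::
  "('g, 'm) monoid_scheme \<Rightarrow> 'g set set \<Rightarrow> ('g, 'b) omodule \<Rightarrow> ('g, 'c) omodule \<Rightarrow> ('g, 'b, 'c) omap \<Rightarrow> bool"
  where "omap_epi G F M N q \<longleftrightarrow>
    q \<in> nat_trans G F M N \<and> (\<forall>X\<in>orbits G F. q X ` carrier (obj M X) = carrier (obj N X))"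

definition const_Z :: "('g, int) omodule"
  where "const_Z = \<lparr>obj = (\<lambda>X. integer_group), arr = (\<lambda>X Y f x. x)\<rparr>"

section \<open>Projective modules and projective resolutions\<close>

definition lifts_against ::
  "('g, 'm) monoid_scheme \<Rightarrow> 'g set set \<Rightarrow> ('g, 'p) omodule \<Rightarrow>
    ('g, 'e) omodule \<Rightarrow> ('g, 'b) omodule \<Rightarrow> bool"
  where "lifts_against G F P E B \<longleftrightarrow>
    (\<forall>q g. omap_epi G F E B q \<and> g \<in> nat_trans G F P B \<longrightarrow>
      (\<exists>h\<in>nat_trans G F P E. omap_comp G F P q h = g))"

text \<open>A definition cannot quantify over all carrier types, so the lifting property is demanded
  for epimorphisms between modules over fixed carrier types, chosen large enough to contain
  P itself and the canonical free cover of P. Lemma \<open>projective_lifts_against\<close> below shows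
  that the lifting property then holds over all carrier types.\<close>

type_synonym ('g, 'p) free_cover_elem = "('g set set \<times> ('g set \<Rightarrow> 'g set) \<times> 'p) \<Rightarrow>\<^sub>0 int"

definition projective ::
  "('g, 'm) monoid_scheme \<Rightarrow> 'g set set \<Rightarrow> ('g, 'p) omodule \<Rightarrow> bool"
  where "projective G F P \<longleftrightarrow> is_omodule G F P \<and>
    (\<forall>(E :: ('g, ('g, 'p) free_cover_elem) omodule) (B :: ('g, 'p) omodule).
      is_omodule G F E \<and> is_omodule G F B \<longrightarrow> lifts_against G F P E B)"

lemma is_omoduleD:
  assumes "is_omodule G F M" "X \<in> orbits G F"
  shows "comm_group (obj M X)" "group (obj M X)"
    "\<lbrakk>Y \<in> orbits G F; f \<in> orbit_maps G X Y\<rbrakk> \<Longrightarrow> arr M X Y f \<in> hom (obj M Y) (obj M X)"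
    "\<lbrakk>Y \<in> orbits G F; f \<in> orbit_maps G X Y; y \<in> carrier (obj M Y)\<rbrakk>
      \<Longrightarrow> arr M X Y f y \<in> carrier (obj M X)"
    "x \<in> carrier (obj M X) \<Longrightarrow> arr M X X (\<lambda>C\<in>X. C) x = x"
    "\<lbrakk>Y \<in> orbits G F; Z \<in> orbits G F; f \<in> orbit_maps G X Y; g \<in> orbit_maps G Y Z;
      z \<in> carrier (obj M Z)\<rbrakk> \<Longrightarrow> arr M X Z (compose X g f) z = arr M X Y f (arr M Y Z g z)"
proof -
  show "comm_group (obj M X)" using assms unfolding is_omodule_def by blast
  then show "group (obj M X)" by (simp add: comm_group_def)
  show h: "arr M X Y f \<in> hom (obj M Y) (obj M X)" if "Y \<in> orbits G F" "f \<in> orbit_maps G X Y" for Y f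
    using assms that unfolding is_omodule_def by blast
  show "arr M X Y f y \<in> carrier (obj M X)"
    if "Y \<in> orbits G F" "f \<in> orbit_maps G X Y" "y \<in> carrier (obj M Y)"
    using hom_in_carrier[OF h] that by blast
qed (use assms in \<open>unfold is_omodule_def, blast\<close>)+

lemma nat_transD:
  assumes "\<eta> \<in> nat_trans G F M N" "X \<in> orbits G F"
  shows "\<eta> X \<in> hom (obj M X) (obj N X)" "\<eta> X \<in> extensional (carrier (obj M X))"
    "x \<in> carrier (obj M X) \<Longrightarrow> \<eta> X x \<in> carrier (obj N X)"
    "\<lbrakk>Y \<in> orbits G F; f \<in> orbit_maps G X Y; y \<in> carrier (obj M Y)\<rbrakk>
      \<Longrightarrow> \<eta> X (arr M X Y f y) = arr N X Y f (\<eta> Y y)"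
  using assms by (auto simp: nat_trans_def PiE_def Pi_def)

lemma nat_trans_eqI:
  assumes "\<eta> \<in> nat_trans G F M N" "\<theta> \<in> nat_trans G F M N'"
    and "\<And>X x. \<lbrakk>X \<in> orbits G F; x \<in> carrier (obj M X)\<rbrakk> \<Longrightarrow> \<eta> X x = \<theta> X x"
  shows "\<eta> = \<theta>"
proof (rule extensionalityI[where A = "orbits G F"])
  show "\<eta> \<in> extensional (orbits G F)" "\<theta> \<in> extensional (orbits G F)"
    using assms by (auto simp: nat_trans_def PiE_def)
  show "\<eta> X = \<theta> X" if "X \<in> orbits G F" for X
    by (rule extensionalityI[OF nat_transD(2)[OF assms(1) that] nat_transD(2)[OF assms(2) that]])
       (use assms(3) that in auto)
qed

lemma nat_trans_omap_comp:
  assumes \<theta>: "\<theta> \<in> nat_trans G F L M" and \<eta>: "\<eta> \<in> nat_trans G F M N" and L: "is_omodule G F L"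
  shows "omap_comp G F L \<eta> \<theta> \<in> nat_trans G F L N"
proof -
  have arrL: "arr L X Y f y \<in> carrier (obj L X)"
    if "X \<in> orbits G F" "Y \<in> orbits G F" "f \<in> orbit_maps G X Y" "y \<in> carrier (obj L Y)" for X Y f y
    using is_omoduleD(4)[OF L] that by blast
  have 1: "compose (carrier (obj L X)) (\<eta> X) (\<theta> X) \<in> hom (obj L X) (obj N X)" if X: "X \<in> orbits G F" for X
  proof (rule homI)
    interpret comm_group "obj L X" by (rule is_omoduleD(1)[OF L X])
    fix x y assume xy: "x \<in> carrier (obj L X)" "y \<in> carrier (obj L X)"
    show "compose (carrier (obj L X)) (\<eta> X) (\<theta> X) x \<in> carrier (obj N X)"
      using xy nat_transD(3)[OF \<eta> X] nat_transD(3)[OF \<theta> X] by (simp add: compose_eq)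
    show "compose (carrier (obj L X)) (\<eta> X) (\<theta> X) (x \<otimes>\<^bsub>obj L X\<^esub> y) =
      compose (carrier (obj L X)) (\<eta> X) (\<theta> X) x \<otimes>\<^bsub>obj N X\<^esub> compose (carrier (obj L X)) (\<eta> X) (\<theta> X) y"
      using xy nat_transD(3)[OF \<theta> X] hom_mult[OF nat_transD(1)[OF \<theta> X]] hom_mult[OF nat_transD(1)[OF \<eta> X]]
      by (simp add: compose_eq)
  qed
  have "omap_comp G F L \<eta> \<theta> \<in> (\<Pi>\<^sub>E X\<in>orbits G F. carrier (obj L X) \<rightarrow>\<^sub>E carrier (obj N X))"
  proof (rule PiE_I)
    fix X assume X: "X \<in> orbits G F"
    show "omap_comp G F L \<eta> \<theta> X \<in> carrier (obj L X) \<rightarrow>\<^sub>E carrier (obj N X)"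
      using X nat_transD(3)[OF \<eta> X] nat_transD(3)[OF \<theta> X] by (simp add: omap_comp_def compose_def)
  qed (simp add: omap_comp_def)
  then show ?thesis
    using 1 nat_transD(3,4)[OF \<theta>] nat_transD(4)[OF \<eta>] arrL
    by (simp add: nat_trans_def[of G F L N]) (simp add: omap_comp_def compose_eq)
qed

lemma hom_free_eqI:
  assumes "h \<in> hom (free_Abelian_group S) C" "k \<in> hom (free_Abelian_group S) C" "group C"
    and eq: "\<And>a. a \<in> S \<Longrightarrow> h (frag_of a) = k (frag_of a)"
    and c: "c \<in> carrier (free_Abelian_group S)"
  shows "h c = k c"
proof -
  interpret h: group_hom "free_Abelian_group S" C h
    using assms by (simp add: group_hom_def group_hom_axioms_def)
  interpret k: group_hom "free_Abelian_group S" C k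
    using assms by (simp add: group_hom_def group_hom_axioms_def)
  have "Poly_Mapping.keys c \<subseteq> S" using c by simp
  then show ?thesis
  proof (rule free_Abelian_group_induct)
    show "h 0 = k 0" using h.hom_one k.hom_one by simp
  next
    fix x y assume 2: "Poly_Mapping.keys x \<subseteq> S" "Poly_Mapping.keys y \<subseteq> S" "h x = k x" "h y = k y"
    have m: "- y \<in> carrier (free_Abelian_group S)" using 2 by simp
    have "h (x - y) = h x \<otimes>\<^bsub>C\<^esub> inv\<^bsub>C\<^esub> h y"
      using h.hom_mult[of x "- y"] h.hom_inv[of y] 2 m by simp
    moreover have "k (x - y) = k x \<otimes>\<^bsub>C\<^esub> inv\<^bsub>C\<^esub> k y"
      using k.hom_mult[of x "- y"] k.hom_inv[of y] 2 m by simp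
    ultimately show "h (x - y) = k (x - y)" using 2 by simp
  qed (rule eq)
qed

lemma hom_frag_extend:
  assumes "\<And>a. a \<in> S \<Longrightarrow> Poly_Mapping.keys (g a) \<subseteq> T"
  shows "frag_extend g \<in> hom (free_Abelian_group S) (free_Abelian_group T)"
proof (rule homI)
  fix x assume "x \<in> carrier (free_Abelian_group S)"
  then show "frag_extend g x \<in> carrier (free_Abelian_group T)"
    using keys_frag_extend[of g x] assms by fastforce
qed (simp add: frag_extend_add)

text \<open>The canonical free cover of P: generators over X are the elements of P pulled back along
  all orbit maps out of X.\<close>

definition cover_gens ::
  "('g, 'm) monoid_scheme \<Rightarrow> 'g set set \<Rightarrow> ('g, 'p) omodule \<Rightarrow> 'g set set \<Rightarrow>
    ('g set set \<times> ('g set \<Rightarrow> 'g set) \<times> 'p) set"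
  where "cover_gens G F P X = {(Y, f, x). Y \<in> orbits G F \<and> f \<in> orbit_maps G X Y \<and> x \<in> carrier (obj P Y)}"

definition free_cover ::
  "('g, 'm) monoid_scheme \<Rightarrow> 'g set set \<Rightarrow> ('g, 'p) omodule \<Rightarrow> ('g, ('g, 'p) free_cover_elem) omodule"
  where "free_cover G F P =
    \<lparr>obj = (\<lambda>X. free_Abelian_group (cover_gens G F P X)),
     arr = (\<lambda>X X' k. frag_extend (\<lambda>(Y, f, x). frag_of (Y, compose X f k, x)))\<rparr>"

context
  fixes G :: "('g, 'm) monoid_scheme" and F :: "'g set set"
  assumes grp: "group G" and sub: "\<And>H. H \<in> F \<Longrightarrow> H \<subseteq> carrier G"
begin

lemma orbit_closed:
  assumes "X \<in> orbits G F" "a \<in> carrier G" "C \<in> X"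
  shows "a <#\<^bsub>G\<^esub> C \<in> X"
proof -
  interpret group G by (rule grp)
  from assms sub obtain H b where H: "H \<subseteq> carrier G" "X = lcosets\<^bsub>G\<^esub> H" "b \<in> carrier G" "C = b <#\<^bsub>G\<^esub> H"
    unfolding orbits_def LCOSETS_def by auto
  then have "a <#\<^bsub>G\<^esub> C = (a \<otimes>\<^bsub>G\<^esub> b) <#\<^bsub>G\<^esub> H" using assms(2) by (simp add: lcos_m_assoc)
  then show ?thesis using H assms(2) unfolding LCOSETS_def by auto
qed

lemma orbit_maps_id: "X \<in> orbits G F \<Longrightarrow> (\<lambda>C\<in>X. C) \<in> orbit_maps G X X"
  using orbit_closed by (auto simp: orbit_maps_def equivariant_maps_def)

lemma orbit_maps_compose:
  assumes "X \<in> orbits G F" "f \<in> orbit_maps G X Y" "g \<in> orbit_maps G Y Z"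
  shows "compose X g f \<in> orbit_maps G X Z"
proof -
  have f: "f \<in> X \<rightarrow>\<^sub>E Y" "\<And>C. C \<in> X \<Longrightarrow> f C \<in> Y"
    "\<And>a C. \<lbrakk>a \<in> carrier G; C \<in> X\<rbrakk> \<Longrightarrow> f (a <#\<^bsub>G\<^esub> C) = a <#\<^bsub>G\<^esub> f C"
    using assms(2) by (auto simp: orbit_maps_def equivariant_maps_def)
  have g: "g \<in> Y \<rightarrow>\<^sub>E Z" "\<And>C. C \<in> Y \<Longrightarrow> g C \<in> Z"
    "\<And>a C. \<lbrakk>a \<in> carrier G; C \<in> Y\<rbrakk> \<Longrightarrow> g (a <#\<^bsub>G\<^esub> C) = a <#\<^bsub>G\<^esub> g C"
    using assms(3) by (auto simp: orbit_maps_def equivariant_maps_def)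
  show ?thesis
    unfolding orbit_maps_def equivariant_maps_def
    by (simp add: compose_eq f(2,3) g(2,3) orbit_closed[OF assms(1)]) (simp add: compose_def f(2) g(2))
qed

lemma cover_arr_hom:
  assumes "X \<in> orbits G F" "k \<in> orbit_maps G X X'"
  shows "arr (free_cover G F P) X X' k \<in> hom (obj (free_cover G F P) X') (obj (free_cover G F P) X)"
  unfolding free_cover_def omodule.simps
  by (rule hom_frag_extend) (use assms in \<open>auto simp: cover_gens_def intro: orbit_maps_compose\<close>)

lemma is_omodule_free_cover: "is_omodule G F (free_cover G F P)"
proof -
  let ?A = "arr (free_cover G F P)" and ?S = "cover_gens G F P"
  have gen: "?A X X' k (frag_of (Y, f, x)) = frag_of (Y, compose X f k, x)" for X X' k Y f x
    by (simp add: free_cover_def)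
  have obj: "obj (free_cover G F P) X = free_Abelian_group (?S X)" for X by (simp add: free_cover_def)
  have id: "?A X X (\<lambda>C\<in>X. C) c = c"
    if X: "X \<in> orbits G F" and c: "c \<in> carrier (free_Abelian_group (?S X))" for X c
  proof -
    have "?A X X (\<lambda>C\<in>X. C) c = id c"
    proof (rule hom_free_eqI[OF _ _ _ _ c])
      show "?A X X (\<lambda>C\<in>X. C) \<in> hom (free_Abelian_group (?S X)) (free_Abelian_group (?S X))"
        using cover_arr_hom[OF X orbit_maps_id[OF X], of P] by (simp add: obj)
      fix a assume "a \<in> ?S X"
      then obtain Y f x where a: "a = (Y, f, x)" "f \<in> orbit_maps G X Y" by (auto simp: cover_gens_def)
      then have "f \<in> extensional X" by (auto simp: orbit_maps_def equivariant_maps_def PiE_def)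
      then have "compose X f (\<lambda>C\<in>X. C) = f" by (auto simp: compose_def extensional_def fun_eq_iff)
      then show "?A X X (\<lambda>C\<in>X. C) (frag_of a) = id (frag_of a)" by (simp add: a gen)
    qed (auto simp: hom_def)
    then show ?thesis by simp
  qed
  have comp: "?A X Z (compose X g f) c = ?A X Y f (?A Y Z g c)"
    if X: "X \<in> orbits G F" and Y: "Y \<in> orbits G F"
      and f: "f \<in> orbit_maps G X Y" and g: "g \<in> orbit_maps G Y Z"
      and c: "c \<in> carrier (free_Abelian_group (?S Z))" for X Y Z f g c
  proof -
    have fX: "f C \<in> Y" if "C \<in> X" for C using f that by (auto simp: orbit_maps_def equivariant_maps_def)
    have "?A X Z (compose X g f) c = (?A X Y f \<circ> ?A Y Z g) c"
    proof (rule hom_free_eqI[OF _ _ _ _ c])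
      show "?A X Z (compose X g f) \<in> hom (free_Abelian_group (?S Z)) (free_Abelian_group (?S X))"
        using cover_arr_hom[OF X orbit_maps_compose[OF X f g], of P] by (simp add: obj)
      show "?A X Y f \<circ> ?A Y Z g \<in> hom (free_Abelian_group (?S Z)) (free_Abelian_group (?S X))"
        using hom_compose[OF cover_arr_hom[OF Y g, of P] cover_arr_hom[OF X f, of P]] by (simp add: obj)
      fix a assume "a \<in> ?S Z"
      then obtain W h x where a: "a = (W, h, x)" by (cases a)
      have "compose X h (compose X g f) = compose X (compose Y h g) f"
        using fX by (auto simp: compose_def fun_eq_iff)
      then show "?A X Z (compose X g f) (frag_of a) = (?A X Y f \<circ> ?A Y Z g) (frag_of a)"
        by (simp add: a gen)
    qed simp
    then show ?thesis by simp
  qed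
  show ?thesis
    unfolding is_omodule_def
  proof (intro conjI ballI)
    show "?A X Y f \<in> hom (obj (free_cover G F P) Y) (obj (free_cover G F P) X)"
      if "X \<in> orbits G F" "f \<in> orbit_maps G X Y" for X Y f using cover_arr_hom that by blast
    show "comm_group (obj (free_cover G F P) X)" for X by (simp add: obj abelian_free_Abelian_group)
    show "?A X X (\<lambda>C\<in>X. C) x = x" if "X \<in> orbits G F" "x \<in> carrier (obj (free_cover G F P) X)" for X x
      using id that unfolding obj by blast
    show "?A X Z (compose X g f) z = ?A X Y f (?A Y Z g z)"
      if "X \<in> orbits G F" "Y \<in> orbits G F" "f \<in> orbit_maps G X Y" "g \<in> orbit_maps G Y Z"
        "z \<in> carrier (obj (free_cover G F P) Z)" for X Y Z f g z
      using comp that unfolding obj by blast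
  qed
qed

lemma free_cover_universal:
  assumes E: "is_omodule G F E"
    and s: "\<And>Y x. \<lbrakk>Y \<in> orbits G F; x \<in> carrier (obj P Y)\<rbrakk> \<Longrightarrow> s Y x \<in> carrier (obj E Y)"
  obtains h where "h \<in> nat_trans G F (free_cover G F P) E"
    "\<And>X Y f x. \<lbrakk>X \<in> orbits G F; (Y, f, x) \<in> cover_gens G F P X\<rbrakk>
      \<Longrightarrow> h X (frag_of (Y, f, x)) = arr E X Y f (s Y x)"
proof -
  let ?S = "cover_gens G F P"
  have arrE: "arr E X Y f \<in> hom (obj E Y) (obj E X)"
    if "X \<in> orbits G F" "Y \<in> orbits G F" "f \<in> orbit_maps G X Y" for X Y f
    using is_omoduleD(3)[OF E] that by blast
  have "\<exists>h. h \<in> hom (free_Abelian_group (?S X)) (obj E X) \<and>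
      (\<forall>a \<in> ?S X. h (frag_of a) = (\<lambda>(Y, f, x). arr E X Y f (s Y x)) a)" if X: "X \<in> orbits G F" for X
  proof -
    interpret comm_group "obj E X" by (rule is_omoduleD(1)[OF E X])
    have "(\<lambda>(Y, f, x). arr E X Y f (s Y x)) ` ?S X \<subseteq> carrier (obj E X)"
    proof (rule image_subsetI)
      fix a assume a: "a \<in> ?S X"
      obtain Y f x where az: "a = (Y, f, x)" by (cases a)
      have Y: "Y \<in> orbits G F" "f \<in> orbit_maps G X Y" "x \<in> carrier (obj P Y)"
        using a by (simp_all add: az cover_gens_def)
      show "(\<lambda>(Y, f, x). arr E X Y f (s Y x)) a \<in> carrier (obj E X)"
        using is_omoduleD(4)[OF E X Y(1,2) s[OF Y(1,3)]] by (simp add: az)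
    qed
    then obtain h where "h \<in> hom (free_Abelian_group (?S X)) (obj E X)"
      "\<And>a. a \<in> ?S X \<Longrightarrow> h (frag_of a) = (\<lambda>(Y, f, x). arr E X Y f (s Y x)) a"
      by (rule free_Abelian_group_universal) simp
    then show ?thesis by (intro exI[of _ h] conjI ballI)
  qed
  then have "\<forall>X\<in>orbits G F. \<exists>h. h \<in> hom (free_Abelian_group (?S X)) (obj E X) \<and>
      (\<forall>a \<in> ?S X. h (frag_of a) = (\<lambda>(Y, f, x). arr E X Y f (s Y x)) a)" ..
  from bchoice[OF this] obtain h0 where h00: "\<forall>X\<in>orbits G F. h0 X \<in> hom (free_Abelian_group (?S X)) (obj E X) \<and>
      (\<forall>a \<in> ?S X. h0 X (frag_of a) = (\<lambda>(Y, f, x). arr E X Y f (s Y x)) a)"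
    ..
  then have h0: "\<And>X. X \<in> orbits G F \<Longrightarrow> h0 X \<in> hom (free_Abelian_group (?S X)) (obj E X)" by blast
  have h0g: "h0 X (frag_of (Y, f, x)) = arr E X Y f (s Y x)"
    if "X \<in> orbits G F" "(Y, f, x) \<in> ?S X" for X Y f x
    using h00 that by simp
  define h where "h = (\<lambda>X\<in>orbits G F. restrict (h0 X) (carrier (free_Abelian_group (?S X))))"
  have obj: "obj (free_cover G F P) X = free_Abelian_group (?S X)" for X by (simp add: free_cover_def)
  have nat0: "h0 X (arr (free_cover G F P) X Y f c) = arr E X Y f (h0 Y c)"
    if X: "X \<in> orbits G F" and Y: "Y \<in> orbits G F" and f: "f \<in> orbit_maps G X Y"
      and c: "c \<in> carrier (free_Abelian_group (?S Y))" for X Y f c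
  proof -
    have "(h0 X \<circ> arr (free_cover G F P) X Y f) c = (arr E X Y f \<circ> h0 Y) c"
    proof (rule hom_free_eqI[OF _ _ _ _ c])
      show "h0 X \<circ> arr (free_cover G F P) X Y f \<in> hom (free_Abelian_group (?S Y)) (obj E X)"
        using hom_compose[OF cover_arr_hom[OF X f, of P, unfolded obj] h0[OF X]] .
      show "arr E X Y f \<circ> h0 Y \<in> hom (free_Abelian_group (?S Y)) (obj E X)"
        using hom_compose[OF h0[OF Y] arrE[OF X Y f]] .
      show "group (obj E X)" by (rule is_omoduleD(2)[OF E X])
      fix a assume a: "a \<in> ?S Y"
      obtain Z g x where az: "a = (Z, g, x)" by (cases a)
      have Z: "Z \<in> orbits G F" "g \<in> orbit_maps G Y Z" "x \<in> carrier (obj P Z)"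
        using a by (auto simp: az cover_gens_def)
      have "(Z, compose X g f, x) \<in> ?S X"
        using Z orbit_maps_compose[OF X f Z(2)] by (simp add: cover_gens_def)
      then have "(h0 X \<circ> arr (free_cover G F P) X Y f) (frag_of a) = arr E X Z (compose X g f) (s Z x)"
        using h0g[OF X] by (simp add: az free_cover_def)
      also have "\<dots> = arr E X Y f (arr E Y Z g (s Z x))"
        by (rule is_omoduleD(6)[OF E X Y Z(1) f Z(2) s[OF Z(1,3)]])
      finally show "(h0 X \<circ> arr (free_cover G F P) X Y f) (frag_of a) = (arr E X Y f \<circ> h0 Y) (frag_of a)"
        using h0g[OF Y] a by (simp add: az)
    qed
    then show ?thesis by simp
  qed
  have "h \<in> nat_trans G F (free_cover G F P) E"
    unfolding nat_trans_def
  proof (intro CollectI conjI ballI PiE_I)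
    fix X assume X: "X \<in> orbits G F"
    show "h X \<in> hom (obj (free_cover G F P) X) (obj E X)"
    proof (rule homI)
      fix x y assume "x \<in> carrier (obj (free_cover G F P) X)" "y \<in> carrier (obj (free_cover G F P) X)"
      then have x: "x \<in> carrier (free_Abelian_group (?S X))" and y: "y \<in> carrier (free_Abelian_group (?S X))"
        by (simp_all add: obj)
      interpret A: group "free_Abelian_group (?S X)" by simp
      show "h X x \<in> carrier (obj E X)" using hom_in_carrier[OF h0[OF X] x] x X by (simp add: h_def)
      show "h X (x \<otimes>\<^bsub>obj (free_cover G F P) X\<^esub> y) = h X x \<otimes>\<^bsub>obj E X\<^esub> h X y"
        using hom_mult[OF h0[OF X] x y] x y A.m_closed[OF x y] X by (simp add: h_def obj)
    qed
    fix c assume "c \<in> carrier (obj (free_cover G F P) X)"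
    then show "h X c \<in> carrier (obj E X)"
      using hom_in_carrier[OF h0[OF X]] X by (simp add: h_def obj)
  next
    fix X Y f c assume X: "X \<in> orbits G F" and Y: "Y \<in> orbits G F" and f: "f \<in> orbit_maps G X Y"
      and "c \<in> carrier (obj (free_cover G F P) Y)"
    then have c: "c \<in> carrier (free_Abelian_group (?S Y))" by (simp add: obj)
    show "h X (arr (free_cover G F P) X Y f c) = arr E X Y f (h Y c)"
      using nat0[OF X Y f c] hom_in_carrier[OF cover_arr_hom[OF X f, of P, unfolded obj] c] c X Y
      by (simp add: h_def)
  qed (auto simp: h_def obj)
  moreover have "h X (frag_of (Y, f, x)) = arr E X Y f (s Y x)"
    if "X \<in> orbits G F" "(Y, f, x) \<in> ?S X" for X Y f x
    using h0g that by (simp add: h_def)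
  ultimately show thesis by (rule that)
qed

lemma projective_lifts_against:
  fixes E :: "('g, 'e) omodule" and B :: "('g, 'b) omodule" and P :: "('g, 'p) omodule"
  assumes P: "projective G F P" and E: "is_omodule G F E" and B: "is_omodule G F B"
  shows "lifts_against G F P E B"
  unfolding lifts_against_def
proof (intro allI impI, elim conjE)
  fix q g assume epi: "omap_epi G F E B q" and g: "g \<in> nat_trans G F P B"
  let ?F = "free_cover G F P"
  have PM: "is_omodule G F P" using P by (simp add: projective_def)
  have q: "q \<in> nat_trans G F E B" using epi by (simp add: omap_epi_def)
  obtain c where c: "c \<in> nat_trans G F ?F P"
    and cg: "\<And>X Y f x. \<lbrakk>X \<in> orbits G F; (Y, f, x) \<in> cover_gens G F P X\<rbrakk>
      \<Longrightarrow> c X (frag_of (Y, f, x)) = arr P X Y f x"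
    by (rule free_cover_universal[OF PM, where P = P and s = "\<lambda>Y x. x"]) auto
  have "c X ` carrier (obj ?F X) = carrier (obj P X)" if X: "X \<in> orbits G F" for X
  proof (intro equalityI subsetI)
    fix x assume x: "x \<in> carrier (obj P X)"
    then have m: "(X, \<lambda>C\<in>X. C, x) \<in> cover_gens G F P X"
      using X orbit_maps_id[OF X] by (simp add: cover_gens_def)
    have "c X (frag_of (X, \<lambda>C\<in>X. C, x)) = x"
      using cg[OF X m] is_omoduleD(5)[OF PM X x] by simp
    moreover have "frag_of (X, \<lambda>C\<in>X. C, x) \<in> carrier (obj ?F X)" using m by (simp add: free_cover_def)
    ultimately show "x \<in> c X ` carrier (obj ?F X)" by (metis imageI)
  qed (use nat_transD(3)[OF c X] in auto)
  then have cepi: "omap_epi G F ?F P c" using c by (simp add: omap_epi_def)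
  define i where "i = (\<lambda>X\<in>orbits G F. \<lambda>x\<in>carrier (obj P X). x)"
  have arrP: "arr P X Y f y \<in> carrier (obj P X)"
    if "X \<in> orbits G F" "Y \<in> orbits G F" "f \<in> orbit_maps G X Y" "y \<in> carrier (obj P Y)" for X Y f y
    using is_omoduleD(4)[OF PM] that by blast
  have grpP: "group (obj P X)" if "X \<in> orbits G F" for X by (rule is_omoduleD(2)[OF PM that])
  have i: "i \<in> nat_trans G F P P"
    using arrP grpP by (auto simp: nat_trans_def i_def hom_def group.is_monoid monoid.m_closed)
  have "lifts_against G F P ?F P"
    using P is_omodule_free_cover PM unfolding projective_def by blast
  then obtain t where t: "t \<in> nat_trans G F P ?F" and ct: "omap_comp G F P c t = i"
    using cepi i unfolding lifts_against_def by blast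
  have "\<exists>y. y \<in> carrier (obj E Y) \<and> q Y y = g Y x"
    if "Y \<in> orbits G F" "x \<in> carrier (obj P Y)" for Y x
    using nat_transD(3)[OF g that] epi that unfolding omap_epi_def by (metis imageE)
  then obtain s where s: "\<And>Y x. \<lbrakk>Y \<in> orbits G F; x \<in> carrier (obj P Y)\<rbrakk> \<Longrightarrow> s Y x \<in> carrier (obj E Y)"
    and qs: "\<And>Y x. \<lbrakk>Y \<in> orbits G F; x \<in> carrier (obj P Y)\<rbrakk> \<Longrightarrow> q Y (s Y x) = g Y x"
    by metis
  obtain h where h: "h \<in> nat_trans G F ?F E"
    and hg: "\<And>X Y f x. \<lbrakk>X \<in> orbits G F; (Y, f, x) \<in> cover_gens G F P X\<rbrakk>
      \<Longrightarrow> h X (frag_of (Y, f, x)) = arr E X Y f (s Y x)"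
    by (rule free_cover_universal[OF E, where P = P and s = s]) (use s in blast)+
  have qh: "q X (h X z) = g X (c X z)" if X: "X \<in> orbits G F" and z: "z \<in> carrier (obj ?F X)" for X z
  proof -
    have obj: "obj ?F X = free_Abelian_group (cover_gens G F P X)" by (simp add: free_cover_def)
    have "(q X \<circ> h X) z = (g X \<circ> c X) z"
    proof (rule hom_free_eqI)
      show "q X \<circ> h X \<in> hom (free_Abelian_group (cover_gens G F P X)) (obj B X)"
        using hom_compose[OF nat_transD(1)[OF h X] nat_transD(1)[OF q X]] by (simp add: obj)
      show "g X \<circ> c X \<in> hom (free_Abelian_group (cover_gens G F P X)) (obj B X)"
        using hom_compose[OF nat_transD(1)[OF c X] nat_transD(1)[OF g X]] by (simp add: obj)
      show "group (obj B X)" by (rule is_omoduleD(2)[OF B X])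
      show "z \<in> carrier (free_Abelian_group (cover_gens G F P X))" using z by (simp add: obj)
      fix a assume a: "a \<in> cover_gens G F P X"
      obtain Y f x where az: "a = (Y, f, x)" by (cases a)
      have Y: "Y \<in> orbits G F" "f \<in> orbit_maps G X Y" "x \<in> carrier (obj P Y)"
        using a by (auto simp: az cover_gens_def)
      show "(q X \<circ> h X) (frag_of a) = (g X \<circ> c X) (frag_of a)"
        using hg[OF X] cg[OF X] a qs[OF Y(1,3)] nat_transD(4)[OF q X Y(1,2) s[OF Y(1,3)]]
          nat_transD(4)[OF g X Y]
        by (simp add: az)
    qed
    then show ?thesis by simp
  qed
  have ht: "omap_comp G F P h t \<in> nat_trans G F P E" by (rule nat_trans_omap_comp[OF t h PM])
  have "omap_comp G F P q (omap_comp G F P h t) = g"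
  proof (rule nat_trans_eqI[OF nat_trans_omap_comp[OF ht q PM] g])
    fix X x assume X: "X \<in> orbits G F" and x: "x \<in> carrier (obj P X)"
    have "omap_comp G F P q (omap_comp G F P h t) X x = q X (h X (t X x))"
      using X x by (simp add: omap_comp_def compose_eq)
    also have "\<dots> = g X (c X (t X x))" using qh[OF X nat_transD(3)[OF t X x]] .
    also have "c X (t X x) = omap_comp G F P c t X x" using X x by (simp add: omap_comp_def compose_eq)
    also have "\<dots> = x" using X x by (simp add: ct i_def)
    finally show "omap_comp G F P q (omap_comp G F P h t) X x = g X x" .
  qed
  then show "\<exists>h\<in>nat_trans G F P E. omap_comp G F P q h = g" using ht by blast
qed

end

text \<open>\<open>\<cdots> \<rightarrow> P 2 \<rightarrow> P 1 \<rightarrow> P 0 \<rightarrow> Z \<rightarrow> 0\<close> with \<open>d r : P (r + 1) \<rightarrow> P r\<close>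
  and augmentation \<open>e\<close>.\<close>

definition projective_resolution ::
  "('g, 'm) monoid_scheme \<Rightarrow> 'g set set \<Rightarrow> (nat \<Rightarrow> ('g, 'p) omodule) \<Rightarrow>
    (nat \<Rightarrow> ('g, 'p, 'p) omap) \<Rightarrow> ('g, 'p, int) omap \<Rightarrow> bool"
  where "projective_resolution G F P d e \<longleftrightarrow>
    (\<forall>r. projective G F (P r)) \<and>
    (\<forall>r. d r \<in> nat_trans G F (P (Suc r)) (P r)) \<and>
    omap_epi G F (P 0) const_Z e \<and>
    (\<forall>X\<in>orbits G F.
      d 0 X ` carrier (obj (P (Suc 0)) X) = kernel (obj (P 0) X) (obj const_Z X) (e X)) \<and>
    (\<forall>r. \<forall>X\<in>orbits G F.
      d (Suc r) X ` carrier (obj (P (Suc (Suc r))) X) =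
      kernel (obj (P (Suc r)) X) (obj (P r) X) (d r X))"

section \<open>Bredon cohomology\<close>

definition cobdry ::
  "('g, 'm) monoid_scheme \<Rightarrow> 'g set set \<Rightarrow> (nat \<Rightarrow> ('g, 'p) omodule) \<Rightarrow>
    (nat \<Rightarrow> ('g, 'p, 'p) omap) \<Rightarrow> nat \<Rightarrow> ('g, 'p, 'b) omap \<Rightarrow> ('g, 'p, 'b) omap"
  where "cobdry G F P d n \<eta> = omap_comp G F (P (Suc n)) \<eta> (d n)"

definition cocycles ::
  "('g, 'm) monoid_scheme \<Rightarrow> 'g set set \<Rightarrow> (nat \<Rightarrow> ('g, 'p) omodule) \<Rightarrow>
    (nat \<Rightarrow> ('g, 'p, 'p) omap) \<Rightarrow> ('g, 'b) omodule \<Rightarrow> nat \<Rightarrow> ('g, 'p, 'b) omap set"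
  where "cocycles G F P d M n =
    kernel (omod_Hom G F (P n) M) (omod_Hom G F (P (Suc n)) M) (cobdry G F P d n)"

definition coboundaries ::
  "('g, 'm) monoid_scheme \<Rightarrow> 'g set set \<Rightarrow> (nat \<Rightarrow> ('g, 'p) omodule) \<Rightarrow>
    (nat \<Rightarrow> ('g, 'p, 'p) omap) \<Rightarrow> ('g, 'b) omodule \<Rightarrow> nat \<Rightarrow> ('g, 'p, 'b) omap set"
  where "coboundaries G F P d M n =
    (case n of 0 \<Rightarrow> {\<one>\<^bsub>omod_Hom G F (P 0) M\<^esub>}
     | Suc k \<Rightarrow> cobdry G F P d k ` carrier (omod_Hom G F (P k) M))"

definition bredon_cohomology ::
  "('g, 'm) monoid_scheme \<Rightarrow> 'g set set \<Rightarrow> (nat \<Rightarrow> ('g, 'p) omodule) \<Rightarrow>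
    (nat \<Rightarrow> ('g, 'p, 'p) omap) \<Rightarrow> ('g, 'b) omodule \<Rightarrow> nat \<Rightarrow> ('g, 'p, 'b) omap set monoid"
  where "bredon_cohomology G F P d M n =
    (omod_Hom G F (P n) M)\<lparr>carrier := cocycles G F P d M n\<rparr> Mod coboundaries G F P d M n"

definition cohomology_class ::
  "('g, 'm) monoid_scheme \<Rightarrow> 'g set set \<Rightarrow> (nat \<Rightarrow> ('g, 'p) omodule) \<Rightarrow>
    (nat \<Rightarrow> ('g, 'p, 'p) omap) \<Rightarrow> ('g, 'b) omodule \<Rightarrow> nat \<Rightarrow> ('g, 'p, 'b) omap \<Rightarrow> ('g, 'p, 'b) omap set"
  where "cohomology_class G F P d M n f =
    coboundaries G F P d M n #>\<^bsub>omod_Hom G F (P n) M\<^esub> f"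

text \<open>The map in cohomology induced by a morphism \<open>\<phi>\<close> of coefficients with target M, computed on
  any representative of the given class.\<close>

definition coeff_map ::
  "('g, 'm) monoid_scheme \<Rightarrow> 'g set set \<Rightarrow> (nat \<Rightarrow> ('g, 'p) omodule) \<Rightarrow>
    (nat \<Rightarrow> ('g, 'p, 'p) omap) \<Rightarrow> ('g, 'b) omodule \<Rightarrow> nat \<Rightarrow> ('g, 'c, 'b) omap \<Rightarrow>
    ('g, 'p, 'c) omap set \<Rightarrow> ('g, 'p, 'b) omap set"
  where "coeff_map G F P d M n \<phi> c =
    the_elem ((\<lambda>f. cohomology_class G F P d M n (omap_comp G F (P n) \<phi> f)) ` c)"

section \<open>Tensor products over the integers\<close>

text \<open>The tensor product of a finite list of abelian groups over a common carrier type: the free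
  abelian group on tuples modulo the relations of multilinearity. (Forming it for all factors at
  once keeps the type independent of the number of factors.) The empty tensor product is infinite
  cyclic, generated by the class of the empty tuple.\<close>

definition tensor_gens :: "'b monoid list \<Rightarrow> 'b list set"
  where "tensor_gens As = listset (map carrier As)"

definition tensor_rels :: "'b monoid list \<Rightarrow> ('b list \<Rightarrow>\<^sub>0 int) set"
  where "tensor_rels As =
    {frag_of (xs[i := x \<otimes>\<^bsub>As ! i\<^esub> y]) - frag_of (xs[i := x]) - frag_of (xs[i := y]) | xs i x y.
      xs \<in> tensor_gens As \<and> i < length As \<and> x \<in> carrier (As ! i) \<and> y \<in> carrier (As ! i)}"

definition tensor_ker :: "'b monoid list \<Rightarrow> ('b list \<Rightarrow>\<^sub>0 int) set"
  where "tensor_ker As = generate (free_Abelian_group (tensor_gens As)) (tensor_rels As)"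

definition tensor :: "'b monoid list \<Rightarrow> ('b list \<Rightarrow>\<^sub>0 int) set monoid"
  where "tensor As = free_Abelian_group (tensor_gens As) Mod tensor_ker As"

text \<open>The homomorphism \<open>tensor As \<rightarrow> tensor Bs\<close> with value the class of \<open>g xs\<close> on the class of
  a tuple \<open>xs\<close>, computed on any representative.\<close>

definition tensor_hom ::
  "'b monoid list \<Rightarrow> 'c monoid list \<Rightarrow> ('b list \<Rightarrow> ('c list \<Rightarrow>\<^sub>0 int)) \<Rightarrow>
    ('b list \<Rightarrow>\<^sub>0 int) set \<Rightarrow> ('c list \<Rightarrow>\<^sub>0 int) set"
  where "tensor_hom As Bs g = (\<lambda>T\<in>carrier (tensor As).
    the_elem ((\<lambda>c. tensor_ker Bs #>\<^bsub>free_Abelian_group (tensor_gens Bs)\<^esub> frag_extend g c) ` T))"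

definition tensor_omod :: "('g, 'b) omodule list \<Rightarrow> ('g, ('b list \<Rightarrow>\<^sub>0 int) set) omodule"
  where "tensor_omod Ms =
    \<lparr>obj = (\<lambda>X. tensor (map (\<lambda>M. obj M X) Ms)),
     arr = (\<lambda>X Y f. tensor_hom (map (\<lambda>M. obj M Y) Ms) (map (\<lambda>M. obj M X) Ms)
        (\<lambda>ys. frag_of (map2 (\<lambda>M. arr M X Y f) Ms ys)))\<rparr>"

section \<open>The family of subgroups and the canonical class\<close>

inductive_set diag_family :: "('a, 'm) monoid_scheme \<Rightarrow> ('a \<times> 'a) set set"
  for \<pi> :: "('a, 'm) monoid_scheme" where
  trivial: "{\<one>\<^bsub>\<pi> \<times>\<times> \<pi>\<^esub>} \<in> diag_family \<pi>"
| diagonal: "{(a, a) | a. a \<in> carrier \<pi>} \<in> diag_family \<pi>"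
| conjugate: "\<lbrakk>H \<in> diag_family \<pi>; g \<in> carrier (\<pi> \<times>\<times> \<pi>)\<rbrakk>
    \<Longrightarrow> {g \<otimes>\<^bsub>\<pi> \<times>\<times> \<pi>\<^esub> h \<otimes>\<^bsub>\<pi> \<times>\<times> \<pi>\<^esub> inv\<^bsub>\<pi> \<times>\<times> \<pi>\<^esub> g | h. h \<in> H} \<in> diag_family \<pi>"
| intersection: "\<lbrakk>H \<in> diag_family \<pi>; K \<in> diag_family \<pi>\<rbrakk> \<Longrightarrow> H \<inter> K \<in> diag_family \<pi>"

lemma diag_family_subset:
  assumes "group \<pi>" "H \<in> diag_family \<pi>"
  shows "H \<subseteq> carrier (\<pi> \<times>\<times> \<pi>)"
  using assms(2)
proof induction
  case (conjugate H g)
  interpret group "\<pi> \<times>\<times> \<pi>" by (rule DirProd_group[OF assms(1) assms(1)])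
  from conjugate show ?case by (auto simp del: carrier_DirProd mult_DirProd intro!: m_closed)
qed (use assms(1) in \<open>auto simp: group.is_monoid monoid.one_closed\<close>)

definition pi_action :: "('a, 'm) monoid_scheme \<Rightarrow> 'a \<times> 'a \<Rightarrow> 'a \<Rightarrow> 'a"
  where "pi_action \<pi> = (\<lambda>(x, y) g. x \<otimes>\<^bsub>\<pi>\<^esub> g \<otimes>\<^bsub>\<pi>\<^esub> inv\<^bsub>\<pi>\<^esub> y)"

type_synonym 'a mpi_elem = "(('a \<times> 'a) set \<Rightarrow> 'a) \<Rightarrow>\<^sub>0 int"

definition M_pi :: "('a, 'm) monoid_scheme \<Rightarrow> ('a \<times> 'a, 'a mpi_elem) omodule"
  where "M_pi \<pi> =
    \<lparr>obj = (\<lambda>X. free_Abelian_group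
        (equivariant_maps (\<pi> \<times>\<times> \<pi>) X (l_coset (\<pi> \<times>\<times> \<pi>)) (carrier \<pi>) (pi_action \<pi>))),
     arr = (\<lambda>X Y f. frag_extend (\<lambda>u. frag_of (compose X u f)))\<rparr>"

definition coeff_sum :: "('b \<Rightarrow>\<^sub>0 int) \<Rightarrow> int"
  where "coeff_sum c = (\<Sum>x\<in>Poly_Mapping.keys c. Poly_Mapping.lookup c x)"

definition I_mod :: "('a, 'm) monoid_scheme \<Rightarrow> ('a \<times> 'a, 'a mpi_elem) omodule"
  where "I_mod \<pi> =
    \<lparr>obj = (\<lambda>X. (obj (M_pi \<pi>) X)
        \<lparr>carrier := kernel (obj (M_pi \<pi>) X) (obj const_Z X) coeff_sum\<rparr>),
     arr = arr (M_pi \<pi>)\<rparr>"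

text \<open>\<open>I_pow \<pi> r\<close> is the r-th tensor power of I, and \<open>MI \<pi> r\<close> is the tensor product of \<open>M_pi\<close> with
  it. In particular \<open>I_pow \<pi> 0\<close> is the constant module Z up to the canonical isomorphism
  \<open>I_pow_0_to_Z\<close>, and \<open>MI \<pi> 0\<close> is \<open>M_pi\<close>.\<close>

type_synonym 'a tensor_elem = "('a mpi_elem list \<Rightarrow>\<^sub>0 int) set"

definition I_pow :: "('a, 'm) monoid_scheme \<Rightarrow> nat \<Rightarrow> ('a \<times> 'a, 'a tensor_elem) omodule"
  where "I_pow \<pi> r = tensor_omod (replicate r (I_mod \<pi>))"

definition MI :: "('a, 'm) monoid_scheme \<Rightarrow> nat \<Rightarrow> ('a \<times> 'a, 'a tensor_elem) omodule"
  where "MI \<pi> r = tensor_omod (M_pi \<pi> # replicate r (I_mod \<pi>))"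

definition tensor_omap ::
  "('g, 'm) monoid_scheme \<Rightarrow> 'g set set \<Rightarrow> ('g, 'b) omodule list \<Rightarrow> ('g, 'c) omodule list \<Rightarrow>
    ('b list \<Rightarrow> ('c list \<Rightarrow>\<^sub>0 int)) \<Rightarrow> ('g, ('b list \<Rightarrow>\<^sub>0 int) set, ('c list \<Rightarrow>\<^sub>0 int) set) omap"
  where "tensor_omap G F Ms Ns g = (\<lambda>X\<in>orbits G F.
    tensor_hom (map (\<lambda>M. obj M X) Ms) (map (\<lambda>N. obj N X) Ns) g)"

text \<open>Tensoring the inclusion of I in \<open>M_pi\<close> with the r-th power of I:
  \<open>I_pow \<pi> (r + 1) \<rightarrow> MI \<pi> r\<close>.\<close>

definition incl :: "('a, 'm) monoid_scheme \<Rightarrow> nat \<Rightarrow> ('a \<times> 'a, 'a tensor_elem, 'a tensor_elem) omap"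
  where "incl \<pi> r = tensor_omap (\<pi> \<times>\<times> \<pi>) (diag_family \<pi>)
    (replicate (Suc r) (I_mod \<pi>)) (M_pi \<pi> # replicate r (I_mod \<pi>)) frag_of"

text \<open>Tensoring the augmentation with the r-th power of I: \<open>MI \<pi> r \<rightarrow> I_pow \<pi> r\<close>.\<close>

definition aug_tensor :: "('a, 'm) monoid_scheme \<Rightarrow> nat \<Rightarrow> ('a \<times> 'a, 'a tensor_elem, 'a tensor_elem) omap"
  where "aug_tensor \<pi> r = tensor_omap (\<pi> \<times>\<times> \<pi>) (diag_family \<pi>)
    (M_pi \<pi> # replicate r (I_mod \<pi>)) (replicate r (I_mod \<pi>))
    (\<lambda>xs. frag_cmul (coeff_sum (hd xs)) (frag_of (tl xs)))"

definition I_pow_0_to_Z :: "('a, 'm) monoid_scheme \<Rightarrow> ('a \<times> 'a, 'a tensor_elem, int) omap"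
  where "I_pow_0_to_Z \<pi> = (\<lambda>X\<in>orbits (\<pi> \<times>\<times> \<pi>) (diag_family \<pi>).
    \<lambda>T\<in>carrier (obj (I_pow \<pi> 0) X). the_elem (coeff_sum ` T))"

text \<open>The maps of the spliced sequence: \<open>splice \<pi> r : MI \<pi> (r + 1) \<rightarrow> MI \<pi> r\<close> and
  \<open>splice_aug \<pi> : MI \<pi> 0 \<rightarrow> Z\<close>.\<close>

definition splice :: "('a, 'm) monoid_scheme \<Rightarrow> nat \<Rightarrow> ('a \<times> 'a, 'a tensor_elem, 'a tensor_elem) omap"
  where "splice \<pi> r = omap_comp (\<pi> \<times>\<times> \<pi>) (diag_family \<pi>) (MI \<pi> (Suc r)) (incl \<pi> r) (aug_tensor \<pi> (Suc r))"

definition splice_aug :: "('a, 'm) monoid_scheme \<Rightarrow> ('a \<times> 'a, 'a tensor_elem, int) omap"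
  where "splice_aug \<pi> = omap_comp (\<pi> \<times>\<times> \<pi>) (diag_family \<pi>) (MI \<pi> 0) (I_pow_0_to_Z \<pi>) (aug_tensor \<pi> 0)"

text \<open>\<open>(f 0, \<dots>, f (n - 1), u, 0, 0, \<dots>)\<close> is a chain map over the identity of Z from \<open>P\<close> to
  \<open>0 \<rightarrow> I_pow \<pi> n \<rightarrow> MI \<pi> (n - 1) \<rightarrow> \<cdots> \<rightarrow> MI \<pi> 0 \<rightarrow> Z \<rightarrow> 0\<close>, for \<open>n \<ge> 1\<close>.\<close>

definition chain_lift ::
  "('a, 'm) monoid_scheme \<Rightarrow> (nat \<Rightarrow> ('a \<times> 'a, 'p) omodule) \<Rightarrow> (nat \<Rightarrow> ('a \<times> 'a, 'p, 'p) omap) \<Rightarrow>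
    ('a \<times> 'a, 'p, int) omap \<Rightarrow> nat \<Rightarrow> (nat \<Rightarrow> ('a \<times> 'a, 'p, 'a tensor_elem) omap) \<Rightarrow>
    ('a \<times> 'a, 'p, 'a tensor_elem) omap \<Rightarrow> bool"
  where "chain_lift \<pi> P d e n f u \<longleftrightarrow>
    (let G = \<pi> \<times>\<times> \<pi>; F = diag_family \<pi> in
      (\<forall>r<n. f r \<in> nat_trans G F (P r) (MI \<pi> r)) \<and>
      u \<in> nat_trans G F (P n) (I_pow \<pi> n) \<and>
      omap_comp G F (P 0) (splice_aug \<pi>) (f 0) = e \<and>
      (\<forall>r. Suc r < n \<longrightarrow>
        omap_comp G F (P (Suc r)) (splice \<pi> r) (f (Suc r)) = omap_comp G F (P (Suc r)) (f r) (d r)) \<and>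
      omap_comp G F (P n) (incl \<pi> (n - 1)) u = omap_comp G F (P n) (f (n - 1)) (d (n - 1)) \<and>
      omap_comp G F (P (Suc n)) u (d n) = \<one>\<^bsub>omod_Hom G F (P (Suc n)) (I_pow \<pi> n)\<^esub>)"

text \<open>Any two lifts are chain homotopic, so the class does not depend on the one chosen.\<close>

definition u_class ::
  "('a, 'm) monoid_scheme \<Rightarrow> (nat \<Rightarrow> ('a \<times> 'a, 'p) omodule) \<Rightarrow> (nat \<Rightarrow> ('a \<times> 'a, 'p, 'p) omap) \<Rightarrow>
    ('a \<times> 'a, 'p, int) omap \<Rightarrow> nat \<Rightarrow> ('a \<times> 'a, 'p, 'a tensor_elem) omap set"
  where "u_class \<pi> P d e n =
    cohomology_class (\<pi> \<times>\<times> \<pi>) (diag_family \<pi>) P d (I_pow \<pi> n) n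
      (SOME u. \<exists>f. chain_lift \<pi> P d e n f u)"

end

theory Submission
  imports Defs
begin

text \<open>
  The \<open>n\<close>-th syzygy of \<open>P\<close> is compared with \<open>I_pow \<pi> n\<close>: a chain map from the spliced sequence back to
  \<open>P\<close> restricts to \<open>\<psi> : I_pow \<pi> n \<rightarrow> P (n - 1)\<close> with image in the image of \<open>d (n - 1)\<close>, and the
  round trip on \<open>P\<close> is homotopic to the identity. A cocycle \<open>c\<close> factors through \<open>d (n - 1)\<close>, so \<open>\<psi>\<close> followed
  by the factor is the required \<open>\<phi>\<close>; the homotopy shows that \<open>\<phi>\<close> sends the canonical class to the class
  of \<open>c\<close>. The chain map exists because each \<open>MI \<pi> r\<close> is a retract of the free module on (r + 1)-tuples
  of equivariant maps, and the canonical class exists because the sequence splits over each orbit: every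
  member of the family fixes a point of \<open>\<pi>\<close>.
\<close>

section \<open>Universal property of the tensor product\<close>

text \<open>The principle is dimension shifting: the middle terms of the spliced sequence are
  projective, so Ext^n(Z, M) is a quotient of Hom(I^n, M) for n >= 1. As cohomology is computed on
  an arbitrary resolution \<open>P\<close> with its own carrier type, the shift is carried out by
  explicit maps between \<open>P\<close> and the sequence in both directions. The two directions
  rest on opposite properties of the family. Maps out of \<open>P\<close> need exactness of the
  sequence, which comes from the fixed points of its members. Maps into \<open>P\<close> need
  projectivity of \<open>MI \<pi> r\<close>, which comes from a converse: the stabilizer of a
  nonempty tuple in \<pi> is a finite intersection of conjugates of the diagonal, hence a member.
  The splittings over an orbit depend on a chosen map to \<pi> and need not be natural, so they give
  exactness objectwise but no morphisms of modules. For lifting, a retraction from the module on all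
  tuples suffices, so no basis of \<open>MI \<pi> r\<close> has to be exhibited.\<close>

definition multilinear :: "'b monoid list \<Rightarrow> ('c, 'm) monoid_scheme \<Rightarrow> ('b list \<Rightarrow> 'c) \<Rightarrow> bool"
  where "multilinear As C \<gamma> \<longleftrightarrow>
    (\<forall>xs\<in>tensor_gens As. \<gamma> xs \<in> carrier C) \<and>
    (\<forall>xs\<in>tensor_gens As. \<forall>i<length As. \<forall>x\<in>carrier (As ! i). \<forall>y\<in>carrier (As ! i).
      \<gamma> (xs[i := x \<otimes>\<^bsub>As ! i\<^esub> y]) = \<gamma> (xs[i := x]) \<otimes>\<^bsub>C\<^esub> \<gamma> (xs[i := y]))"

text \<open>The quotient map onto \<open>tensor As\<close>. For a tuple \<open>xs\<close>,
  \<open>tensor_class As (frag_of xs)\<close> is the elementary tensor of its entries.\<close>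

definition tensor_class :: "'b monoid list \<Rightarrow> ('b list \<Rightarrow>\<^sub>0 int) \<Rightarrow> ('b list \<Rightarrow>\<^sub>0 int) set"
  where "tensor_class As c = tensor_ker As #>\<^bsub>free_Abelian_group (tensor_gens As)\<^esub> c"

lemma tensor_gens_Nil [simp]: "tensor_gens [] = {[]}"
  by (simp add: tensor_gens_def)

lemma tensor_gens_Cons:
  "xs \<in> tensor_gens (A # As) \<longleftrightarrow> (\<exists>a as. xs = a # as \<and> a \<in> carrier A \<and> as \<in> tensor_gens As)"
  by (simp add: tensor_gens_def set_Cons_def)

lemma Cons_in_tensor_gens [simp]:
  "a # as \<in> tensor_gens (A # As) \<longleftrightarrow> a \<in> carrier A \<and> as \<in> tensor_gens As"
  by (auto simp: tensor_gens_Cons)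

lemma tensor_gens_iff:
  "xs \<in> tensor_gens As \<longleftrightarrow> length xs = length As \<and> (\<forall>i<length As. xs ! i \<in> carrier (As ! i))"
proof (induction As arbitrary: xs)
  case (Cons A As)
  show ?case
    by (cases xs) (auto simp: Cons.IH tensor_gens_Cons nth_Cons' less_Suc_eq_0_disj)
qed auto

lemma tensor_gens_update:
  "\<lbrakk>xs \<in> tensor_gens As; i < length As; x \<in> carrier (As ! i)\<rbrakk> \<Longrightarrow> xs[i := x] \<in> tensor_gens As"
  by (auto simp: tensor_gens_iff nth_list_update)

lemma multilinearI:
  assumes "\<And>xs. xs \<in> tensor_gens As \<Longrightarrow> \<gamma> xs \<in> carrier C"
    and "\<And>xs i x y. \<lbrakk>xs \<in> tensor_gens As; i < length As; x \<in> carrier (As ! i); y \<in> carrier (As ! i)\<rbrakk>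
      \<Longrightarrow> \<gamma> (xs[i := x \<otimes>\<^bsub>As ! i\<^esub> y]) = \<gamma> (xs[i := x]) \<otimes>\<^bsub>C\<^esub> \<gamma> (xs[i := y])"
  shows "multilinear As C \<gamma>"
  using assms by (auto simp: multilinear_def)

lemma multilinearD:
  assumes "multilinear As C \<gamma>" "xs \<in> tensor_gens As"
  shows "\<gamma> xs \<in> carrier C"
    "\<lbrakk>i < length As; x \<in> carrier (As ! i); y \<in> carrier (As ! i)\<rbrakk>
      \<Longrightarrow> \<gamma> (xs[i := x \<otimes>\<^bsub>As ! i\<^esub> y]) = \<gamma> (xs[i := x]) \<otimes>\<^bsub>C\<^esub> \<gamma> (xs[i := y])"
  using assms by (auto simp: multilinear_def)

lemma multilinear_Nil [simp]: "multilinear [] C \<gamma> \<longleftrightarrow> \<gamma> [] \<in> carrier C"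
  by (simp add: multilinear_def)

text \<open>Splitting off the first factor serves the inductions on the number of factors and fits
  \<open>MI \<pi> r\<close>, whose first factor differs from the others.\<close>

lemma multilinear_Cons:
  "multilinear (A # As) C \<gamma> \<longleftrightarrow>
    (\<forall>xs\<in>tensor_gens As. (\<lambda>a. \<gamma> (a # xs)) \<in> hom A C) \<and>
    (\<forall>a\<in>carrier A. multilinear As C (\<lambda>xs. \<gamma> (a # xs)))"
  (is "?l \<longleftrightarrow> ?r")
proof
  assume l: ?l
  show ?r
  proof (intro conjI ballI)
    fix xs assume xs: "xs \<in> tensor_gens As"
    show "(\<lambda>a. \<gamma> (a # xs)) \<in> hom A C"
    proof (rule homI)
      fix x y assume "x \<in> carrier A" "y \<in> carrier A"
      then show "\<gamma> (x \<otimes>\<^bsub>A\<^esub> y # xs) = \<gamma> (x # xs) \<otimes>\<^bsub>C\<^esub> \<gamma> (y # xs)"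
        using multilinearD(2)[OF l, of "x # xs" 0 x y] xs by simp
    qed (use multilinearD(1)[OF l] xs in simp)
  next
    fix a assume a: "a \<in> carrier A"
    show "multilinear As C (\<lambda>xs. \<gamma> (a # xs))"
    proof (rule multilinearI)
      fix xs i x y
      assume "xs \<in> tensor_gens As" "i < length As" "x \<in> carrier (As ! i)" "y \<in> carrier (As ! i)"
      then show "\<gamma> (a # xs[i := x \<otimes>\<^bsub>As ! i\<^esub> y]) = \<gamma> (a # xs[i := x]) \<otimes>\<^bsub>C\<^esub> \<gamma> (a # xs[i := y])"
        using multilinearD(2)[OF l, of "a # xs" "Suc i" x y] a by simp
    qed (use multilinearD(1)[OF l] a in simp)
  qed
next
  assume r: ?r
  show ?l
  proof (rule multilinearI)
    fix xs assume "xs \<in> tensor_gens (A # As)"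
    then show "\<gamma> xs \<in> carrier C"
      using r by (auto simp: tensor_gens_Cons multilinear_def)
  next
    fix xs i x y
    assume "xs \<in> tensor_gens (A # As)" and i: "i < length (A # As)"
      and xy: "x \<in> carrier ((A # As) ! i)" "y \<in> carrier ((A # As) ! i)"
    then obtain a as where xs: "xs = a # as" "a \<in> carrier A" "as \<in> tensor_gens As"
      by (auto simp: tensor_gens_Cons)
    show "\<gamma> (xs[i := x \<otimes>\<^bsub>(A # As) ! i\<^esub> y]) = \<gamma> (xs[i := x]) \<otimes>\<^bsub>C\<^esub> \<gamma> (xs[i := y])"
    proof (cases i)
      case 0
      then have "(\<lambda>a. \<gamma> (a # as)) \<in> hom A C" using r xs by blast
      from hom_mult[OF this, of x y] xy 0 show ?thesis by (simp add: xs)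
    next
      case (Suc j)
      then have "multilinear As C (\<lambda>xs. \<gamma> (a # xs))" using r xs by blast
      from multilinearD(2)[OF this xs(3), of j x y] xy i Suc show ?thesis by (simp add: xs)
    qed
  qed
qed

text \<open>This makes the tensor product functorial. The homomorphisms are indexed by a list
  \<open>Ms\<close> because an orbit map acts on each factor through the module it comes
  from.\<close>

lemma multilinear_map2:
  assumes \<gamma>: "multilinear Bs C \<gamma>" and len: "length Ms = length As" "length As = length Bs"
    and k: "\<And>i. i < length As \<Longrightarrow> k (Ms ! i) \<in> hom (As ! i) (Bs ! i)"
  shows "multilinear As C (\<lambda>xs. \<gamma> (map2 k Ms xs))"
    and "xs \<in> tensor_gens As \<Longrightarrow> map2 k Ms xs \<in> tensor_gens Bs"
proof -
  show gens: "map2 k Ms xs \<in> tensor_gens Bs" if "xs \<in> tensor_gens As" for xs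
    using that len hom_in_carrier[OF k] by (auto simp: tensor_gens_iff)
  have upd: "map2 k Ms (xs[i := x]) = (map2 k Ms xs)[i := k (Ms ! i) x]" if "length xs = length As" for xs i x
    
    using that len by (intro nth_equalityI; case_tac "ia = i") (auto simp: nth_list_update)
  show "multilinear As C (\<lambda>xs. \<gamma> (map2 k Ms xs))"
  proof (rule multilinearI)
    fix xs assume "xs \<in> tensor_gens As"
    then show "\<gamma> (map2 k Ms xs) \<in> carrier C" using gens multilinearD(1)[OF \<gamma>] by blast
  next
    fix xs i x y
    assume xs: "xs \<in> tensor_gens As" and i: "i < length As"
      and xy: "x \<in> carrier (As ! i)" "y \<in> carrier (As ! i)"
    show "\<gamma> (map2 k Ms (xs[i := x \<otimes>\<^bsub>As ! i\<^esub> y])) =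
        \<gamma> (map2 k Ms (xs[i := x])) \<otimes>\<^bsub>C\<^esub> \<gamma> (map2 k Ms (xs[i := y]))"
      using multilinearD(2)[OF \<gamma> gens[OF xs], of i "k (Ms ! i) x" "k (Ms ! i) y"]
        xs i xy len hom_in_carrier[OF k[OF i]] hom_mult[OF k[OF i]]
      by (simp add: upd tensor_gens_iff)
  qed
qed

lemma keys_diff_subset: "\<lbrakk>Poly_Mapping.keys a \<subseteq> S; Poly_Mapping.keys b \<subseteq> S\<rbrakk> \<Longrightarrow> Poly_Mapping.keys (a - b) \<subseteq> S"
  using keys_diff[of a b] by blast

lemma tensor_rels_subset:
  assumes "\<forall>A\<in>set As. group A"
  shows "tensor_rels As \<subseteq> carrier (free_Abelian_group (tensor_gens As))"
proof
  fix c assume "c \<in> tensor_rels As"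
  then obtain xs i x y where c: "c = frag_of (xs[i := x \<otimes>\<^bsub>As ! i\<^esub> y]) - frag_of (xs[i := x]) - frag_of (xs[i := y])"
    and h: "xs \<in> tensor_gens As" "i < length As" "x \<in> carrier (As ! i)" "y \<in> carrier (As ! i)"
    unfolding tensor_rels_def by blast
  interpret F: group "free_Abelian_group (tensor_gens As)" by simp
  have "x \<otimes>\<^bsub>As ! i\<^esub> y \<in> carrier (As ! i)"
    using h assms by (simp add: group.is_monoid monoid.m_closed)
  then have "xs[i := x \<otimes>\<^bsub>As ! i\<^esub> y] \<in> tensor_gens As" "xs[i := x] \<in> tensor_gens As" "xs[i := y] \<in> tensor_gens As"
    using h by (simp_all add: tensor_gens_update)
  then show "c \<in> carrier (free_Abelian_group (tensor_gens As))"
    unfolding c by (simp add: keys_diff_subset)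
qed

lemma tensor_ker_subgroup:
  assumes "\<forall>A\<in>set As. group A"
  shows "subgroup (tensor_ker As) (free_Abelian_group (tensor_gens As))"
  unfolding tensor_ker_def
  by (rule group.generate_is_subgroup) (use tensor_rels_subset[OF assms] in auto)

lemma
  assumes "\<forall>A\<in>set As. group A"
  shows comm_group_tensor: "comm_group (tensor As)"
    and tensor_class_hom: "tensor_class As \<in> hom (free_Abelian_group (tensor_gens As)) (tensor As)"
    and carrier_tensor: "carrier (tensor As) = tensor_class As ` carrier (free_Abelian_group (tensor_gens As))"
proof -
  interpret F: comm_group "free_Abelian_group (tensor_gens As)" by (rule abelian_free_Abelian_group)
  note s = tensor_ker_subgroup[OF assms]
  show "comm_group (tensor As)" unfolding tensor_def by (rule F.abelian_FactGroup[OF s])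
  show "tensor_class As \<in> hom (free_Abelian_group (tensor_gens As)) (tensor As)"
    using normal.r_coset_hom_Mod[OF F.subgroup_imp_normal[OF s]]
    unfolding tensor_def tensor_class_def[abs_def] .
  show "carrier (tensor As) = tensor_class As ` carrier (free_Abelian_group (tensor_gens As))"
    by (auto simp: tensor_def tensor_class_def FactGroup_def RCOSETS_def)
qed

text \<open>Elementary tensors generate: after composition with \<open>tensor_class As\<close> both
  maps live on a free abelian group, where generators decide.\<close>

lemma tensor_hom_eqI:
  assumes As: "\<forall>A\<in>set As. group A"
    and h: "h \<in> hom (tensor As) C" "k \<in> hom (tensor As) C" "group C"
    and eq: "\<And>xs. xs \<in> tensor_gens As \<Longrightarrow> h (tensor_class As (frag_of xs)) = k (tensor_class As (frag_of xs))"
    and T: "T \<in> carrier (tensor As)"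
  shows "h T = k T"
proof -
  obtain c where c: "T = tensor_class As c" "c \<in> carrier (free_Abelian_group (tensor_gens As))"
    using T carrier_tensor[OF As] by auto
  have "(h \<circ> tensor_class As) c = (k \<circ> tensor_class As) c"
    by (rule hom_free_eqI[OF hom_compose[OF tensor_class_hom[OF As] h(1)]
          hom_compose[OF tensor_class_hom[OF As] h(2)] h(3) _ c(2)]) (use eq in auto)
  then show ?thesis using c by simp
qed

text \<open>Justifies every map defined by evaluating on a representative: multilinearity on
  generators makes \<open>L\<close> kill \<open>tensor_rels As\<close>, so \<open>L\<close> is
  constant on each coset of \<open>tensor_ker As\<close>.\<close>

lemma tensor_lift:
  assumes As: "\<forall>A\<in>set As. group A" and C: "comm_group C"
    and L: "L \<in> hom (free_Abelian_group (tensor_gens As)) C"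
    and \<gamma>: "multilinear As C (\<lambda>xs. L (frag_of xs))"
  shows "c \<in> carrier (free_Abelian_group (tensor_gens As)) \<Longrightarrow> the_elem (L ` tensor_class As c) = L c"
    and "(\<lambda>T\<in>carrier (tensor As). the_elem (L ` T)) \<in> hom (tensor As) C"
proof -
  let ?F = "free_Abelian_group (tensor_gens As)"
  interpret C: comm_group C by (rule C)
  interpret F: group ?F by simp
  interpret L: group_hom ?F C L using L by unfold_locales
  have "tensor_rels As \<subseteq> kernel ?F C L"
  proof
    fix r assume r: "r \<in> tensor_rels As"
    then obtain xs i x y where rr: "r = frag_of (xs[i := x \<otimes>\<^bsub>As ! i\<^esub> y]) - frag_of (xs[i := x]) - frag_of (xs[i := y])"
      and h: "xs \<in> tensor_gens As" "i < length As" "x \<in> carrier (As ! i)" "y \<in> carrier (As ! i)"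
      unfolding tensor_rels_def by blast
    have rc: "r \<in> carrier ?F" using tensor_rels_subset[OF As] r by blast
    have g: "xs[i := x] \<in> tensor_gens As" "xs[i := y] \<in> tensor_gens As"
      using h by (simp_all add: tensor_gens_update)
    \<comment> \<open>The relation is solved for its leading generator, so that only products occur
      and \<open>L r\<close> can be cancelled.\<close>
    have "frag_of (xs[i := x \<otimes>\<^bsub>As ! i\<^esub> y]) = r \<otimes>\<^bsub>?F\<^esub> (frag_of (xs[i := x]) \<otimes>\<^bsub>?F\<^esub> frag_of (xs[i := y]))"
      by (simp add: rr)
    also have "L \<dots> = L r \<otimes>\<^bsub>C\<^esub> (L (frag_of (xs[i := x])) \<otimes>\<^bsub>C\<^esub> L (frag_of (xs[i := y])))"
      using rc g by (simp only: L.hom_mult F.m_closed frag_of_in_free_Abelian_group)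
    finally have "L r \<otimes>\<^bsub>C\<^esub> (L (frag_of (xs[i := x])) \<otimes>\<^bsub>C\<^esub> L (frag_of (xs[i := y])))
      = L (frag_of (xs[i := x])) \<otimes>\<^bsub>C\<^esub> L (frag_of (xs[i := y]))"
      using multilinearD(2)[OF \<gamma> h] by simp
    moreover have "L (frag_of (xs[i := x])) \<otimes>\<^bsub>C\<^esub> L (frag_of (xs[i := y])) \<in> carrier C"
      using multilinearD(1)[OF \<gamma>] g by (simp only: C.m_closed)
    ultimately have "L r = \<one>\<^bsub>C\<^esub>"
      using C.right_cancel[OF _ L.hom_closed[OF rc] C.one_closed] by (simp only: C.l_one)
    then show "r \<in> kernel ?F C L" using rc by (simp add: kernel_def)
  qed
  then have ker: "tensor_ker As \<subseteq> kernel ?F C L"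
    unfolding tensor_ker_def by (rule F.generate_subgroup_incl[OF _ L.subgroup_kernel])
  show lift: "the_elem (L ` tensor_class As c) = L c" if c: "c \<in> carrier ?F" for c
  proof -
    \<comment> \<open>The unit shows that the coset is nonempty; with constancy of \<open>L\<close>
      its image is then a singleton, as \<open>the_elem\<close> requires.\<close>
    have "\<one>\<^bsub>?F\<^esub> \<in> tensor_ker As" using subgroup.one_closed[OF tensor_ker_subgroup[OF As]] by simp
    moreover have "L (k \<otimes>\<^bsub>?F\<^esub> c) = L c" if "k \<in> tensor_ker As" for k
    proof -
      have "k \<in> carrier ?F" "L k = \<one>\<^bsub>C\<^esub>" using ker that by (auto simp: kernel_def)
      then show ?thesis using L.hom_mult[OF _ c, of k] L.hom_closed[OF c] by simp
    qed
    ultimately have "L ` tensor_class As c = {L c}"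
      unfolding tensor_class_def r_coset_def by (auto simp del: mult_free_Abelian_group simp: image_iff)
    then show ?thesis by simp
  qed
  show "(\<lambda>T\<in>carrier (tensor As). the_elem (L ` T)) \<in> hom (tensor As) C"
  proof (rule homI)
    fix T U assume T: "T \<in> carrier (tensor As)" and U: "U \<in> carrier (tensor As)"
    then obtain c e where c: "T = tensor_class As c" "c \<in> carrier ?F"
      and e: "U = tensor_class As e" "e \<in> carrier ?F"
      using carrier_tensor[OF As] by auto
    have "T \<otimes>\<^bsub>tensor As\<^esub> U = tensor_class As (c \<otimes>\<^bsub>?F\<^esub> e)"
      using hom_mult[OF tensor_class_hom[OF As] c(2) e(2)] c e by simp
    moreover have "T \<otimes>\<^bsub>tensor As\<^esub> U \<in> carrier (tensor As)"
      using T U comm_group_tensor[OF As] by (simp add: comm_group_def group.is_monoid monoid.m_closed)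
    ultimately show "(\<lambda>T\<in>carrier (tensor As). the_elem (L ` T)) (T \<otimes>\<^bsub>tensor As\<^esub> U) =
        (\<lambda>T\<in>carrier (tensor As). the_elem (L ` T)) T \<otimes>\<^bsub>C\<^esub> (\<lambda>T\<in>carrier (tensor As). the_elem (L ` T)) U"
      using T U c e lift L.hom_mult F.m_closed[OF c(2) e(2)] by (simp del: mult_free_Abelian_group)
  next
    fix T assume T: "T \<in> carrier (tensor As)"
    then show "(\<lambda>T\<in>carrier (tensor As). the_elem (L ` T)) T \<in> carrier C"
      using carrier_tensor[OF As] lift L.hom_closed by auto
  qed
qed

text \<open>Extensionality is part of the conclusion because the components of a natural
  transformation must be extensional.\<close>

lemma tensor_universal:
  assumes As: "\<forall>A\<in>set As. group A" and C: "comm_group C" and \<gamma>: "multilinear As C \<gamma>"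
  obtains t where "t \<in> hom (tensor As) C" "t \<in> extensional (carrier (tensor As))"
    "\<And>xs. xs \<in> tensor_gens As \<Longrightarrow> t (tensor_class As (frag_of xs)) = \<gamma> xs"
proof -
  interpret C: comm_group C by (rule C)
  obtain L where L: "L \<in> hom (free_Abelian_group (tensor_gens As)) C"
    and Lg: "\<And>xs. xs \<in> tensor_gens As \<Longrightarrow> L (frag_of xs) = \<gamma> xs"
    by (rule C.free_Abelian_group_universal[of \<gamma> "tensor_gens As"]) (use multilinearD(1)[OF \<gamma>] in auto)
  have m: "multilinear As C (\<lambda>xs. L (frag_of xs))"
  proof (rule multilinearI)
    fix xs i x y assume h: "xs \<in> tensor_gens As" "i < length As" "x \<in> carrier (As ! i)" "y \<in> carrier (As ! i)"
    have "x \<otimes>\<^bsub>As ! i\<^esub> y \<in> carrier (As ! i)"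
      using h As by (simp add: group.is_monoid monoid.m_closed)
    then show "L (frag_of (xs[i := x \<otimes>\<^bsub>As ! i\<^esub> y])) = L (frag_of (xs[i := x])) \<otimes>\<^bsub>C\<^esub> L (frag_of (xs[i := y]))"
      using multilinearD(2)[OF \<gamma> h] h by (simp add: Lg tensor_gens_update)
  qed (use Lg multilinearD(1)[OF \<gamma>] in simp)
  have gen: "tensor_class As (frag_of xs) \<in> carrier (tensor As)" if "xs \<in> tensor_gens As" for xs
    using hom_in_carrier[OF tensor_class_hom[OF As]] that by simp
  show thesis
    by (rule that[OF tensor_lift(2)[OF As C L m]])
      (use gen Lg tensor_lift(1)[OF As C L m] in auto)
qed

lemma multilinear_tensor_class:
  assumes As: "\<forall>A\<in>set As. group A"
  shows "multilinear As (tensor As) (\<lambda>xs. tensor_class As (frag_of xs))"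
proof (rule multilinearI)
  let ?F = "free_Abelian_group (tensor_gens As)"
  note hom = tensor_class_hom[OF As]
  fix xs assume xs: "xs \<in> tensor_gens As"
  then show "tensor_class As (frag_of xs) \<in> carrier (tensor As)"
    using hom_in_carrier[OF hom] by simp
  fix i x y assume h: "i < length As" "x \<in> carrier (As ! i)" "y \<in> carrier (As ! i)"
  interpret F: comm_group ?F by (rule abelian_free_Abelian_group)
  interpret T: comm_group "tensor As" by (rule comm_group_tensor[OF As])
  define r where "r = frag_of (xs[i := x \<otimes>\<^bsub>As ! i\<^esub> y]) - frag_of (xs[i := x]) - frag_of (xs[i := y])"
  have rr: "r \<in> tensor_rels As" unfolding r_def tensor_rels_def using xs h by blast
  then have rc: "r \<in> carrier ?F" and rk: "r \<in> tensor_ker As"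
    using subsetD[OF tensor_rels_subset[OF As]] by (auto simp: tensor_ker_def simp del: carrier_free_Abelian_group_iff intro: generate.incl)
  have g: "frag_of (xs[i := x]) \<in> carrier ?F" "frag_of (xs[i := y]) \<in> carrier ?F"
    using h xs by (simp_all add: tensor_gens_update)
  have "tensor_class As r = \<one>\<^bsub>tensor As\<^esub>"
    using F.coset_join2[OF rc tensor_ker_subgroup[OF As] rk]
    by (simp add: tensor_class_def tensor_def FactGroup_def)
  moreover have "frag_of (xs[i := x \<otimes>\<^bsub>As ! i\<^esub> y]) = r \<otimes>\<^bsub>?F\<^esub> (frag_of (xs[i := x]) \<otimes>\<^bsub>?F\<^esub> frag_of (xs[i := y]))"
    by (simp add: r_def)
  ultimately show "tensor_class As (frag_of (xs[i := x \<otimes>\<^bsub>As ! i\<^esub> y])) =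
    tensor_class As (frag_of (xs[i := x])) \<otimes>\<^bsub>tensor As\<^esub> tensor_class As (frag_of (xs[i := y]))"
    using hom_mult[OF hom rc F.m_closed[OF g]] hom_mult[OF hom g] hom_in_carrier[OF hom] rc g
    by (simp del: mult_free_Abelian_group carrier_free_Abelian_group_iff)
qed

text \<open>Multilinearity is asked of \<open>g\<close> only modulo \<open>tensor_ker Bs\<close>: a
  typical \<open>g\<close> such as \<open>frag_of\<close> is multilinear only after passing to
  classes.\<close>

lemma tensor_hom_props:
  assumes As: "\<forall>A\<in>set As. group A" and Bs: "\<forall>B\<in>set Bs. group B"
    and g: "\<And>xs. xs \<in> tensor_gens As \<Longrightarrow> g xs \<in> carrier (free_Abelian_group (tensor_gens Bs))"
    and m: "multilinear As (tensor Bs) (\<lambda>xs. tensor_class Bs (g xs))"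
  shows "tensor_hom As Bs g \<in> hom (tensor As) (tensor Bs)"
    and "xs \<in> tensor_gens As \<Longrightarrow> tensor_hom As Bs g (tensor_class As (frag_of xs)) = tensor_class Bs (g xs)"
proof -
  let ?L = "tensor_class Bs \<circ> frag_extend g"
  have "frag_extend g \<in> hom (free_Abelian_group (tensor_gens As)) (free_Abelian_group (tensor_gens Bs))"
    by (rule hom_frag_extend) (use g in simp)
  then have L: "?L \<in> hom (free_Abelian_group (tensor_gens As)) (tensor Bs)"
    by (rule hom_compose[OF _ tensor_class_hom[OF Bs]])
  have m': "multilinear As (tensor Bs) (\<lambda>xs. ?L (frag_of xs))" using m by simp
  have eq: "tensor_hom As Bs g = (\<lambda>T\<in>carrier (tensor As). the_elem (?L ` T))"
    by (simp add: tensor_hom_def tensor_class_def comp_def)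
  show "tensor_hom As Bs g \<in> hom (tensor As) (tensor Bs)"
    unfolding eq by (rule tensor_lift(2)[OF As comm_group_tensor[OF Bs] L m'])
  show "tensor_hom As Bs g (tensor_class As (frag_of xs)) = tensor_class Bs (g xs)" if "xs \<in> tensor_gens As"
    using tensor_lift(1)[OF As comm_group_tensor[OF Bs] L m', where c = "frag_of xs"]
      hom_in_carrier[OF tensor_class_hom[OF As], where x = "frag_of xs"] that
    by (simp add: eq)
qed

section \<open>Tensor products of modules\<close>

lemma obj_tensor_omod [simp]: "obj (tensor_omod Ms) X = tensor (map (\<lambda>M. obj M X) Ms)"
  by (simp add: tensor_omod_def)

lemma omod_groups:
  assumes "\<forall>M\<in>set Ms. is_omodule G F M" "X \<in> orbits G F"
  shows "\<forall>A\<in>set (map (\<lambda>M. obj M X) Ms). group A"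
  using assms is_omoduleD(2) by fastforce

lemma tensor_omod_arr:
  assumes Ms: "\<forall>M\<in>set Ms. is_omodule G F M"
    and X: "X \<in> orbits G F" and Y: "Y \<in> orbits G F" and f: "f \<in> orbit_maps G X Y"
  shows "arr (tensor_omod Ms) X Y f \<in> hom (obj (tensor_omod Ms) Y) (obj (tensor_omod Ms) X)"
    and "ys \<in> tensor_gens (map (\<lambda>M. obj M Y) Ms) \<Longrightarrow>
      map2 (\<lambda>M. arr M X Y f) Ms ys \<in> tensor_gens (map (\<lambda>M. obj M X) Ms)"
    and "ys \<in> tensor_gens (map (\<lambda>M. obj M Y) Ms) \<Longrightarrow>
      arr (tensor_omod Ms) X Y f (tensor_class (map (\<lambda>M. obj M Y) Ms) (frag_of ys)) =
        tensor_class (map (\<lambda>M. obj M X) Ms) (frag_of (map2 (\<lambda>M. arr M X Y f) Ms ys))"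
proof -
  let ?A = "map (\<lambda>M. obj M Y) Ms" and ?B = "map (\<lambda>M. obj M X) Ms"
  have k: "arr (Ms ! i) X Y f \<in> hom (?A ! i) (?B ! i)" if "i < length ?A" for i
    using that is_omoduleD(3)[OF bspec[OF Ms nth_mem] X Y f] by simp
  note m = multilinear_map2[OF multilinear_tensor_class[OF omod_groups[OF Ms X]], where Ms = Ms and As = ?A
      and k = "\<lambda>M. arr M X Y f"]
  show g: "map2 (\<lambda>M. arr M X Y f) Ms ys \<in> tensor_gens ?B" if "ys \<in> tensor_gens ?A" for ys
    by (rule m(2)) (use k that in auto)
  have ml: "multilinear ?A (tensor ?B) (\<lambda>xs. tensor_class ?B (frag_of (map2 (\<lambda>M. arr M X Y f) Ms xs)))"
    by (rule m(1)) (use k in auto)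
  note p = tensor_hom_props[OF omod_groups[OF Ms Y] omod_groups[OF Ms X] _ ml]
  show "arr (tensor_omod Ms) X Y f \<in> hom (obj (tensor_omod Ms) Y) (obj (tensor_omod Ms) X)"
    using p(1) g by (simp add: tensor_omod_def)
  show "arr (tensor_omod Ms) X Y f (tensor_class ?A (frag_of ys)) =
      tensor_class ?B (frag_of (map2 (\<lambda>M. arr M X Y f) Ms ys))" if "ys \<in> tensor_gens ?A"
    using p(2)[OF _ that] g by (simp add: tensor_omod_def)
qed

text \<open>Both functor laws hold entry by entry on tuples and extend because elementary tensors
  generate. Closure of orbit maps is assumed here since its proof depends on \<open>G\<close> being
  a group that contains the members of \<open>F\<close>.\<close>

lemma is_omodule_tensor_omod:
  assumes Ms: "\<forall>M\<in>set Ms. is_omodule G F M"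
    and comp: "\<And>X Y Z f g. \<lbrakk>X \<in> orbits G F; f \<in> orbit_maps G X Y; g \<in> orbit_maps G Y Z\<rbrakk>
      \<Longrightarrow> compose X g f \<in> orbit_maps G X Z"
    and idm: "\<And>X. X \<in> orbits G F \<Longrightarrow> (\<lambda>C\<in>X. C) \<in> orbit_maps G X X"
  shows "is_omodule G F (tensor_omod Ms)"
proof -
  let ?T = "tensor_omod Ms" and ?A = "\<lambda>X. map (\<lambda>M. obj M X) Ms"
  note arr = tensor_omod_arr[OF Ms] and gr = omod_groups[OF Ms]
  have len: "length xs = length Ms" if "xs \<in> tensor_gens (?A X)" for xs X
    using that by (simp add: tensor_gens_iff)
  have nth: "xs ! i \<in> carrier (obj (Ms ! i) X)" if "xs \<in> tensor_gens (?A X)" "i < length Ms" for xs X i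
    using that by (simp add: tensor_gens_iff)
  have comm: "comm_group (obj ?T X)" if "X \<in> orbits G F" for X
    using comm_group_tensor[OF gr[OF that]] by simp
  have 1: "arr ?T X X (\<lambda>C\<in>X. C) T = T" if X: "X \<in> orbits G F" and T: "T \<in> carrier (obj ?T X)" for X T
  proof -
    have "arr ?T X X (\<lambda>C\<in>X. C) T = id T"
    proof (rule tensor_hom_eqI[OF gr[OF X], where k = id and C = "obj ?T X"])
      fix xs assume xs: "xs \<in> tensor_gens (?A X)"
      have "map2 (\<lambda>M. arr M X X (\<lambda>C\<in>X. C)) Ms xs = xs"
        using len[OF xs] nth[OF xs] is_omoduleD(5)[OF bspec[OF Ms nth_mem] X] by (intro nth_equalityI) auto
      then show "arr ?T X X (\<lambda>C\<in>X. C) (tensor_class (?A X) (frag_of xs)) = id (tensor_class (?A X) (frag_of xs))"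
        using arr(3)[OF X X idm[OF X] xs] by simp
    next
      show "id \<in> hom (tensor (?A X)) (obj ?T X)" by (auto simp: hom_def)
      show "arr ?T X X (\<lambda>C\<in>X. C) \<in> hom (tensor (?A X)) (obj ?T X)"
        using arr(1)[OF X X idm[OF X]] unfolding obj_tensor_omod .
    qed (use T comm[OF X] in \<open>simp_all add: comm_group_def\<close>)
    then show ?thesis by simp
  qed
  have 2: "arr ?T X Z (compose X g f) T = arr ?T X Y f (arr ?T Y Z g T)"
    if X: "X \<in> orbits G F" and Y: "Y \<in> orbits G F" and Z: "Z \<in> orbits G F"
      and f: "f \<in> orbit_maps G X Y" and g: "g \<in> orbit_maps G Y Z" and T: "T \<in> carrier (obj ?T Z)"
    for X Y Z f g T
  proof -
    have "arr ?T X Z (compose X g f) T = (arr ?T X Y f \<circ> arr ?T Y Z g) T"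
    proof (rule tensor_hom_eqI[OF gr[OF Z], where h = "arr ?T X Z (compose X g f)" and C = "obj ?T X"])
      fix xs assume xs: "xs \<in> tensor_gens (?A Z)"
      have "map2 (\<lambda>M. arr M X Z (compose X g f)) Ms xs =
          map2 (\<lambda>M. arr M X Y f) Ms (map2 (\<lambda>M. arr M Y Z g) Ms xs)"
        using len[OF xs] nth[OF xs] is_omoduleD(6)[OF bspec[OF Ms nth_mem] X Y Z f g] by (intro nth_equalityI) auto
      then show "arr ?T X Z (compose X g f) (tensor_class (?A Z) (frag_of xs)) =
          (arr ?T X Y f \<circ> arr ?T Y Z g) (tensor_class (?A Z) (frag_of xs))"
        using arr(3)[OF X Z comp[OF X f g] xs] arr(3)[OF Y Z g xs] arr(3)[OF X Y f arr(2)[OF Y Z g xs]]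
        by simp
    next
      show "arr ?T X Z (compose X g f) \<in> hom (tensor (?A Z)) (obj ?T X)"
        using arr(1)[OF X Z comp[OF X f g]] by simp
      show "arr ?T X Y f \<circ> arr ?T Y Z g \<in> hom (tensor (?A Z)) (obj ?T X)"
        using hom_compose[OF arr(1)[OF Y Z g] arr(1)[OF X Y f]] by simp
    qed (use T comm[OF X] in \<open>auto simp: comm_group_def\<close>)
    then show ?thesis by simp
  qed
  show ?thesis
    unfolding is_omodule_def by (intro conjI ballI comm arr(1) 1 2)
qed

text \<open>Both sides of the naturality square are homomorphisms on a tensor product, so the square
  commutes once it does on elementary tensors.\<close>

lemma tensor_nat_transI:
  assumes Ms: "\<forall>M\<in>set Ms. is_omodule G F M" and N: "is_omodule G F N"
    and ext: "\<eta> \<in> extensional (orbits G F)"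
      "\<And>X. X \<in> orbits G F \<Longrightarrow> \<eta> X \<in> extensional (carrier (obj (tensor_omod Ms) X))"
    and hom: "\<And>X. X \<in> orbits G F \<Longrightarrow> \<eta> X \<in> hom (obj (tensor_omod Ms) X) (obj N X)"
    and nat: "\<And>X Y f ys. \<lbrakk>X \<in> orbits G F; Y \<in> orbits G F; f \<in> orbit_maps G X Y;
        ys \<in> tensor_gens (map (\<lambda>M. obj M Y) Ms)\<rbrakk> \<Longrightarrow>
      \<eta> X (tensor_class (map (\<lambda>M. obj M X) Ms) (frag_of (map2 (\<lambda>M. arr M X Y f) Ms ys))) =
      arr N X Y f (\<eta> Y (tensor_class (map (\<lambda>M. obj M Y) Ms) (frag_of ys)))"
  shows "\<eta> \<in> nat_trans G F (tensor_omod Ms) N"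
proof -
  let ?T = "tensor_omod Ms" and ?A = "\<lambda>X. map (\<lambda>M. obj M X) Ms"
  have "\<eta> X (arr ?T X Y f y) = arr N X Y f (\<eta> Y y)"
    if X: "X \<in> orbits G F" and Y: "Y \<in> orbits G F" and f: "f \<in> orbit_maps G X Y"
      and y: "y \<in> carrier (obj ?T Y)" for X Y f y
  proof -
    have "(\<eta> X \<circ> arr ?T X Y f) y = (arr N X Y f \<circ> \<eta> Y) y"
    proof (rule tensor_hom_eqI[OF omod_groups[OF Ms Y]])
      show "\<eta> X \<circ> arr ?T X Y f \<in> hom (tensor (?A Y)) (obj N X)"
        using hom_compose[OF tensor_omod_arr(1)[OF Ms X Y f] hom[OF X]] by simp
      show "arr N X Y f \<circ> \<eta> Y \<in> hom (tensor (?A Y)) (obj N X)"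
        using hom_compose[OF hom[OF Y] is_omoduleD(3)[OF N X Y f]] by simp
      show "(\<eta> X \<circ> arr ?T X Y f) (tensor_class (?A Y) (frag_of xs)) =
          (arr N X Y f \<circ> \<eta> Y) (tensor_class (?A Y) (frag_of xs))" if "xs \<in> tensor_gens (?A Y)" for xs
        using tensor_omod_arr(3)[OF Ms X Y f that] nat[OF X Y f that] by simp
    qed (use y is_omoduleD(2)[OF N X] in auto)
    then show ?thesis by simp
  qed
  then show ?thesis
    using ext hom hom_in_carrier[OF hom] unfolding nat_trans_def PiE_def Pi_def by auto
qed

text \<open>Common criterion for \<open>incl\<close> and \<open>aug_tensor\<close>, which are both
  given by a formula \<open>g\<close> on tuples.\<close>

lemma tensor_omap_nat_trans:
  assumes Ms: "\<forall>M\<in>set Ms. is_omodule G F M" and Ns: "\<forall>N\<in>set Ns. is_omodule G F N"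
    and TN: "is_omodule G F (tensor_omod Ns)"
    and g: "\<And>X xs. \<lbrakk>X \<in> orbits G F; xs \<in> tensor_gens (map (\<lambda>M. obj M X) Ms)\<rbrakk> \<Longrightarrow>
      g xs \<in> carrier (free_Abelian_group (tensor_gens (map (\<lambda>N. obj N X) Ns)))"
    and m: "\<And>X. X \<in> orbits G F \<Longrightarrow> multilinear (map (\<lambda>M. obj M X) Ms) (tensor (map (\<lambda>N. obj N X) Ns))
      (\<lambda>xs. tensor_class (map (\<lambda>N. obj N X) Ns) (g xs))"
    and nat: "\<And>X Y f ys. \<lbrakk>X \<in> orbits G F; Y \<in> orbits G F; f \<in> orbit_maps G X Y;
        ys \<in> tensor_gens (map (\<lambda>M. obj M Y) Ms)\<rbrakk> \<Longrightarrow>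
      tensor_class (map (\<lambda>N. obj N X) Ns) (g (map2 (\<lambda>M. arr M X Y f) Ms ys)) =
      arr (tensor_omod Ns) X Y f (tensor_class (map (\<lambda>N. obj N Y) Ns) (g ys))"
  shows "tensor_omap G F Ms Ns g \<in> nat_trans G F (tensor_omod Ms) (tensor_omod Ns)"
    and "\<lbrakk>X \<in> orbits G F; xs \<in> tensor_gens (map (\<lambda>M. obj M X) Ms)\<rbrakk> \<Longrightarrow>
      tensor_omap G F Ms Ns g X (tensor_class (map (\<lambda>M. obj M X) Ms) (frag_of xs)) =
      tensor_class (map (\<lambda>N. obj N X) Ns) (g xs)"
proof -
  note p = tensor_hom_props[OF omod_groups[OF Ms] omod_groups[OF Ns] g m]
  show val: "tensor_omap G F Ms Ns g X (tensor_class (map (\<lambda>M. obj M X) Ms) (frag_of xs)) =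
      tensor_class (map (\<lambda>N. obj N X) Ns) (g xs)"
    if "X \<in> orbits G F" "xs \<in> tensor_gens (map (\<lambda>M. obj M X) Ms)" for X xs
    using p(2) that by (simp add: tensor_omap_def)
  show "tensor_omap G F Ms Ns g \<in> nat_trans G F (tensor_omod Ms) (tensor_omod Ns)"
  proof (rule tensor_nat_transI[OF Ms TN])
    show "tensor_omap G F Ms Ns g \<in> extensional (orbits G F)" by (simp add: tensor_omap_def)
    fix X assume X: "X \<in> orbits G F"
    show "tensor_omap G F Ms Ns g X \<in> extensional (carrier (obj (tensor_omod Ms) X))"
      using X by (simp add: tensor_omap_def tensor_hom_def)
    show "tensor_omap G F Ms Ns g X \<in> hom (obj (tensor_omod Ms) X) (obj (tensor_omod Ns) X)"
      using p(1)[OF X X X _ X] X by (simp add: tensor_omap_def)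
  next
    fix X Y f ys
    assume h: "X \<in> orbits G F" "Y \<in> orbits G F" "f \<in> orbit_maps G X Y"
      "ys \<in> tensor_gens (map (\<lambda>M. obj M Y) Ms)"
    show "tensor_omap G F Ms Ns g X (tensor_class (map (\<lambda>M. obj M X) Ms) (frag_of (map2 (\<lambda>M. arr M X Y f) Ms ys))) =
      arr (tensor_omod Ns) X Y f (tensor_omap G F Ms Ns g Y (tensor_class (map (\<lambda>M. obj M Y) Ms) (frag_of ys)))"
      using nat[OF h] val[OF h(1) tensor_omod_arr(2)[OF Ms h]] val[OF h(2,4)] by simp
  qed
qed

section \<open>The augmentation of a free abelian group, and operations on multilinear maps\<close>

lemma coeff_sum_superset:
  assumes "finite S" "Poly_Mapping.keys c \<subseteq> S"
  shows "coeff_sum c = (\<Sum>x\<in>S. Poly_Mapping.lookup c x)"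
  unfolding coeff_sum_def
  by (rule sum.mono_neutral_left) (use assms in \<open>auto simp: in_keys_iff\<close>)

lemma coeff_sum_add: "coeff_sum (a + b) = coeff_sum a + coeff_sum b"
proof -
  let ?S = "Poly_Mapping.keys a \<union> Poly_Mapping.keys b"
  have "coeff_sum (a + b) = (\<Sum>x\<in>?S. Poly_Mapping.lookup (a + b) x)"
    by (rule coeff_sum_superset) (auto dest: subsetD[OF keys_add])
  also have "\<dots> = (\<Sum>x\<in>?S. Poly_Mapping.lookup a x) + (\<Sum>x\<in>?S. Poly_Mapping.lookup b x)"
    by (simp add: lookup_add sum.distrib)
  finally show ?thesis
    using coeff_sum_superset[of ?S a] coeff_sum_superset[of ?S b] by simp
qed

lemma coeff_sum_of [simp]: "coeff_sum (frag_of x) = 1"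
  by (simp add: coeff_sum_def)

lemma coeff_sum_hom: "coeff_sum \<in> hom (free_Abelian_group S) integer_group"
  by (simp add: hom_def coeff_sum_add)

lemma coeff_sum_diff: "coeff_sum (a - b) = coeff_sum a - coeff_sum b"
  using coeff_sum_add[of "a - b" b] by simp

lemma coeff_sum_cmul: "coeff_sum (frag_cmul n a) = n * coeff_sum a"
proof -
  have "Poly_Mapping.keys (frag_cmul n a) \<subseteq> Poly_Mapping.keys a" by (rule keys_cmul)
  from coeff_sum_superset[OF _ this] show ?thesis
    by (simp add: coeff_sum_def sum_distrib_left)
qed

text \<open>Restriction along an orbit map replaces basis elements by basis elements. Hence it
  preserves the augmentation, which makes I a submodule of \<open>M_pi \<pi>\<close>.\<close>

lemma coeff_sum_frag_extend:
  assumes "\<And>x. coeff_sum (g x) = 1"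
  shows "coeff_sum (frag_extend g c) = coeff_sum c"
proof -
  have "c \<in> carrier (free_Abelian_group UNIV)" by simp
  moreover have "frag_extend g \<in> hom (free_Abelian_group UNIV) (free_Abelian_group UNIV)"
    by (rule hom_frag_extend) simp
  ultimately show ?thesis
    using hom_free_eqI[OF hom_compose[OF _ coeff_sum_hom] coeff_sum_hom, of "frag_extend g" UNIV UNIV c] assms
    by simp
qed

lemma multilinear_hom:
  assumes \<gamma>: "multilinear As C \<gamma>" and h: "h \<in> hom C D" and As: "\<forall>A\<in>set As. group A"
  shows "multilinear As D (\<lambda>xs. h (\<gamma> xs))"
proof (rule multilinearI)
  fix xs i x y assume xs: "xs \<in> tensor_gens As" "i < length As" "x \<in> carrier (As ! i)" "y \<in> carrier (As ! i)"
  then have "xs[i := x] \<in> tensor_gens As" "xs[i := y] \<in> tensor_gens As"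
    by (simp_all add: tensor_gens_update)
  then show "h (\<gamma> (xs[i := x \<otimes>\<^bsub>As ! i\<^esub> y])) = h (\<gamma> (xs[i := x])) \<otimes>\<^bsub>D\<^esub> h (\<gamma> (xs[i := y]))"
    using multilinearD[OF \<gamma>] xs hom_mult[OF h] by simp
qed (use multilinearD(1)[OF \<gamma>] hom_in_carrier[OF h] in simp)

lemma multilinear_cong:
  assumes \<gamma>: "multilinear As C \<gamma>" and eq: "\<And>xs. xs \<in> tensor_gens As \<Longrightarrow> \<gamma>' xs = \<gamma> xs" and As: "\<forall>A\<in>set As. group A"
  shows "multilinear As C \<gamma>'"
proof (rule multilinearI)
  fix xs i x y assume h: "xs \<in> tensor_gens As" "i < length As" "x \<in> carrier (As ! i)" "y \<in> carrier (As ! i)"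
  have "x \<otimes>\<^bsub>As ! i\<^esub> y \<in> carrier (As ! i)"
    using h As by (simp add: group.is_monoid monoid.m_closed)
  then show "\<gamma>' (xs[i := x \<otimes>\<^bsub>As ! i\<^esub> y]) = \<gamma>' (xs[i := x]) \<otimes>\<^bsub>C\<^esub> \<gamma>' (xs[i := y])"
    using multilinearD(2)[OF \<gamma> h] h by (simp add: eq tensor_gens_update)
qed (use multilinearD(1)[OF \<gamma>] eq in simp)

section \<open>The modules \<open>M_pi\<close> and I\<close>

locale discrete_group =
  fixes \<pi> :: "('a, 'm) monoid_scheme"
  assumes grp: "group \<pi>"
begin

abbreviation "GG \<equiv> \<pi> \<times>\<times> \<pi>"
abbreviation "\<D> \<equiv> diag_family \<pi>"
abbreviation "Orb \<equiv> orbits GG \<D>"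
abbreviation "Mor \<equiv> orbit_maps GG"
abbreviation "act \<equiv> pi_action \<pi>"
abbreviation "Maps X \<equiv> equivariant_maps GG X (l_coset GG) (carrier \<pi>) act"
abbreviation "Mb X \<equiv> obj (M_pi \<pi>) X"
abbreviation "Ib X \<equiv> obj (I_mod \<pi>) X"

lemma group_GG: "group GG"
  by (rule DirProd_group[OF grp grp])

lemma D_subset: "H \<in> \<D> \<Longrightarrow> H \<subseteq> carrier GG"
  by (rule diag_family_subset[OF grp])

lemma closed_orbit: "\<lbrakk>X \<in> Orb; a \<in> carrier GG; C \<in> X\<rbrakk> \<Longrightarrow> a <#\<^bsub>GG\<^esub> C \<in> X"
  by (rule orbit_closed[OF group_GG D_subset])

lemma Mor_id: "X \<in> Orb \<Longrightarrow> (\<lambda>C\<in>X. C) \<in> Mor X X"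
  by (rule orbit_maps_id[OF group_GG D_subset])

lemma Mor_compose: "\<lbrakk>X \<in> Orb; f \<in> Mor X Y; g \<in> Mor Y Z\<rbrakk> \<Longrightarrow> compose X g f \<in> Mor X Z"
  by (rule orbit_maps_compose[OF group_GG D_subset])

lemma is_omodule_tensor: "\<forall>M\<in>set Ms. is_omodule GG \<D> M \<Longrightarrow> is_omodule GG \<D> (tensor_omod Ms)"
  by (rule is_omodule_tensor_omod) (auto intro: Mor_compose Mor_id)

lemma Maps_compose:
  assumes "X \<in> Orb" "f \<in> Mor X Y" "u \<in> Maps Y"
  shows "compose X u f \<in> Maps X"
  using assms closed_orbit[OF assms(1)]
  by (auto simp: orbit_maps_def equivariant_maps_def compose_def PiE_iff)

lemma obj_M_pi: "Mb X = free_Abelian_group (Maps X)"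
  by (simp add: M_pi_def)

lemma arr_M_pi: "arr (M_pi \<pi>) X Y f = frag_extend (\<lambda>u. frag_of (compose X u f))"
  by (simp add: M_pi_def)

lemma arr_M_pi_hom:
  assumes "X \<in> Orb" "f \<in> Mor X Y"
  shows "arr (M_pi \<pi>) X Y f \<in> hom (Mb Y) (Mb X)"
  unfolding arr_M_pi obj_M_pi by (rule hom_frag_extend) (use Maps_compose[OF assms] in simp)

lemma Maps_compose_id: "u \<in> Maps X \<Longrightarrow> compose X u (\<lambda>C\<in>X. C) = u"
  by (auto simp: equivariant_maps_def PiE_iff compose_def extensional_def fun_eq_iff)

lemma compose_compose:
  assumes "f \<in> Mor X Y"
  shows "compose X h (compose X g f) = compose X (compose Y h g) f"
  using assms by (auto simp: orbit_maps_def equivariant_maps_def compose_def fun_eq_iff)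

lemma is_omodule_M_pi: "is_omodule GG \<D> (M_pi \<pi>)"
proof -
  have 1: "arr (M_pi \<pi>) X X (\<lambda>C\<in>X. C) c = c" if X: "X \<in> Orb" and c: "c \<in> carrier (Mb X)" for X c
  proof -
    have "arr (M_pi \<pi>) X X (\<lambda>C\<in>X. C) c = id c"
      by (rule hom_free_eqI[OF arr_M_pi_hom[OF X Mor_id[OF X], unfolded obj_M_pi] _ _ _ c[unfolded obj_M_pi]])
        (simp_all add: arr_M_pi Maps_compose_id hom_def)
    then show ?thesis by simp
  qed
  have 2: "arr (M_pi \<pi>) X Z (compose X g f) c = arr (M_pi \<pi>) X Y f (arr (M_pi \<pi>) Y Z g c)"
    if X: "X \<in> Orb" and Y: "Y \<in> Orb" and f: "f \<in> Mor X Y" and g: "g \<in> Mor Y Z"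
      and c: "c \<in> carrier (Mb Z)" for X Y Z f g c
  proof -
    have "arr (M_pi \<pi>) X Z (compose X g f) c = (arr (M_pi \<pi>) X Y f \<circ> arr (M_pi \<pi>) Y Z g) c"
      by (rule hom_free_eqI[OF arr_M_pi_hom[OF X Mor_compose[OF X f g], unfolded obj_M_pi]
            hom_compose[OF arr_M_pi_hom[OF Y g, unfolded obj_M_pi] arr_M_pi_hom[OF X f, unfolded obj_M_pi]]
            _ _ c[unfolded obj_M_pi]])
        (simp_all add: arr_M_pi compose_compose[OF f])
    then show ?thesis by simp
  qed
  show ?thesis
    unfolding is_omodule_def using 1 2 arr_M_pi_hom abelian_free_Abelian_group[folded obj_M_pi] 
    by (auto simp: obj_M_pi abelian_free_Abelian_group)
qed

lemma I_mod_simps: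
  "carrier (Ib X) = {c \<in> carrier (Mb X). coeff_sum c = 0}"
  "monoid.mult (Ib X) = monoid.mult (Mb X)" "monoid.one (Ib X) = monoid.one (Mb X)"
  by (auto simp: I_mod_def kernel_def const_Z_def)

lemma arr_I_mod: "arr (I_mod \<pi>) = arr (M_pi \<pi>)"
  by (simp add: I_mod_def)

lemma comm_group_I_mod: "comm_group (Ib X)"
proof -
  interpret M: comm_group "Mb X" unfolding obj_M_pi by (rule abelian_free_Abelian_group)
  interpret h: group_hom "Mb X" integer_group coeff_sum
    using coeff_sum_hom by (simp add: group_hom_def group_hom_axioms_def M.is_group obj_M_pi)
  have "group (Ib X)"
    using subgroup.subgroup_is_group[OF h.subgroup_kernel M.is_group]
    by (simp add: I_mod_def const_Z_def)
  then show ?thesis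
    by (rule group.group_comm_groupI) (auto simp: I_mod_simps intro: M.m_comm)
qed

lemma coeff_sum_arr: "coeff_sum (arr (M_pi \<pi>) X Y f c) = coeff_sum c"
  unfolding arr_M_pi by (rule coeff_sum_frag_extend) simp

lemma is_omodule_I_mod: "is_omodule GG \<D> (I_mod \<pi>)"
  unfolding is_omodule_def
proof (intro conjI ballI comm_group_I_mod)
  fix X Y f assume h: "X \<in> Orb" "Y \<in> Orb" "f \<in> Mor X Y"
  from is_omoduleD(3)[OF is_omodule_M_pi h] show "arr (I_mod \<pi>) X Y f \<in> hom (Ib Y) (Ib X)"
    by (auto simp: hom_def I_mod_simps arr_I_mod coeff_sum_arr)
next
  fix X c assume "X \<in> Orb" "c \<in> carrier (Ib X)"
  then show "arr (I_mod \<pi>) X X (\<lambda>C\<in>X. C) c = c"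
    using is_omoduleD(5)[OF is_omodule_M_pi] unfolding I_mod_simps arr_I_mod by blast
next
  fix X Y Z f g c assume h: "X \<in> Orb" "Y \<in> Orb" "Z \<in> Orb" "f \<in> Mor X Y" "g \<in> Mor Y Z" "c \<in> carrier (Ib Z)"
  then show "arr (I_mod \<pi>) X Z (compose X g f) c = arr (I_mod \<pi>) X Y f (arr (I_mod \<pi>) Y Z g c)"
    using is_omoduleD(6)[OF is_omodule_M_pi h(1-5)] unfolding I_mod_simps arr_I_mod by blast
qed

section \<open>Tensor powers of I and the maps between them\<close>

abbreviation "Is r \<equiv> replicate r (I_mod \<pi>)"
abbreviation "MIs r \<equiv> M_pi \<pi> # replicate r (I_mod \<pi>)"
abbreviation "Ibs r X \<equiv> replicate r (Ib X)"
abbreviation "MIbs r X \<equiv> Mb X # replicate r (Ib X)"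

lemma Is_omodules: "\<forall>M\<in>set (Is r). is_omodule GG \<D> M" "\<forall>M\<in>set (MIs r). is_omodule GG \<D> M"
  using is_omodule_I_mod is_omodule_M_pi by auto

lemma Is_groups: "\<forall>A\<in>set (Ibs r X). group A" "\<forall>A\<in>set (MIbs r X). group A"
  using comm_group_I_mod abelian_free_Abelian_group by (auto simp: comm_group_def obj_M_pi)

lemma is_omodule_I_pow: "is_omodule GG \<D> (I_pow \<pi> r)"
  unfolding I_pow_def by (rule is_omodule_tensor[OF Is_omodules(1)])

lemma is_omodule_MI: "is_omodule GG \<D> (MI \<pi> r)"
  unfolding MI_def by (rule is_omodule_tensor[OF Is_omodules(2)])

lemma obj_I_pow: "obj (I_pow \<pi> r) X = tensor (Ibs r X)"
  by (simp add: I_pow_def)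

lemma obj_MI: "obj (MI \<pi> r) X = tensor (MIbs r X)"
  by (simp add: MI_def)

lemma comm_group_I_pow: "comm_group (tensor (Ibs r X))"
  by (rule comm_group_tensor[OF Is_groups(1)])

lemma comm_group_MI: "comm_group (tensor (MIbs r X))"
  by (rule comm_group_tensor[OF Is_groups(2)])

definition I_tensor :: "nat \<Rightarrow> ('a \<times> 'a) set set \<Rightarrow> 'a mpi_elem list \<Rightarrow> 'a tensor_elem"
  where "I_tensor r X ms = tensor_class (Ibs r X) (frag_of ms)"

definition MI_tensor :: "nat \<Rightarrow> ('a \<times> 'a) set set \<Rightarrow> 'a mpi_elem list \<Rightarrow> 'a tensor_elem"
  where "MI_tensor r X ms = tensor_class (MIbs r X) (frag_of ms)"

lemma multilinear_I_tensor: "multilinear (Ibs r X) (tensor (Ibs r X)) (I_tensor r X)"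
  unfolding I_tensor_def[abs_def] by (rule multilinear_tensor_class[OF Is_groups(1)])

lemma multilinear_MI_tensor: "multilinear (MIbs r X) (tensor (MIbs r X)) (MI_tensor r X)"
  unfolding MI_tensor_def[abs_def] by (rule multilinear_tensor_class[OF Is_groups(2)])

text \<open>I and \<open>M_pi \<pi>\<close> share their structure maps, so one and the same map acts
  on all entries of a tuple.\<close>

lemma map2_arr:
  assumes "ms \<in> tensor_gens (Ibs r Y)"
  shows "map2 (\<lambda>M. arr M X Y f) (Is r) ms = map (arr (M_pi \<pi>) X Y f) ms"
  using assms by (auto simp: tensor_gens_iff list_eq_iff_nth_eq arr_I_mod)

lemma map2_arr_M:
  assumes "ms \<in> tensor_gens (MIbs r Y)"
  shows "map2 (\<lambda>M. arr M X Y f) (MIs r) ms = map (arr (M_pi \<pi>) X Y f) ms"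
  using assms by (auto simp: tensor_gens_Cons map2_arr)

lemma arr_tensors:
  assumes "X \<in> Orb" "Y \<in> Orb" "f \<in> Mor X Y"
  shows "ms \<in> tensor_gens (Ibs r Y) \<Longrightarrow>
      map (arr (M_pi \<pi>) X Y f) ms \<in> tensor_gens (Ibs r X) \<and>
      arr (I_pow \<pi> r) X Y f (I_tensor r Y ms) = I_tensor r X (map (arr (M_pi \<pi>) X Y f) ms)"
    and "ms \<in> tensor_gens (MIbs r Y) \<Longrightarrow>
      map (arr (M_pi \<pi>) X Y f) ms \<in> tensor_gens (MIbs r X) \<and>
      arr (MI \<pi> r) X Y f (MI_tensor r Y ms) = MI_tensor r X (map (arr (M_pi \<pi>) X Y f) ms)"
  using tensor_omod_arr(2,3)[OF Is_omodules(1)[of r] assms, of ms]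
    tensor_omod_arr(2,3)[OF Is_omodules(2)[of r] assms, of ms] map2_arr[of ms r Y X f] map2_arr_M[of ms Y r X f]
  by (auto simp: I_pow_def MI_def I_tensor_def MI_tensor_def)

lemma gens_I_in_M: "ms \<in> tensor_gens (Ibs (Suc r) X) \<Longrightarrow> ms \<in> tensor_gens (MIbs r X)"
  by (auto simp: tensor_gens_Cons I_mod_simps)

lemma
  shows incl_nat_trans: "incl \<pi> r \<in> nat_trans GG \<D> (I_pow \<pi> (Suc r)) (MI \<pi> r)"
    and incl_val: "\<lbrakk>X \<in> Orb; ms \<in> tensor_gens (Ibs (Suc r) X)\<rbrakk> \<Longrightarrow>
      incl \<pi> r X (I_tensor (Suc r) X ms) = MI_tensor r X ms"
proof -
  \<comment> \<open>The product of I is that of \<open>M_pi \<pi>\<close> on a smaller carrier, so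
    multilinearity survives restricting the first entry to I.\<close>
  have m: "multilinear (Ib X # Ibs r X) (tensor (MIbs r X)) (MI_tensor r X)" for X
  proof -
    have "h \<in> hom (Ib X) C" if "h \<in> hom (Mb X) C" for h and C :: "'a tensor_elem monoid"
      using that by (auto simp: hom_def I_mod_simps)
    then show ?thesis
      using multilinear_MI_tensor[where r = r and X = X] unfolding multilinear_Cons by (auto simp: I_mod_simps)
  qed
  note p = tensor_omap_nat_trans[OF Is_omodules(1)[of "Suc r"] Is_omodules(2)[of r] is_omodule_tensor[OF Is_omodules(2)],
      where g = frag_of]
  have 1: "frag_of xs \<in> carrier (free_Abelian_group (tensor_gens (map (\<lambda>N. obj N X) (MIs r))))"
    if "xs \<in> tensor_gens (map (\<lambda>M. obj M X) (Is (Suc r)))" for X xs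
    using gens_I_in_M[where ms = xs and r = r and X = X] that by simp
  have 2: "multilinear (map (\<lambda>M. obj M X) (Is (Suc r))) (tensor (map (\<lambda>N. obj N X) (MIs r)))
     (\<lambda>xs. tensor_class (map (\<lambda>N. obj N X) (MIs r)) (frag_of xs))" for X
    using m[of X] by (simp add: MI_tensor_def[abs_def])
  have 3: "tensor_class (map (\<lambda>N. obj N X) (MIs r)) (frag_of (map2 (\<lambda>M. arr M X Y f) (Is (Suc r)) ys)) =
    arr (tensor_omod (MIs r)) X Y f (tensor_class (map (\<lambda>N. obj N Y) (MIs r)) (frag_of ys))"
    if "X \<in> Orb" "Y \<in> Orb" "f \<in> Mor X Y" "ys \<in> tensor_gens (map (\<lambda>M. obj M Y) (Is (Suc r)))" for X Y f ys
  proof -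
    have "ys \<in> tensor_gens (Ibs (Suc r) Y)" using that(4) by simp
    then show ?thesis
      using arr_tensors(2)[OF that(1-3) gens_I_in_M] map2_arr[of ys "Suc r" Y X f]
      by (simp del: replicate_Suc add: MI_tensor_def MI_def)
  qed
  show "incl \<pi> r \<in> nat_trans GG \<D> (I_pow \<pi> (Suc r)) (MI \<pi> r)"
    unfolding incl_def I_pow_def MI_def by (rule p(1)[OF 1 2 3])
  show "incl \<pi> r X (I_tensor (Suc r) X ms) = MI_tensor r X ms"
    if "X \<in> Orb" "ms \<in> tensor_gens (Ibs (Suc r) X)" for X ms
    using p(2)[OF 1 2 3 that(1), of ms] that(2)
    by (simp add: incl_def I_tensor_def MI_tensor_def)
qed

text \<open>The tensor group is written multiplicatively, so the integer multiple by the
  augmentation of \<open>m\<close> appears as a power with exponent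
  \<open>coeff_sum m\<close>.\<close>

lemma
  shows aug_nat_trans: "aug_tensor \<pi> r \<in> nat_trans GG \<D> (MI \<pi> r) (I_pow \<pi> r)"
    and aug_val: "\<lbrakk>X \<in> Orb; m \<in> carrier (Mb X); ms \<in> tensor_gens (Ibs r X)\<rbrakk> \<Longrightarrow>
      aug_tensor \<pi> r X (MI_tensor r X (m # ms)) =
      I_tensor r X ms [^]\<^bsub>tensor (Ibs r X)\<^esub> coeff_sum m"
proof -
  let ?g = "\<lambda>xs. frag_cmul (coeff_sum (hd xs)) (frag_of (tl xs))"
  have cmul: "tensor_class (Ibs r X) (frag_cmul k (frag_of ms)) = I_tensor r X ms [^]\<^bsub>tensor (Ibs r X)\<^esub> k"
    if "ms \<in> tensor_gens (Ibs r X)" for ms X k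
    using hom_int_pow[OF tensor_class_hom[OF Is_groups(1)], of "frag_of ms" r X k] that comm_group_I_pow[of r X]
    by (simp add: I_tensor_def comm_group_def)
  have m: "multilinear (MIbs r X) (tensor (Ibs r X)) (\<lambda>xs. I_tensor r X (tl xs) [^]\<^bsub>tensor (Ibs r X)\<^esub> coeff_sum (hd xs))" for X
  proof -
    interpret T: comm_group "tensor (Ibs r X)" by (rule comm_group_I_pow)
    show ?thesis
      unfolding multilinear_Cons list.sel
    proof (intro conjI ballI)
      fix xs assume "xs \<in> tensor_gens (Ibs r X)"
      then have "I_tensor r X xs \<in> carrier (tensor (Ibs r X))" by (rule multilinearD(1)[OF multilinear_I_tensor])
      then show "(\<lambda>a. I_tensor r X xs [^]\<^bsub>tensor (Ibs r X)\<^esub> coeff_sum a) \<in> hom (Mb X) (tensor (Ibs r X))"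
        by (intro homI) (simp_all add: obj_M_pi coeff_sum_add T.int_pow_mult)
    next
      fix a
      \<comment> \<open>Commutativity makes a fixed power an endomorphism, which preserves
        multilinearity in the remaining entries.\<close>
      have "(\<lambda>t. t [^]\<^bsub>tensor (Ibs r X)\<^esub> coeff_sum a) \<in> hom (tensor (Ibs r X)) (tensor (Ibs r X))"
        by (rule homI) (simp_all add: T.int_pow_distrib)
      from multilinear_hom[OF multilinear_I_tensor this Is_groups(1)]
      show "multilinear (Ibs r X) (tensor (Ibs r X)) (\<lambda>xs. I_tensor r X xs [^]\<^bsub>tensor (Ibs r X)\<^esub> coeff_sum a)" .
    qed
  qed
  note p = tensor_omap_nat_trans[OF Is_omodules(2)[of r] Is_omodules(1)[of r] is_omodule_tensor[OF Is_omodules(1)],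
      where g = ?g]
  have 1: "?g xs \<in> carrier (free_Abelian_group (tensor_gens (map (\<lambda>N. obj N X) (Is r))))"
    if "xs \<in> tensor_gens (map (\<lambda>M. obj M X) (MIs r))" for X xs
    using that keys_cmul[of "coeff_sum (hd xs)" "frag_of (tl xs)"] by (auto simp: tensor_gens_Cons)
  have 2: "multilinear (map (\<lambda>M. obj M X) (MIs r)) (tensor (map (\<lambda>N. obj N X) (Is r)))
     (\<lambda>xs. tensor_class (map (\<lambda>N. obj N X) (Is r)) (?g xs))" for X
  proof -
    have "multilinear (MIbs r X) (tensor (Ibs r X)) (\<lambda>xs. tensor_class (Ibs r X) (?g xs))"
      by (rule multilinear_cong[OF m _ Is_groups(2)]) (auto simp: tensor_gens_Cons cmul)
    then show ?thesis by simp
  qed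
  have 3: "tensor_class (map (\<lambda>N. obj N X) (Is r)) (?g (map2 (\<lambda>M. arr M X Y f) (MIs r) ys)) =
    arr (tensor_omod (Is r)) X Y f (tensor_class (map (\<lambda>N. obj N Y) (Is r)) (?g ys))"
    if XY: "X \<in> Orb" "Y \<in> Orb" "f \<in> Mor X Y" and "ys \<in> tensor_gens (map (\<lambda>M. obj M Y) (MIs r))" for X Y f ys
  proof -
    from that(4) obtain m ms where ys: "ys = m # ms" "m \<in> carrier (Mb Y)" "ms \<in> tensor_gens (Ibs r Y)"
      by (auto simp: tensor_gens_Cons)
    have c: "I_tensor r Y ms \<in> carrier (tensor (Ibs r Y))"
      by (rule multilinearD(1)[OF multilinear_I_tensor ys(3)])
    have "arr (tensor_omod (Is r)) X Y f \<in> hom (tensor (Ibs r Y)) (tensor (Ibs r X))"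
      using is_omoduleD(3)[OF is_omodule_I_pow XY, of r] by (simp add: I_pow_def)
    from hom_int_pow[OF this c, of "coeff_sum m"] show ?thesis
      using arr_tensors(1)[OF XY ys(3)] map2_arr[OF ys(3), of X f] comm_group_I_pow[of r X] comm_group_I_pow[of r Y]
      by (simp add: ys cmul coeff_sum_arr I_pow_def comm_group_def)
  qed
  show "aug_tensor \<pi> r \<in> nat_trans GG \<D> (MI \<pi> r) (I_pow \<pi> r)"
    unfolding aug_tensor_def I_pow_def MI_def by (rule p(1)[OF 1 2 3])
  show "aug_tensor \<pi> r X (MI_tensor r X (m # ms)) =
      I_tensor r X ms [^]\<^bsub>tensor (Ibs r X)\<^esub> coeff_sum m"
    if "X \<in> Orb" "m \<in> carrier (Mb X)" "ms \<in> tensor_gens (Ibs r X)" for X m ms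
    using p(2)[OF 1 2 3 that(1), of "m # ms"] that(2,3)
    by (simp add: aug_tensor_def MI_tensor_def cmul)
qed

end

text \<open>The case of a single homomorphism on all factors, applied to the inclusion of I and to
  the projections \<open>reduce u\<close>.\<close>

lemma multilinear_map:
  assumes \<gamma>: "multilinear (replicate n B) C \<gamma>" and k: "k \<in> hom A B"
  shows "multilinear (replicate n A) C (\<lambda>xs. \<gamma> (map k xs))"
    and "xs \<in> tensor_gens (replicate n A) \<Longrightarrow> map k xs \<in> tensor_gens (replicate n B)"
proof -
  show gens: "map k xs \<in> tensor_gens (replicate n B)" if "xs \<in> tensor_gens (replicate n A)" for xs
    using that hom_in_carrier[OF k] by (simp add: tensor_gens_iff)
  show "multilinear (replicate n A) C (\<lambda>xs. \<gamma> (map k xs))"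
  proof (rule multilinearI)
    fix xs i x y
    assume xs: "xs \<in> tensor_gens (replicate n A)" and i: "i < length (replicate n A)"
      and xy: "x \<in> carrier (replicate n A ! i)" "y \<in> carrier (replicate n A ! i)"
    then show "\<gamma> (map k (xs[i := x \<otimes>\<^bsub>replicate n A ! i\<^esub> y])) =
        \<gamma> (map k (xs[i := x])) \<otimes>\<^bsub>C\<^esub> \<gamma> (map k (xs[i := y]))"
      using multilinearD(2)[OF \<gamma> gens[OF xs], of i "k x" "k y"] hom_mult[OF k] hom_in_carrier[OF k]
      by (simp add: map_update)
  qed (use multilinearD(1)[OF \<gamma>] gens in blast)
qed

context discrete_group
begin

section \<open>The action on \<open>\<pi>\<close>, fixed points and stabilizers\<close>

lemma act_closed: "\<lbrakk>g \<in> carrier GG; t \<in> carrier \<pi>\<rbrakk> \<Longrightarrow> act g t \<in> carrier \<pi>"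
proof -
  interpret group \<pi> by (rule grp)
  show "\<lbrakk>g \<in> carrier GG; t \<in> carrier \<pi>\<rbrakk> \<Longrightarrow> act g t \<in> carrier \<pi>"
    by (auto simp: pi_action_def)
qed

lemma act_mult:
  assumes "g \<in> carrier GG" "h \<in> carrier GG" "t \<in> carrier \<pi>"
  shows "act (g \<otimes>\<^bsub>GG\<^esub> h) t = act g (act h t)"
proof -
  interpret group \<pi> by (rule grp)
  show ?thesis using assms by (auto simp: pi_action_def DirProd_def inv_mult_group m_assoc)
qed

lemma act_one: "t \<in> carrier \<pi> \<Longrightarrow> act \<one>\<^bsub>GG\<^esub> t = t"
proof -
  interpret group \<pi> by (rule grp)
  show "t \<in> carrier \<pi> \<Longrightarrow> act \<one>\<^bsub>GG\<^esub> t = t" by (simp add: pi_action_def)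
qed

lemma act_inv: "\<lbrakk>g \<in> carrier GG; t \<in> carrier \<pi>\<rbrakk> \<Longrightarrow> act (inv\<^bsub>GG\<^esub> g) (act g t) = t"
  using act_mult[of "inv\<^bsub>GG\<^esub> g" g t] act_one group.l_inv[OF group_GG] group.inv_closed[OF group_GG] by simp

text \<open>Puts a representative into its own coset, so that \<open>coset_map\<close> can choose
  one by \<open>SOME\<close>.\<close>

lemma D_one:
  assumes "H \<in> \<D>" shows "\<one>\<^bsub>GG\<^esub> \<in> H"
  using assms
proof induction
  case (conjugate H g)
  interpret G: group GG by (rule group_GG)
  have "\<one>\<^bsub>GG\<^esub> = g \<otimes>\<^bsub>GG\<^esub> \<one>\<^bsub>GG\<^esub> \<otimes>\<^bsub>GG\<^esub> inv\<^bsub>GG\<^esub> g"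
    using conjugate(2) by (simp only: G.r_one G.r_inv)
  then show ?case using conjugate by blast
qed (use grp in \<open>auto simp: group.is_monoid\<close>)

text \<open>The trivial group fixes every point and the diagonal fixes the unit; conjugation by
  \<open>g\<close> carries a fixed point \<open>t\<close> to \<open>act g t\<close>; a fixed point
  of \<open>H\<close> is still fixed by the smaller group \<open>H \<inter> K\<close>.\<close>

lemma D_fixed_point:
  assumes "H \<in> \<D>" shows "\<exists>t\<in>carrier \<pi>. \<forall>h\<in>H. act h t = t"
  using assms
proof induction
  case trivial
  then show ?case using act_one[of "\<one>\<^bsub>\<pi>\<^esub>"] grp by (auto simp: group.is_monoid)
next
  case diagonal
  interpret group \<pi> by (rule grp)
  show ?case by (intro bexI[of _ "\<one>\<^bsub>\<pi>\<^esub>"]) (auto simp: pi_action_def)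
next
  case (conjugate H g)
  interpret G: group GG by (rule group_GG)
  from conjugate obtain t where t: "t \<in> carrier \<pi>" "\<And>h. h \<in> H \<Longrightarrow> act h t = t" by blast
  have "act (g \<otimes>\<^bsub>GG\<^esub> h \<otimes>\<^bsub>GG\<^esub> inv\<^bsub>GG\<^esub> g) (act g t) = act g t" if "h \<in> H" for h
  proof -
    have h: "h \<in> carrier GG" using D_subset[OF conjugate(1)] that by blast
    then show ?thesis
      using act_mult[of "g \<otimes>\<^bsub>GG\<^esub> h" "inv\<^bsub>GG\<^esub> g" "act g t"] act_mult[of g h t] conjugate(2) t that
      by (simp only: G.m_closed G.inv_closed act_closed act_inv)
  qed
  then show ?case using act_closed[OF conjugate(2) t(1)] by blast
qed auto

definition stab :: "'a list \<Rightarrow> ('a \<times> 'a) set"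
  where "stab ts = {g \<in> carrier GG. map (act g) ts = ts}"

text \<open>The stabilizer of t is the conjugate of the diagonal by (t, 1).\<close>

lemma stab_single_in_D:
  assumes t: "t \<in> carrier \<pi>"
  shows "stab [t] \<in> \<D>"
proof -
  interpret group \<pi> by (rule grp)
  have "stab [t] = {(t, \<one>\<^bsub>\<pi>\<^esub>) \<otimes>\<^bsub>GG\<^esub> h \<otimes>\<^bsub>GG\<^esub> inv\<^bsub>GG\<^esub> (t, \<one>\<^bsub>\<pi>\<^esub>) | h. h \<in> {(a, a) | a. a \<in> carrier \<pi>}}"
  proof -
    have "x \<otimes>\<^bsub>\<pi>\<^esub> t \<otimes>\<^bsub>\<pi>\<^esub> inv\<^bsub>\<pi>\<^esub> y = t \<longleftrightarrow> x = t \<otimes>\<^bsub>\<pi>\<^esub> y \<otimes>\<^bsub>\<pi>\<^esub> inv\<^bsub>\<pi>\<^esub> t"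
      if "x \<in> carrier \<pi>" "y \<in> carrier \<pi>" for x y
      using that t by (metis inv_solve_right m_closed)
    moreover have "inv\<^bsub>GG\<^esub> (t, \<one>\<^bsub>\<pi>\<^esub>) = (inv\<^bsub>\<pi>\<^esub> t, \<one>\<^bsub>\<pi>\<^esub>)"
      using inv_DirProd[OF grp grp t one_closed] by simp
    ultimately show ?thesis
      using t by (auto simp: stab_def pi_action_def)
  qed
  then show ?thesis
    using diag_family.conjugate[OF diag_family.diagonal, of "(t, \<one>\<^bsub>\<pi>\<^esub>)" \<pi>] t by simp
qed

text \<open>The stabilizer of a tuple is the intersection of those of its entries. The empty tuple
  is excluded: its stabilizer is the whole group, in general not a member.\<close>

lemma stab_in_D:
  assumes "ts \<noteq> []" "set ts \<subseteq> carrier \<pi>"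
  shows "stab ts \<in> \<D>"
  using assms
proof (induction ts rule: list_nonempty_induct)
  case (cons t ts)
  have "stab (t # ts) = stab [t] \<inter> stab ts" by (auto simp: stab_def)
  then show ?case using cons stab_single_in_D[of t] diag_family.intersection[of "stab [t]" \<pi> "stab ts"] by simp
qed (simp add: stab_single_in_D)

lemma Orb_transitive:
  assumes "X \<in> Orb" "C \<in> X" "D \<in> X"
  obtains a where "a \<in> carrier GG" "D = a <#\<^bsub>GG\<^esub> C"
proof -
  interpret G: group GG by (rule group_GG)
  from assms obtain H c d where H: "H \<in> \<D>" "c \<in> carrier GG" "d \<in> carrier GG"
    "C = c <#\<^bsub>GG\<^esub> H" "D = d <#\<^bsub>GG\<^esub> H"
    unfolding orbits_def LCOSETS_def by auto
  have "(d \<otimes>\<^bsub>GG\<^esub> inv\<^bsub>GG\<^esub> c) <#\<^bsub>GG\<^esub> C = (d \<otimes>\<^bsub>GG\<^esub> inv\<^bsub>GG\<^esub> c \<otimes>\<^bsub>GG\<^esub> c) <#\<^bsub>GG\<^esub> H"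
    unfolding H(4) by (rule G.lcos_m_assoc[OF D_subset[OF H(1)]]) (use H in \<open>simp_all only: G.m_closed G.inv_closed\<close>)
  also have "\<dots> = D"
    using H by (simp only: G.m_assoc G.inv_closed G.l_inv G.r_one)
  finally show thesis using H that[of "d \<otimes>\<^bsub>GG\<^esub> inv\<^bsub>GG\<^esub> c"] by (simp only: G.m_closed G.inv_closed)
qed

lemma Orb_nonempty: "X \<in> Orb \<Longrightarrow> X \<noteq> {}"
  using group.is_monoid[OF group_GG] monoid.one_closed by (fastforce simp: orbits_def LCOSETS_def)

text \<open>The target is a single orbit. Surjectivity ensures that a tuple of maps and its pullback
  have the same image, on which naturality in \<open>lift_tuples\<close> depends.\<close>

lemma Mor_surj:
  assumes X: "X \<in> Orb" and Y: "Y \<in> Orb" and f: "f \<in> Mor X Y"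
  shows "f ` X = Y"
proof -
  obtain C where C: "C \<in> X" using Orb_nonempty[OF X] by blast
  have f': "f \<in> X \<rightarrow> Y" "\<And>a C. \<lbrakk>a \<in> carrier GG; C \<in> X\<rbrakk> \<Longrightarrow> f (a <#\<^bsub>GG\<^esub> C) = a <#\<^bsub>GG\<^esub> f C"
    using f unfolding orbit_maps_def equivariant_maps_def by auto
  have "D \<in> f ` X" if D: "D \<in> Y" for D
  proof -
    obtain a where a: "a \<in> carrier GG" "D = a <#\<^bsub>GG\<^esub> f C"
      using Orb_transitive[OF Y, of "f C" D] D f' C by blast
    then show ?thesis using f'(2)[OF a(1) C] closed_orbit[OF X a(1) C] by (metis imageI)
  qed
  then show ?thesis using f' by blast
qed

text \<open>One half of the bijection between points of \<pi> fixed by H and equivariant maps G/H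
  \<rightarrow> \<pi>: sending the coset of \<open>a\<close> to \<open>act a t\<close> is well
  defined because H fixes \<open>t\<close>.\<close>

lemma coset_map:
  assumes H: "H \<in> \<D>" and t: "t \<in> carrier \<pi>" "\<And>h. h \<in> H \<Longrightarrow> act h t = t"
  shows "\<exists>v\<in>Maps (lcosets\<^bsub>GG\<^esub> H). \<forall>a\<in>carrier GG. v (a <#\<^bsub>GG\<^esub> H) = act a t"
proof -
  interpret G: group GG by (rule group_GG)
  \<comment> \<open>The chosen representative has the form a h with h in H, and
    \<open>act h t = t\<close>, so the choice does not affect the value.\<close>
  define v where "v = (\<lambda>C\<in>lcosets\<^bsub>GG\<^esub> H. act (SOME g. g \<in> C) t)"
  have v: "v (a <#\<^bsub>GG\<^esub> H) = act a t" if a: "a \<in> carrier GG" for a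
  proof -
    have "a \<otimes>\<^bsub>GG\<^esub> \<one>\<^bsub>GG\<^esub> \<in> a <#\<^bsub>GG\<^esub> H" using D_one[OF H] unfolding l_coset_def by blast
    then have "(SOME g. g \<in> a <#\<^bsub>GG\<^esub> H) \<in> a <#\<^bsub>GG\<^esub> H" by (rule someI)
    then obtain h where h: "h \<in> H" "(SOME g. g \<in> a <#\<^bsub>GG\<^esub> H) = a \<otimes>\<^bsub>GG\<^esub> h" unfolding l_coset_def by blast
    have "a <#\<^bsub>GG\<^esub> H \<in> lcosets\<^bsub>GG\<^esub> H" using a unfolding LCOSETS_def by blast
    then show ?thesis
      unfolding v_def using h act_mult[OF a _ t(1), of h] t(2)[OF h(1)] D_subset[OF H] by (auto simp del: mult_DirProd)
  qed
  have "v \<in> Maps (lcosets\<^bsub>GG\<^esub> H)"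
    unfolding equivariant_maps_def
  proof (intro CollectI conjI ballI)
    show "v \<in> (lcosets\<^bsub>GG\<^esub> H) \<rightarrow>\<^sub>E carrier \<pi>"
    proof (rule PiE_I)
      fix C assume "C \<in> lcosets\<^bsub>GG\<^esub> H"
      then obtain a where "a \<in> carrier GG" "C = a <#\<^bsub>GG\<^esub> H" unfolding LCOSETS_def by blast
      then show "v C \<in> carrier \<pi>" using v act_closed t by simp
    qed (simp add: v_def)
    fix g C assume g: "g \<in> carrier GG" and "C \<in> lcosets\<^bsub>GG\<^esub> H"
    then obtain a where a: "a \<in> carrier GG" "C = a <#\<^bsub>GG\<^esub> H" unfolding LCOSETS_def by blast
    have "v (g <#\<^bsub>GG\<^esub> C) = v ((g \<otimes>\<^bsub>GG\<^esub> a) <#\<^bsub>GG\<^esub> H)"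
      unfolding a(2) by (simp only: G.lcos_m_assoc[OF D_subset[OF H] g a(1)])
    also have "\<dots> = act g (v C)"
      using v[OF G.m_closed[OF g a(1)]] act_mult[OF g a(1) t(1)] v[OF a(1)] a(2) by simp
    finally show "v (g <#\<^bsub>GG\<^esub> C) = act g (v C)" .
  qed
  then show ?thesis using v by blast
qed

text \<open>This is where the fixed points enter: \<open>M_pi \<pi>\<close> has a basis element over
  every orbit, so the augmentation is onto there.\<close>

lemma Maps_nonempty:
  assumes "X \<in> Orb" obtains u where "u \<in> Maps X"
proof -
  from assms obtain H where H: "H \<in> \<D>" "X = lcosets\<^bsub>GG\<^esub> H" unfolding orbits_def by blast
  from D_fixed_point[OF H(1)] obtain t where "t \<in> carrier \<pi>" "\<And>h. h \<in> H \<Longrightarrow> act h t = t" by blast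
  from coset_map[OF H(1) this] show thesis using that H(2) by blast
qed

lemma I_tensor_closed: "ms \<in> tensor_gens (Ibs r X) \<Longrightarrow> I_tensor r X ms \<in> carrier (tensor (Ibs r X))"
  by (rule multilinearD(1)[OF multilinear_I_tensor])

lemma MI_tensor_closed: "ms \<in> tensor_gens (MIbs r X) \<Longrightarrow> MI_tensor r X ms \<in> carrier (tensor (MIbs r X))"
  by (rule multilinearD(1)[OF multilinear_MI_tensor])

lemma I_tensor_universal:
  assumes "comm_group C" "multilinear (Ibs r X) C \<gamma>"
  obtains t where "t \<in> hom (tensor (Ibs r X)) C" "\<And>ms. ms \<in> tensor_gens (Ibs r X) \<Longrightarrow> t (I_tensor r X ms) = \<gamma> ms"
  using tensor_universal[OF Is_groups(1) assms] unfolding I_tensor_def by metis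

lemma MI_tensor_universal:
  assumes "comm_group C" "multilinear (MIbs r X) C \<gamma>"
  obtains t where "t \<in> hom (tensor (MIbs r X)) C" "t \<in> extensional (carrier (tensor (MIbs r X)))"
    "\<And>ms. ms \<in> tensor_gens (MIbs r X) \<Longrightarrow> t (MI_tensor r X ms) = \<gamma> ms"
  using tensor_universal[OF Is_groups(2) assms] unfolding MI_tensor_def by metis

lemma I_tensor_eqI:
  assumes "h \<in> hom (tensor (Ibs r X)) C" "k \<in> hom (tensor (Ibs r X)) C" "group C"
    and "\<And>ms. ms \<in> tensor_gens (Ibs r X) \<Longrightarrow> h (I_tensor r X ms) = k (I_tensor r X ms)"
    and "T \<in> carrier (tensor (Ibs r X))"
  shows "h T = k T"
  by (rule tensor_hom_eqI[OF Is_groups(1) assms(1-3) assms(4)[unfolded I_tensor_def] assms(5)])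

lemma MI_tensor_eqI:
  assumes "h \<in> hom (tensor (MIbs r X)) C" "k \<in> hom (tensor (MIbs r X)) C" "group C"
    and "\<And>m ms. \<lbrakk>m \<in> carrier (Mb X); ms \<in> tensor_gens (Ibs r X)\<rbrakk>
      \<Longrightarrow> h (MI_tensor r X (m # ms)) = k (MI_tensor r X (m # ms))"
    and T: "T \<in> carrier (tensor (MIbs r X))"
  shows "h T = k T"
proof (rule tensor_hom_eqI[OF Is_groups(2) assms(1-3) _ T])
  fix xs assume "xs \<in> tensor_gens (MIbs r X)"
  then show "h (tensor_class (MIbs r X) (frag_of xs)) = k (tensor_class (MIbs r X) (frag_of xs))"
    using assms(4) by (auto simp: tensor_gens_Cons MI_tensor_def)
qed

text \<open>The projection of the free group onto the kernel of the augmentation along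
  \<open>frag_of u\<close>; it is the identity on I.\<close>

abbreviation reduce :: "(('a \<times> 'a) set \<Rightarrow> 'a) \<Rightarrow> 'a mpi_elem \<Rightarrow> 'a mpi_elem"
  where "reduce u m \<equiv> m - frag_cmul (coeff_sum m) (frag_of u)"

lemma reduce_hom:
  assumes "u \<in> Maps X" shows "reduce u \<in> hom (Mb X) (Ib X)"
proof (rule homI)
  fix x assume "x \<in> carrier (Mb X)"
  moreover have "Poly_Mapping.keys (frag_cmul (coeff_sum x) (frag_of u)) \<subseteq> Maps X"
    using keys_cmul[of "coeff_sum x" "frag_of u"] assms by auto
  ultimately show "reduce u x \<in> carrier (Ib X)"
    by (simp add: I_mod_simps obj_M_pi coeff_sum_diff coeff_sum_cmul keys_diff_subset)
qed (simp add: I_mod_simps obj_M_pi coeff_sum_add frag_cmul_distrib)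

text \<open>An equivariant map from X to \<open>\<pi>\<close> splits the augmentation over X, hence also the tensored sequence.\<close>

lemma split_exact:
  assumes X: "X \<in> Orb"
  obtains \<sigma> \<rho> where
    "\<sigma> \<in> hom (tensor (Ibs r X)) (tensor (MIbs r X))" "\<rho> \<in> hom (tensor (MIbs r X)) (tensor (Ibs (Suc r) X))"
    "\<And>s. s \<in> carrier (tensor (Ibs r X)) \<Longrightarrow> aug_tensor \<pi> r X (\<sigma> s) = s"
    "\<And>s. s \<in> carrier (tensor (Ibs (Suc r) X)) \<Longrightarrow> \<rho> (incl \<pi> r X s) = s"
    "\<And>s. s \<in> carrier (tensor (Ibs (Suc r) X)) \<Longrightarrow> aug_tensor \<pi> r X (incl \<pi> r X s) = \<one>\<^bsub>tensor (Ibs r X)\<^esub>"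
    "\<And>s. s \<in> carrier (tensor (MIbs r X)) \<Longrightarrow>
      incl \<pi> r X (\<rho> s) \<otimes>\<^bsub>tensor (MIbs r X)\<^esub> \<sigma> (aug_tensor \<pi> r X s) = s"
proof -
  let ?I = "tensor (Ibs r X)" and ?J = "tensor (Ibs (Suc r) X)" and ?M = "tensor (MIbs r X)"
  interpret I: comm_group ?I by (rule comm_group_I_pow)
  interpret J: comm_group ?J by (rule comm_group_I_pow)
  interpret M: comm_group ?M by (rule comm_group_MI)
  note mM = multilinear_MI_tensor[of X r, unfolded multilinear_Cons]
  obtain u where u: "u \<in> Maps X" by (rule Maps_nonempty[OF X])
  have uM: "frag_of u \<in> carrier (Mb X)" using u by (simp add: obj_M_pi)
  have aug: "aug_tensor \<pi> r X \<in> hom ?M ?I"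
    using nat_transD(1)[OF aug_nat_trans X] by (simp add: obj_MI obj_I_pow)
  have inc: "incl \<pi> r X \<in> hom ?J ?M"
    using nat_transD(1)[OF incl_nat_trans X] by (simp add: obj_MI obj_I_pow)
  \<comment> \<open>\<open>\<sigma>\<close> inserts \<open>u\<close> as first factor, lifting the
    unit of Z to a basis element; \<open>\<rho>\<close> below applies the complementary projection
    \<open>reduce u\<close> to the first factor.\<close>
  obtain \<sigma> where \<sigma>: "\<sigma> \<in> hom ?I ?M" "\<And>ms. ms \<in> tensor_gens (Ibs r X) \<Longrightarrow> \<sigma> (I_tensor r X ms) = MI_tensor r X (frag_of u # ms)"
    by (rule I_tensor_universal[OF comm_group_MI, where r = r and X = X and \<gamma> = "\<lambda>ms. MI_tensor r X (frag_of u # ms)"]) (use mM uM in auto)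
  have "multilinear (MIbs r X) ?J (\<lambda>xs. I_tensor (Suc r) X (reduce u (hd xs) # tl xs))"
  proof -
    have mI: "multilinear (Ib X # Ibs r X) ?J (I_tensor (Suc r) X)"
      using multilinear_I_tensor[of "Suc r" X] by simp
    show ?thesis
      using mI hom_in_carrier[OF reduce_hom[OF u]] hom_compose[OF reduce_hom[OF u], of _ ?J]
      unfolding multilinear_Cons list.sel comp_def by blast
  qed
  from MI_tensor_universal[OF comm_group_I_pow this]
  obtain \<rho> where \<rho>: "\<rho> \<in> hom ?M ?J" "\<And>m ms. \<lbrakk>m \<in> carrier (Mb X); ms \<in> tensor_gens (Ibs r X)\<rbrakk>
      \<Longrightarrow> \<rho> (MI_tensor r X (m # ms)) = I_tensor (Suc r) X (reduce u m # ms)"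
    by (metis Cons_in_tensor_gens list.sel(1,3))
  have Suc_gens: "\<exists>m ms. xs = m # ms \<and> m \<in> carrier (Mb X) \<and> coeff_sum m = 0 \<and> m \<in> carrier (Ib X) \<and> ms \<in> tensor_gens (Ibs r X)"
    if "xs \<in> tensor_gens (Ibs (Suc r) X)" for xs
    using that by (auto simp: tensor_gens_Cons I_mod_simps)
  show thesis
  proof (rule that[OF \<sigma>(1) \<rho>(1)])
    fix s assume s: "s \<in> carrier ?I"
    have "(aug_tensor \<pi> r X \<circ> \<sigma>) s = id s"
      by (rule I_tensor_eqI[OF hom_compose[OF \<sigma>(1) aug] _ I.is_group _ s])
        (use \<sigma>(2) aug_val[OF X uM] I.int_pow_1 I_tensor_closed in \<open>auto simp: hom_def\<close>)
    then show "aug_tensor \<pi> r X (\<sigma> s) = s" by simp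
  next
    fix s assume s: "s \<in> carrier ?J"
    have "(\<rho> \<circ> incl \<pi> r X) s = id s"
    proof (rule I_tensor_eqI[OF hom_compose[OF inc \<rho>(1)] _ J.is_group _ s])
      fix ms assume ms: "ms \<in> tensor_gens (Ibs (Suc r) X)"
      show "(\<rho> \<circ> incl \<pi> r X) (I_tensor (Suc r) X ms) = id (I_tensor (Suc r) X ms)"
        using incl_val[OF X ms] Suc_gens[OF ms] \<rho>(2) by auto
    qed (auto simp: hom_def)
    then show "\<rho> (incl \<pi> r X s) = s" by simp
  next
    fix s assume s: "s \<in> carrier ?J"
    have "(aug_tensor \<pi> r X \<circ> incl \<pi> r X) s = (\<lambda>_. \<one>\<^bsub>?I\<^esub>) s"
    proof (rule I_tensor_eqI[OF hom_compose[OF inc aug] _ I.is_group _ s])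
      fix ms assume ms: "ms \<in> tensor_gens (Ibs (Suc r) X)"
      show "(aug_tensor \<pi> r X \<circ> incl \<pi> r X) (I_tensor (Suc r) X ms) = \<one>\<^bsub>?I\<^esub>"
        using incl_val[OF X ms] Suc_gens[OF ms] aug_val[OF X] by auto
    qed (auto simp: hom_def)
    then show "aug_tensor \<pi> r X (incl \<pi> r X s) = \<one>\<^bsub>?I\<^esub>" by simp
  next
    fix s assume s: "s \<in> carrier ?M"
    \<comment> \<open>On elementary tensors this is the decomposition of the first entry
      \<open>m\<close> into \<open>reduce u m\<close> and the multiple of \<open>frag_of u\<close>
      by \<open>coeff_sum m\<close>.\<close>
    have "(\<lambda>s. (incl \<pi> r X \<circ> \<rho>) s \<otimes>\<^bsub>?M\<^esub> (\<sigma> \<circ> aug_tensor \<pi> r X) s) s = id s"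
    proof (rule MI_tensor_eqI[OF M.hom_group_mult[OF hom_compose[OF \<rho>(1) inc] hom_compose[OF aug \<sigma>(1)]] _ M.is_group _ s])
      fix m ms assume m: "m \<in> carrier (Mb X)" and ms: "ms \<in> tensor_gens (Ibs r X)"
      have red: "reduce u m \<in> carrier (Ib X)" using hom_in_carrier[OF reduce_hom[OF u] m] .
      have h: "(\<lambda>a. MI_tensor r X (a # ms)) \<in> hom (Mb X) ?M" using mM ms by blast
      have "\<sigma> (I_tensor r X ms [^]\<^bsub>?I\<^esub> coeff_sum m) = MI_tensor r X (frag_cmul (coeff_sum m) (frag_of u) # ms)"
        using hom_int_pow[OF \<sigma>(1) I_tensor_closed[OF ms] I.is_group M.is_group]
          hom_int_pow[OF h uM _ M.is_group] \<sigma>(2)[OF ms] u by (simp add: obj_M_pi)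
      moreover have "MI_tensor r X (reduce u m # ms) \<otimes>\<^bsub>?M\<^esub> MI_tensor r X (frag_cmul (coeff_sum m) (frag_of u) # ms)
          = MI_tensor r X (m # ms)"
        using hom_mult[OF h, of "reduce u m" "frag_cmul (coeff_sum m) (frag_of u)"] red
          order_trans[OF keys_cmul[of "coeff_sum m" "frag_of u"], of "Maps X"] u
        by (simp add: I_mod_simps obj_M_pi)
      ultimately show "(incl \<pi> r X \<circ> \<rho>) (MI_tensor r X (m # ms)) \<otimes>\<^bsub>?M\<^esub> (\<sigma> \<circ> aug_tensor \<pi> r X) (MI_tensor r X (m # ms)) =
          id (MI_tensor r X (m # ms))"
        using \<rho>(2)[OF m ms] aug_val[OF X m ms] incl_val[OF X, of "reduce u m # ms"] red ms by simp
    qed (auto simp: hom_def)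
    then show "incl \<pi> r X (\<rho> s) \<otimes>\<^bsub>?M\<^esub> \<sigma> (aug_tensor \<pi> r X s) = s" by simp
  qed
qed

end

section \<open>Expanding tensors of formal sums into tuples of generators\<close>

lemma frag_extend_frag_extend: "frag_extend f (frag_extend g c) = frag_extend (\<lambda>x. frag_extend f (g x)) c"
  using subset_UNIV by (induction c rule: frag_induction) (auto simp: frag_extend_diff)

definition tuples :: "nat \<Rightarrow> 'x set \<Rightarrow> 'x list set"
  where "tuples k S = {us. length us = k \<and> set us \<subseteq> S}"

text \<open>Multiplies out a tuple of formal sums; on tensors this is the canonical isomorphism from
  the k-th tensor power of Z[S] to Z[S^k].\<close>

fun expand :: "('x \<Rightarrow>\<^sub>0 int) list \<Rightarrow> ('x list \<Rightarrow>\<^sub>0 int)"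
  where "expand [] = frag_of []"
  | "expand (m # ms) = frag_extend (\<lambda>u. frag_extend (\<lambda>us. frag_of (u # us)) (expand ms)) m"

lemma Cons_hom:
  assumes "u \<in> S"
  shows "frag_extend (\<lambda>us. frag_of (u # us)) \<in> hom (free_Abelian_group (tuples k S)) (free_Abelian_group (tuples (Suc k) S))"
  by (rule hom_frag_extend) (use assms in \<open>auto simp: tuples_def\<close>)

lemma expand_closed:
  "ms \<in> tensor_gens (replicate k (free_Abelian_group S)) \<Longrightarrow> expand ms \<in> carrier (free_Abelian_group (tuples k S))"
proof (induction k arbitrary: ms)
  case (Suc k)
  then obtain m ms' where ms: "ms = m # ms'" "m \<in> carrier (free_Abelian_group S)"
    "ms' \<in> tensor_gens (replicate k (free_Abelian_group S))"
    by (auto simp: tensor_gens_Cons)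
  have "frag_extend (\<lambda>u. frag_extend (\<lambda>us. frag_of (u # us)) (expand ms')) \<in>
      hom (free_Abelian_group S) (free_Abelian_group (tuples (Suc k) S))"
    by (rule hom_frag_extend) (use hom_in_carrier[OF Cons_hom Suc.IH[OF ms(3)]] in simp)
  from hom_in_carrier[OF this ms(2)] show ?case by (simp add: ms)
qed (simp add: tuples_def)

lemma multilinear_expand:
  "multilinear (replicate k (free_Abelian_group S)) (free_Abelian_group (tuples k S)) expand"
proof (induction k)
  case (Suc k)
  show ?case
    unfolding replicate_Suc multilinear_Cons
  proof (intro conjI ballI)
    fix xs assume xs: "xs \<in> tensor_gens (replicate k (free_Abelian_group S))"
    show "(\<lambda>a. expand (a # xs)) \<in> hom (free_Abelian_group S) (free_Abelian_group (tuples (Suc k) S))"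
      unfolding expand.simps
      by (rule hom_frag_extend) (use hom_in_carrier[OF Cons_hom expand_closed[OF xs]] in simp)
  next
    fix a assume a: "a \<in> carrier (free_Abelian_group S)"
    \<comment> \<open>Interchanging the two sums exhibits \<open>expand (a # xs)\<close> as a
      homomorphism applied to \<open>expand xs\<close>, so the induction hypothesis gives
      multilinearity in the tail.\<close>
    have eq: "expand (a # xs) = frag_extend (\<lambda>us. frag_extend (\<lambda>u. frag_of (u # us)) a) (expand xs)" for xs
      unfolding expand.simps frag_extend_def frag_cmul_sum frag_cmul_cmul
      by (subst sum.swap) (simp add: mult.commute)
    have "frag_extend (\<lambda>us. frag_extend (\<lambda>u. frag_of (u # us)) a) \<in>
        hom (free_Abelian_group (tuples k S)) (free_Abelian_group (tuples (Suc k) S))"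
    proof (rule hom_frag_extend)
      fix us assume "us \<in> tuples k S"
      then show "Poly_Mapping.keys (frag_extend (\<lambda>u. frag_of (u # us)) a) \<subseteq> tuples (Suc k) S"
        using keys_frag_extend[of "\<lambda>u. frag_of (u # us)" a] a by (fastforce simp: tuples_def)
    qed
    from multilinear_hom[OF Suc this]
    show "multilinear (replicate k (free_Abelian_group S)) (free_Abelian_group (tuples (Suc k) S)) (\<lambda>xs. expand (a # xs))"
      unfolding eq by simp
  qed
qed (simp add: tuples_def)

text \<open>Z[S^k] has the universal property of the tensor power: a multilinear map is recovered
  from its values on tuples of basis elements. The first entry is reduced to a basis element
  \<open>u\<close>, and the rest follows by induction for the map with \<open>u\<close> held
  fixed.\<close>

lemma expand_universal:
  assumes C: "group C"
    and "multilinear (replicate k (free_Abelian_group S)) C \<gamma>"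
    and "L \<in> hom (free_Abelian_group (tuples k S)) C"
    and "\<And>us. us \<in> tuples k S \<Longrightarrow> L (frag_of us) = \<gamma> (map frag_of us)"
    and "ms \<in> tensor_gens (replicate k (free_Abelian_group S))"
  shows "L (expand ms) = \<gamma> ms"
  using assms(2-)
proof (induction k arbitrary: \<gamma> L ms)
  case (Suc k)
  let ?F = "free_Abelian_group S"
  from Suc.prems(4) obtain m ms' where ms: "ms = m # ms'" "m \<in> carrier ?F" "ms' \<in> tensor_gens (replicate k ?F)"
    by (auto simp: tensor_gens_Cons)
  note \<gamma> = Suc.prems(1)[unfolded replicate_Suc multilinear_Cons]
  have "(L \<circ> (\<lambda>a. expand (a # ms'))) m = (\<lambda>a. \<gamma> (a # ms')) m"
  proof (rule hom_free_eqI[OF hom_compose[OF _ Suc.prems(2)] _ C _ ms(2)])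
    show "(\<lambda>a. expand (a # ms')) \<in> hom ?F (free_Abelian_group (tuples (Suc k) S))"
      using multilinear_expand[of "Suc k" S] ms(3) unfolding replicate_Suc multilinear_Cons by blast
    show "(\<lambda>a. \<gamma> (a # ms')) \<in> hom ?F C" using \<gamma> ms(3) by blast
    fix u assume u: "u \<in> S"
    have "(L \<circ> frag_extend (\<lambda>us. frag_of (u # us))) (expand ms') = \<gamma> (frag_of u # ms')"
    proof (rule Suc.IH[OF _ hom_compose[OF Cons_hom[OF u] Suc.prems(2)] _ ms(3), where \<gamma> = "\<lambda>xs. \<gamma> (frag_of u # xs)"])
      show "multilinear (replicate k ?F) C (\<lambda>xs. \<gamma> (frag_of u # xs))" using \<gamma> u by simp
      fix us assume "us \<in> tuples k S"
      then show "(L \<circ> frag_extend (\<lambda>us. frag_of (u # us))) (frag_of us) = \<gamma> (frag_of u # map frag_of us)"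
        using Suc.prems(3)[of "u # us"] u by (simp add: tuples_def)
    qed
    then show "(L \<circ> (\<lambda>a. expand (a # ms'))) (frag_of u) = \<gamma> (frag_of u # ms')" by simp
  qed
  then show ?case by (simp add: ms)
qed (simp add: tuples_def)

text \<open>Naturality of the expansion under relabelling of generators, the form taken by
  restriction along an orbit map.\<close>

lemma expand_map:
  "expand (map (frag_extend (\<lambda>u. frag_of (h u))) ms) = frag_extend (\<lambda>us. frag_of (map h us)) (expand ms)"
  by (induction ms) (simp_all add: frag_extend_frag_extend)

context discrete_group
begin

section \<open>Projectivity of \<open>M_pi \<otimes> I^r\<close> through tuples of equivariant
  maps\<close>

abbreviation pullback :: "('a \<times> 'a) set set \<Rightarrow> (('a \<times> 'a) set \<Rightarrow> ('a \<times> 'a) set) \<Rightarrow>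
    (('a \<times> 'a) set \<Rightarrow> 'a) list \<Rightarrow> (('a \<times> 'a) set \<Rightarrow> 'a) list"
  where "pullback X f us \<equiv> map (\<lambda>u. compose X u f) us"

text \<open>A k-tuple of equivariant maps on X has one orbit in \<open>\<pi>\<^sup>k\<close> as image, so it factors uniquely through
  the orbit of any point t of that image. Hence the functor of k-tuples is a disjoint union of
  representable functors, and lifting reduces to choosing one lift for each t.\<close>

lemma lift_tuples:
  fixes E :: "('a \<times> 'a, 'e) omodule" and B :: "('a \<times> 'a, 'b) omodule"
  assumes E: "is_omodule GG \<D> E" and B: "is_omodule GG \<D> B" and q: "q \<in> nat_trans GG \<D> E B" and k: "k > 0"
    and b: "\<And>X us. \<lbrakk>X \<in> Orb; us \<in> tuples k (Maps X)\<rbrakk> \<Longrightarrow> b X us \<in> q X ` carrier (obj E X)"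
    and bnat: "\<And>X Y f us. \<lbrakk>X \<in> Orb; Y \<in> Orb; f \<in> Mor X Y; us \<in> tuples k (Maps Y)\<rbrakk>
      \<Longrightarrow> b X (pullback X f us) = arr B X Y f (b Y us)"
  obtains \<eta> where
    "\<And>X us. \<lbrakk>X \<in> Orb; us \<in> tuples k (Maps X)\<rbrakk> \<Longrightarrow> \<eta> X us \<in> carrier (obj E X) \<and> q X (\<eta> X us) = b X us"
    "\<And>X Y f us. \<lbrakk>X \<in> Orb; Y \<in> Orb; f \<in> Mor X Y; us \<in> tuples k (Maps Y)\<rbrakk>
      \<Longrightarrow> \<eta> X (pullback X f us) = arr E X Y f (\<eta> Y us)"
proof -
  interpret G: group GG by (rule group_GG)
  \<comment> \<open>\<open>ev us\<close> regards a tuple as one equivariant map from X to the k-fold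
    product of \<pi>, and \<open>R t\<close> is the orbit with stabilizer \<open>stab t\<close>. The
    base point \<open>t X us\<close> depends only on the image of \<open>ev us\<close>. The
    factorization \<open>F X us t\<close> sends C to all \<open>g\<close> moving \<open>t\<close> to
    \<open>ev us C\<close>; this set is itself a left coset of \<open>stab t\<close>, so no
    representatives are chosen.\<close>
  define ev where "ev us C = map (\<lambda>u. u C) us" for us :: "(('a \<times> 'a) set \<Rightarrow> 'a) list" and C
  define R where "R t = lcosets\<^bsub>GG\<^esub> stab t" for t
  define t where "t X us = (SOME t. t \<in> ev us ` X)" for X us
  define F where "F X us t = (\<lambda>C\<in>X. {g \<in> carrier GG. map (act g) t = ev us C})" for X us t
  let ?T = "{t. length t = k \<and> set t \<subseteq> carrier \<pi>}"
  have stabD: "stab t \<in> \<D>" if "t \<in> ?T" for t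
    using stab_in_D[of t] that k by auto
  have R: "R t \<in> Orb" if "t \<in> ?T" for t
    using stabD[OF that] unfolding R_def orbits_def by blast
  \<comment> \<open>The universal tuple over \<open>R t\<close>, with value \<open>t\<close> at the
    base coset; every tuple whose image contains \<open>t\<close> is a pullback of it.\<close>
  have "\<exists>v. v \<in> tuples k (Maps (R t)) \<and> (\<forall>a\<in>carrier GG. ev v (a <#\<^bsub>GG\<^esub> stab t) = map (act a) t)"
    if t: "t \<in> ?T" for t
  proof -
    have "\<forall>x\<in>set t. \<exists>v. v \<in> Maps (R t) \<and> (\<forall>a\<in>carrier GG. v (a <#\<^bsub>GG\<^esub> stab t) = act a x)"
    proof
      fix x assume x: "x \<in> set t"
      have "act h x = x" if "h \<in> stab t" for h
        using that x unfolding stab_def by (auto simp: map_idI list_eq_iff_nth_eq in_set_conv_nth)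
      then show "\<exists>v. v \<in> Maps (R t) \<and> (\<forall>a\<in>carrier GG. v (a <#\<^bsub>GG\<^esub> stab t) = act a x)"
        using coset_map[OF stabD[OF t], of x] x t unfolding R_def by blast
    qed
    from bchoice[OF this] obtain w where w: "\<forall>x\<in>set t. w x \<in> Maps (R t) \<and>
        (\<forall>a\<in>carrier GG. w x (a <#\<^bsub>GG\<^esub> stab t) = act a x)" ..
    show ?thesis
      by (rule exI[of _ "map w t"]) (use w t in \<open>auto simp: tuples_def ev_def\<close>)
  qed
  then have "\<forall>t\<in>?T. \<exists>v. v \<in> tuples k (Maps (R t)) \<and> (\<forall>a\<in>carrier GG. ev v (a <#\<^bsub>GG\<^esub> stab t) = map (act a) t)"
    ..
  from bchoice[OF this] obtain v where v': "\<forall>t\<in>?T. v t \<in> tuples k (Maps (R t)) \<and>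
      (\<forall>a\<in>carrier GG. ev (v t) (a <#\<^bsub>GG\<^esub> stab t) = map (act a) t)" ..
  have v: "\<And>t. t \<in> ?T \<Longrightarrow> v t \<in> tuples k (Maps (R t))"
    "\<And>t a. \<lbrakk>t \<in> ?T; a \<in> carrier GG\<rbrakk> \<Longrightarrow> ev (v t) (a <#\<^bsub>GG\<^esub> stab t) = map (act a) t"
    using v' by blast+
  \<comment> \<open>The only free choice in the lift: an element over the value of \<open>b\<close>
    at the universal tuple, one for each \<open>t\<close>.\<close>
  have "\<exists>e. e \<in> carrier (obj E (R t)) \<and> q (R t) e = b (R t) (v t)" if "t \<in> ?T" for t
    using b[OF R[OF that] v(1)[OF that]] by force
  then have "\<forall>t\<in>?T. \<exists>e. e \<in> carrier (obj E (R t)) \<and> q (R t) e = b (R t) (v t)" ..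
  from bchoice[OF this] obtain \<epsilon> where "\<forall>t\<in>?T. \<epsilon> t \<in> carrier (obj E (R t)) \<and> q (R t) (\<epsilon> t) = b (R t) (v t)" ..
  then have \<epsilon>: "\<And>t. t \<in> ?T \<Longrightarrow> \<epsilon> t \<in> carrier (obj E (R t))"
    "\<And>t. t \<in> ?T \<Longrightarrow> q (R t) (\<epsilon> t) = b (R t) (v t)"
    by blast+
  have ev_act: "ev us (a <#\<^bsub>GG\<^esub> C) = map (act a) (ev us C)"
    if "us \<in> tuples k (Maps X)" "a \<in> carrier GG" "C \<in> X" for us a C X
    using that by (auto simp: ev_def tuples_def equivariant_maps_def)
  have ev_closed: "ev us C \<in> ?T" if "us \<in> tuples k (Maps X)" "C \<in> X" for us C X
    using that by (auto simp: ev_def tuples_def equivariant_maps_def)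
  have t: "t X us \<in> ev us ` X" if "X \<in> Orb" for X us
    unfolding t_def by (rule someI_ex) (use Orb_nonempty[OF that] in blast)
  have coset: "{g \<in> carrier GG. map (act g) t = map (act a) t} = a <#\<^bsub>GG\<^esub> stab t"
    if a: "a \<in> carrier GG" and t: "t \<in> ?T" for a t
  proof (intro equalityI subsetI)
    fix g assume "g \<in> {g \<in> carrier GG. map (act g) t = map (act a) t}"
    then have g: "g \<in> carrier GG" "map (act g) t = map (act a) t" by auto
    have "map (act (inv\<^bsub>GG\<^esub> a \<otimes>\<^bsub>GG\<^esub> g)) t = map (act (inv\<^bsub>GG\<^esub> a)) (map (act g) t)"
      using act_mult[OF G.inv_closed[OF a] g(1)] t by auto
    also have "\<dots> = t" unfolding g(2) map_map by (rule map_idI) (use act_inv[OF a] t in auto)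
    finally have "inv\<^bsub>GG\<^esub> a \<otimes>\<^bsub>GG\<^esub> g \<in> stab t" using a g(1) unfolding stab_def by (simp only: G.m_closed G.inv_closed mem_Collect_eq)
    moreover have "g = a \<otimes>\<^bsub>GG\<^esub> (inv\<^bsub>GG\<^esub> a \<otimes>\<^bsub>GG\<^esub> g)"
      using a g(1) by (simp only: G.m_assoc[symmetric] G.inv_closed G.r_inv G.l_one)
    ultimately show "g \<in> a <#\<^bsub>GG\<^esub> stab t" unfolding l_coset_def by blast
  next
    fix g assume "g \<in> a <#\<^bsub>GG\<^esub> stab t"
    then obtain h where h: "h \<in> carrier GG" "map (act h) t = t" "g = a \<otimes>\<^bsub>GG\<^esub> h"
      unfolding l_coset_def stab_def by blast
    have "map (act g) t = map (act a) (map (act h) t)"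
      unfolding h(3) using act_mult[OF a h(1)] t by auto
    then show "g \<in> {g \<in> carrier GG. map (act g) t = map (act a) t}"
      using h a by (simp only: mem_Collect_eq G.m_closed)
  qed
  have F: "F X us s \<in> Mor X (R s)" "pullback X (F X us s) (v s) = us"
    if X: "X \<in> Orb" and us: "us \<in> tuples k (Maps X)" and s: "s \<in> ev us ` X" for X us s
  proof -
    have sT: "s \<in> ?T" using s ev_closed[OF us] by blast
    have val: "\<exists>a\<in>carrier GG. ev us C = map (act a) s \<and> F X us s C = a <#\<^bsub>GG\<^esub> stab s" if C: "C \<in> X" for C
    proof -
      obtain C0 where C0: "C0 \<in> X" "s = ev us C0" using s by blast
      obtain a where a: "a \<in> carrier GG" "C = a <#\<^bsub>GG\<^esub> C0" using Orb_transitive[OF X C0(1) C] .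
      have "ev us C = map (act a) s" using ev_act[OF us a(1) C0(1)] a(2) C0(2) by simp
      then show ?thesis using coset[OF a(1) sT] a(1) C unfolding F_def by auto
    qed
    show "F X us s \<in> Mor X (R s)"
      unfolding orbit_maps_def equivariant_maps_def
    proof (intro CollectI conjI ballI)
      show "F X us s \<in> X \<rightarrow>\<^sub>E R s"
      proof (rule PiE_I)
        fix C assume "C \<in> X"
        then show "F X us s C \<in> R s" using val unfolding R_def LCOSETS_def by blast
      qed (simp add: F_def)
      fix g C assume g: "g \<in> carrier GG" and C: "C \<in> X"
      obtain a where a: "a \<in> carrier GG" "ev us C = map (act a) s" "F X us s C = a <#\<^bsub>GG\<^esub> stab s" using val[OF C] by blast
      have "ev us (g <#\<^bsub>GG\<^esub> C) = map (act (g \<otimes>\<^bsub>GG\<^esub> a)) s"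
        using ev_act[OF us g C] a act_mult[OF g a(1)] sT by auto
      then have "F X us s (g <#\<^bsub>GG\<^esub> C) = (g \<otimes>\<^bsub>GG\<^esub> a) <#\<^bsub>GG\<^esub> stab s"
        using coset[OF G.m_closed[OF g a(1)] sT] closed_orbit[OF X g C] unfolding F_def by auto
      then show "F X us s (g <#\<^bsub>GG\<^esub> C) = g <#\<^bsub>GG\<^esub> F X us s C"
        unfolding a(3) G.lcos_m_assoc[OF D_subset[OF stabD[OF sT]] g a(1)] .
    qed
    show "pullback X (F X us s) (v s) = us"
    proof (rule nth_equalityI)
      show len: "length (pullback X (F X us s) (v s)) = length us" using v(1)[OF sT] us by (simp add: tuples_def)
      fix i assume "i < length (pullback X (F X us s) (v s))"
      then have i: "i < length (v s)" "i < length us" using len by auto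
      have "compose X (v s ! i) (F X us s) C = (us ! i) C" for C
      proof (cases "C \<in> X")
        case True
        obtain a where a: "a \<in> carrier GG" "ev us C = map (act a) s" "F X us s C = a <#\<^bsub>GG\<^esub> stab s" using val[OF True] by blast
        have "ev (v s) (F X us s C) = ev us C" using v(2)[OF sT a(1)] a by simp
        then have "ev (v s) (F X us s C) ! i = ev us C ! i" by simp
        then show ?thesis using i True by (simp add: ev_def compose_eq)
      next
        case False
        have "us ! i \<in> Maps X" using us i(2) unfolding tuples_def by auto
        then show ?thesis using False by (auto simp: equivariant_maps_def compose_def PiE_iff extensional_def)
      qed
      then show "pullback X (F X us s) (v s) ! i = us ! i" using i by auto
    qed
  qed
  define \<eta> where "\<eta> X us = arr E X (R (t X us)) (F X us (t X us)) (\<epsilon> (t X us))" for X us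
  show thesis
  proof (rule that[of \<eta>])
    fix X us assume X: "X \<in> Orb" and us: "us \<in> tuples k (Maps X)"
    define s where "s = t X us"
    have s: "s \<in> ev us ` X" using t[OF X] by (simp add: s_def)
    then have sT: "s \<in> ?T" using ev_closed[OF us] by blast
    have "\<eta> X us \<in> carrier (obj E X)"
      unfolding \<eta>_def s_def[symmetric] by (rule is_omoduleD(4)[OF E X R[OF sT] F(1)[OF X us s] \<epsilon>(1)[OF sT]])
    moreover have "q X (\<eta> X us) = b X us"
      unfolding \<eta>_def s_def[symmetric]
      using nat_transD(4)[OF q X R[OF sT] F(1)[OF X us s] \<epsilon>(1)[OF sT]] \<epsilon>(2)[OF sT]
        bnat[OF X R[OF sT] F(1)[OF X us s] v(1)[OF sT]] F(2)[OF X us s] by simp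
    ultimately show "\<eta> X us \<in> carrier (obj E X) \<and> q X (\<eta> X us) = b X us" ..
  next
    fix X Y f us assume X: "X \<in> Orb" and Y: "Y \<in> Orb" and f: "f \<in> Mor X Y" and us: "us \<in> tuples k (Maps Y)"
    have ev: "ev (pullback X f us) C = ev us (f C)" if "C \<in> X" for C
      using that by (simp add: ev_def compose_eq)
    \<comment> \<open>Equal images force the same \<open>SOME\<close> base point for a tuple and its
      pullback; otherwise two unrelated choices of \<epsilon> would enter and naturality could
      fail.\<close>
    have "ev (pullback X f us) ` X = ev us ` (f ` X)"
      using ev by (force simp: image_image)
    then have teq: "t X (pullback X f us) = t Y us" unfolding t_def Mor_surj[OF X Y f] by simp
    define s where "s = t Y us"
    have s: "s \<in> ev us ` Y" using t[OF Y] by (simp add: s_def)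
    then have sT: "s \<in> ?T" using ev_closed[OF us] by blast
    have fX: "f C \<in> Y" if "C \<in> X" for C using f that unfolding orbit_maps_def equivariant_maps_def by auto
    have "F X (pullback X f us) s = compose X (F Y us s) f"
    proof
      fix C show "F X (pullback X f us) s C = compose X (F Y us s) f C"
        using ev[of C] fX[of C] by (cases "C \<in> X") (simp_all add: F_def compose_def)
    qed
    then show "\<eta> X (pullback X f us) = arr E X Y f (\<eta> Y us)"
      unfolding \<eta>_def teq s_def[symmetric]
      using is_omoduleD(6)[OF E X Y R[OF sT] f F(1)[OF Y us s] \<epsilon>(1)[OF sT]] by simp
  qed
qed

text \<open>\<open>MI r\<close> is a retract of the free module on (r + 1)-tuples: the retraction sends
  \<open>(u\<^sub>0, \<dots>, u\<^sub>r)\<close> to \<open>u\<^sub>0 \<otimes> (u\<^sub>1 - u\<^sub>0) \<otimes> \<cdots> \<otimes> (u\<^sub>r - u\<^sub>0)\<close>.\<close>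

definition retract :: "nat \<Rightarrow> ('a \<times> 'a) set set \<Rightarrow> (('a \<times> 'a) set \<Rightarrow> 'a) list \<Rightarrow> 'a tensor_elem"
  where "retract r X us = MI_tensor r X (frag_of (hd us) # map (\<lambda>u. frag_of u - frag_of (hd us)) (tl us))"

lemma retract_gens:
  assumes "us \<in> tuples (Suc r) (Maps X)"
  shows "frag_of (hd us) # map (\<lambda>u. frag_of u - frag_of (hd us)) (tl us) \<in> tensor_gens (MIbs r X)"
proof -
  obtain u us' where us: "us = u # us'" "u \<in> Maps X" "set us' \<subseteq> Maps X" "length us' = r"
    using assms by (cases us) (auto simp: tuples_def)
  have "frag_of w - frag_of u \<in> carrier (Ib X)" if "w \<in> Maps X" for w
    using us(2) that keys_diff[of "frag_of w" "frag_of u"] by (auto simp: I_mod_simps obj_M_pi coeff_sum_diff)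
  then have "map (\<lambda>u'. frag_of u' - frag_of u) us' \<in> tensor_gens (Ibs r X)"
    using us nth_mem[of _ us'] by (auto simp: tensor_gens_iff subset_iff)
  then show ?thesis using us by (simp add: obj_M_pi)
qed

text \<open>Restriction sends basis elements to basis elements and respects differences, so the
  formula for \<open>retract\<close> is natural although it singles out the first entry.\<close>

lemma retract_pullback:
  assumes X: "X \<in> Orb" and Y: "Y \<in> Orb" and f: "f \<in> Mor X Y" and us: "us \<in> tuples (Suc r) (Maps Y)"
  shows "retract r X (pullback X f us) = arr (MI \<pi> r) X Y f (retract r Y us)"
proof -
  have "us \<noteq> []" using us by (auto simp: tuples_def)
  then show ?thesis
    using arr_tensors(2)[OF X Y f retract_gens[OF us]]
    by (simp add: retract_def arr_M_pi frag_extend_diff hd_map map_tl comp_def)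
qed

lemma Ibs_gens_free: "xs \<in> tensor_gens (Ibs k X) \<Longrightarrow> xs \<in> tensor_gens (replicate k (free_Abelian_group (Maps X)))"
  by (auto simp: tensor_gens_iff I_mod_simps obj_M_pi)

lemma MIbs_gens_free: "xs \<in> tensor_gens (MIbs k X) \<Longrightarrow> xs \<in> tensor_gens (replicate (Suc k) (free_Abelian_group (Maps X)))"
  unfolding tensor_gens_Cons replicate_Suc obj_M_pi using Ibs_gens_free by blast

lemma multilinear_MIbs:
  assumes "multilinear (replicate (Suc r) (free_Abelian_group (Maps X))) C \<gamma>"
  shows "multilinear (MIbs r X) C \<gamma>"
proof -
  have "(\<lambda>x. x) \<in> hom (Ib X) (free_Abelian_group (Maps X))"
    by (simp add: hom_def I_mod_simps obj_M_pi)
  note multilinear_map(1)[OF _ this]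
  then show ?thesis
    using assms Ibs_gens_free unfolding replicate_Suc multilinear_Cons obj_M_pi list.map_ident by blast
qed

text \<open>The retraction identity, tested against homomorphisms into \<open>C\<close>: expanding
  an elementary tensor of \<open>MI \<pi> r\<close> and then retracting gives it back. With first
  entry \<open>u\<close> the retraction acts on the others as \<open>reduce u\<close>, which is the
  identity on I.\<close>

lemma retract_expand:
  assumes C: "group C" and g: "g \<in> hom (tensor (MIbs r X)) C"
    and L: "L \<in> hom (free_Abelian_group (tuples (Suc r) (Maps X))) C"
    and Lg: "\<And>us. us \<in> tuples (Suc r) (Maps X) \<Longrightarrow> L (frag_of us) = g (retract r X us)"
    and ms: "ms \<in> tensor_gens (MIbs r X)"
  shows "L (expand ms) = g (MI_tensor r X ms)"
proof -
  note mM = multilinear_hom[OF multilinear_MI_tensor g Is_groups(2), unfolded multilinear_Cons]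
  obtain m ms' where m: "ms = m # ms'" "m \<in> carrier (free_Abelian_group (Maps X))" "ms' \<in> tensor_gens (Ibs r X)"
    using ms by (auto simp: tensor_gens_Cons obj_M_pi)
  have "(L \<circ> (\<lambda>a. expand (a # ms'))) m = (\<lambda>a. g (MI_tensor r X (a # ms'))) m"
  proof (rule hom_free_eqI[OF hom_compose[OF _ L] _ C _ m(2)])
    show "(\<lambda>a. expand (a # ms')) \<in> hom (free_Abelian_group (Maps X)) (free_Abelian_group (tuples (Suc r) (Maps X)))"
      using multilinear_expand[of "Suc r" "Maps X"] Ibs_gens_free[OF m(3)] unfolding replicate_Suc multilinear_Cons by blast
    show "(\<lambda>a. g (MI_tensor r X (a # ms'))) \<in> hom (free_Abelian_group (Maps X)) C"
      using mM m(3) unfolding obj_M_pi by blast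
    fix u assume u: "u \<in> Maps X"
    have uM: "frag_of u \<in> carrier (Mb X)" using u by (simp add: obj_M_pi)
    \<comment> \<open>Chosen to agree with \<open>retract\<close> on basis elements, where
      \<open>reduce u\<close> subtracts \<open>frag_of u\<close>, and to be defined on all formal
      sums, so that \<open>expand_universal\<close> applies.\<close>
    let ?\<gamma> = "\<lambda>xs. g (MI_tensor r X (frag_of u # map (reduce u) xs))"
    have "(L \<circ> frag_extend (\<lambda>us. frag_of (u # us))) (expand ms') = ?\<gamma> ms'"
    proof (rule expand_universal[OF C _ hom_compose[OF Cons_hom[OF u] L] _ Ibs_gens_free[OF m(3)], where \<gamma> = ?\<gamma>])
      have "multilinear (Ibs r X) C (\<lambda>xs. g (MI_tensor r X (frag_of u # xs)))"
        using mM uM by blast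
      from multilinear_map(1)[OF this reduce_hom[OF u]]
      show "multilinear (replicate r (free_Abelian_group (Maps X))) C ?\<gamma>" unfolding obj_M_pi .
      fix us assume "us \<in> tuples r (Maps X)"
      then show "(L \<circ> frag_extend (\<lambda>us. frag_of (u # us))) (frag_of us) = ?\<gamma> (map frag_of us)"
        using Lg[of "u # us"] u by (simp add: tuples_def retract_def comp_def)
    qed
    \<comment> \<open>The later entries lie in I and have augmentation zero, so nothing is
      subtracted.\<close>
    moreover have "map (reduce u) ms' = ms'"
    proof (rule map_idI)
      fix x assume "x \<in> set ms'"
      then have "x \<in> carrier (Ib X)" using m(3) by (auto simp: tensor_gens_iff in_set_conv_nth)
      then show "reduce u x = x" by (simp add: I_mod_simps)
    qed
    ultimately show "(L \<circ> (\<lambda>a. expand (a # ms'))) (frag_of u) = g (MI_tensor r X (frag_of u # ms'))" by simp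
  qed
  then show ?thesis by (simp add: m(1))
qed

text \<open>Projectivity of \<open>MI \<pi> r\<close> in usable form: instead of \<open>q\<close>
  being onto, the image of \<open>g\<close> has to lie in that of \<open>q\<close>, and the carrier
  types of \<open>E\<close> and \<open>B\<close> are arbitrary.\<close>

lemma MI_lifts:
  fixes E :: "('a \<times> 'a, 'e) omodule" and B :: "('a \<times> 'a, 'b) omodule"
  assumes E: "is_omodule GG \<D> E" and B: "is_omodule GG \<D> B" and q: "q \<in> nat_trans GG \<D> E B"
    and g: "g \<in> nat_trans GG \<D> (MI \<pi> r) B"
    and im: "\<And>X x. \<lbrakk>X \<in> Orb; x \<in> carrier (obj (MI \<pi> r) X)\<rbrakk> \<Longrightarrow> g X x \<in> q X ` carrier (obj E X)"
  obtains h where "h \<in> nat_trans GG \<D> (MI \<pi> r) E"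
    "\<And>X x. \<lbrakk>X \<in> Orb; x \<in> carrier (obj (MI \<pi> r) X)\<rbrakk> \<Longrightarrow> q X (h X x) = g X x"
proof -
  let ?T = "\<lambda>X. tuples (Suc r) (Maps X)"
  let ?F = "\<lambda>X. free_Abelian_group (?T X)"
  have ret: "retract r X us \<in> carrier (obj (MI \<pi> r) X)" if "us \<in> ?T X" for X us
    using MI_tensor_closed[OF retract_gens[OF that]] by (simp add: obj_MI retract_def)
  obtain \<eta> where
    \<eta>: "\<And>X us. \<lbrakk>X \<in> Orb; us \<in> ?T X\<rbrakk> \<Longrightarrow> \<eta> X us \<in> carrier (obj E X) \<and> q X (\<eta> X us) = g X (retract r X us)"
    and \<eta>nat: "\<And>X Y f us. \<lbrakk>X \<in> Orb; Y \<in> Orb; f \<in> Mor X Y; us \<in> ?T Y\<rbrakk>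
      \<Longrightarrow> \<eta> X (pullback X f us) = arr E X Y f (\<eta> Y us)"
  \<comment> \<open>The map lifted on tuples is \<open>g\<close> after the retraction.\<close>
  proof (rule lift_tuples[OF E B q, of "Suc r" "\<lambda>X us. g X (retract r X us)"])
    show "g X (retract r X us) \<in> q X ` carrier (obj E X)" if "X \<in> Orb" "us \<in> ?T X" for X us
      by (rule im[OF that(1) ret[OF that(2)]])
    show "g X (retract r X (pullback X f us)) = arr B X Y f (g Y (retract r Y us))"
      if "X \<in> Orb" "Y \<in> Orb" "f \<in> Mor X Y" "us \<in> ?T Y" for X Y f us
      using retract_pullback[OF that] nat_transD(4)[OF g that(1-3) ret[OF that(4)]] by simp
  qed auto
  have "\<forall>X\<in>Orb. \<exists>L. L \<in> hom (?F X) (obj E X) \<and> (\<forall>us\<in>?T X. L (frag_of us) = \<eta> X us)"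
  proof
    fix X assume X: "X \<in> Orb"
    interpret C: comm_group "obj E X" by (rule is_omoduleD(1)[OF E X])
    show "\<exists>L. L \<in> hom (?F X) (obj E X) \<and> (\<forall>us\<in>?T X. L (frag_of us) = \<eta> X us)"
      by (rule C.free_Abelian_group_universal[of "\<eta> X" "?T X"]) (use \<eta>[OF X] in blast)+
  qed
  from bchoice[OF this] obtain L where "\<forall>X\<in>Orb. L X \<in> hom (?F X) (obj E X) \<and> (\<forall>us\<in>?T X. L X (frag_of us) = \<eta> X us)" ..
  then have L: "\<And>X. X \<in> Orb \<Longrightarrow> L X \<in> hom (?F X) (obj E X)"
    and Lg: "\<And>X us. \<lbrakk>X \<in> Orb; us \<in> ?T X\<rbrakk> \<Longrightarrow> L X (frag_of us) = \<eta> X us" by blast+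
  \<comment> \<open>The lift on \<open>MI \<pi> r\<close> is the linear extension of
    \<open>\<eta>\<close> precomposed with the section \<open>expand\<close> of the
    retraction.\<close>
  have "\<forall>X\<in>Orb. \<exists>t. t \<in> hom (tensor (MIbs r X)) (obj E X) \<and> t \<in> extensional (carrier (tensor (MIbs r X))) \<and>
    (\<forall>ms\<in>tensor_gens (MIbs r X). t (MI_tensor r X ms) = L X (expand ms))"
  proof
    fix X assume X: "X \<in> Orb"
    have "multilinear (replicate (Suc r) (free_Abelian_group (Maps X))) (obj E X) (\<lambda>ms. L X (expand ms))"
      by (rule multilinear_hom[OF multilinear_expand L[OF X]]) simp
    then have "multilinear (MIbs r X) (obj E X) (\<lambda>ms. L X (expand ms))"
      by (rule multilinear_MIbs)
    from MI_tensor_universal[OF is_omoduleD(1)[OF E X] this]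
    show "\<exists>t. t \<in> hom (tensor (MIbs r X)) (obj E X) \<and> t \<in> extensional (carrier (tensor (MIbs r X))) \<and>
      (\<forall>ms\<in>tensor_gens (MIbs r X). t (MI_tensor r X ms) = L X (expand ms))" by metis
  qed
  from bchoice[OF this] obtain t where "\<forall>X\<in>Orb. t X \<in> hom (tensor (MIbs r X)) (obj E X) \<and>
    t X \<in> extensional (carrier (tensor (MIbs r X))) \<and>
    (\<forall>ms\<in>tensor_gens (MIbs r X). t X (MI_tensor r X ms) = L X (expand ms))" ..
  then have t: "\<And>X. X \<in> Orb \<Longrightarrow> t X \<in> hom (tensor (MIbs r X)) (obj E X)"
    "\<And>X. X \<in> Orb \<Longrightarrow> t X \<in> extensional (carrier (tensor (MIbs r X)))"
    "\<And>X ms. \<lbrakk>X \<in> Orb; ms \<in> tensor_gens (MIbs r X)\<rbrakk> \<Longrightarrow> t X (MI_tensor r X ms) = L X (expand ms)"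
    by blast+
  define h where "h = (\<lambda>X\<in>Orb. t X)"
  have hX: "h X = t X" if "X \<in> Orb" for X using that by (simp add: h_def)
  have Lnat: "L X (frag_extend (\<lambda>us. frag_of (pullback X f us)) c) = arr E X Y f (L Y c)"
    if X: "X \<in> Orb" and Y: "Y \<in> Orb" and f: "f \<in> Mor X Y" and c: "c \<in> carrier (?F Y)" for X Y f c
  proof -
    have pb: "pullback X f us \<in> ?T X" if "us \<in> ?T Y" for us
      using that Maps_compose[OF X f] by (auto simp: tuples_def)
    have "(L X \<circ> frag_extend (\<lambda>us. frag_of (pullback X f us))) c = (arr E X Y f \<circ> L Y) c"
    proof (rule hom_free_eqI[OF hom_compose[OF _ L[OF X]] hom_compose[OF L[OF Y] is_omoduleD(3)[OF E X Y f]]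
          is_omoduleD(2)[OF E X] _ c])
      show "frag_extend (\<lambda>us. frag_of (pullback X f us)) \<in> hom (?F Y) (?F X)"
        by (rule hom_frag_extend) (use pb in simp)
      show "(L X \<circ> frag_extend (\<lambda>us. frag_of (pullback X f us))) (frag_of us) = (arr E X Y f \<circ> L Y) (frag_of us)"
        if "us \<in> ?T Y" for us
        using Lg[OF X pb[OF that]] Lg[OF Y that] \<eta>nat[OF X Y f that] by simp
    qed
    then show ?thesis by simp
  qed
  show thesis
  proof (rule that[of h])
    show "h \<in> nat_trans GG \<D> (MI \<pi> r) E"
      unfolding MI_def
    proof (rule tensor_nat_transI[OF Is_omodules(2) E])
      fix X Y f ys
      assume X: "X \<in> Orb" and Y: "Y \<in> Orb" and f: "f \<in> Mor X Y" and "ys \<in> tensor_gens (map (\<lambda>M. obj M Y) (MIs r))"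
      then have ys: "ys \<in> tensor_gens (MIbs r Y)" by simp
      have "h X (MI_tensor r X (map (arr (M_pi \<pi>) X Y f) ys)) = arr E X Y f (h Y (MI_tensor r Y ys))"
        using arr_tensors(2)[OF X Y f ys] t(3) Lnat[OF X Y f expand_closed[OF MIbs_gens_free[OF ys]]] ys X Y hX
        by (simp add: arr_M_pi expand_map)
      then show "h X (tensor_class (map (\<lambda>M. obj M X) (MIs r)) (frag_of (map2 (\<lambda>M. arr M X Y f) (MIs r) ys))) =
         arr E X Y f (h Y (tensor_class (map (\<lambda>M. obj M Y) (MIs r)) (frag_of ys)))"
        unfolding map2_arr_M[OF ys] MI_tensor_def by simp
    qed (use t hX in \<open>auto simp: h_def\<close>)
    fix X x assume X: "X \<in> Orb" and x: "x \<in> carrier (obj (MI \<pi> r) X)"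
    have gX: "g X \<in> hom (tensor (MIbs r X)) (obj B X)"
      using nat_transD(1)[OF g X] by (simp add: obj_MI)
    have "(q X \<circ> t X) x = g X x"
    proof (rule MI_tensor_eqI[OF hom_compose[OF t(1)[OF X] nat_transD(1)[OF q X]] gX is_omoduleD(2)[OF B X]])
      fix m ms assume "m \<in> carrier (Mb X)" "ms \<in> tensor_gens (Ibs r X)"
      then have ms: "m # ms \<in> tensor_gens (MIbs r X)" by simp
      have "(q X \<circ> L X) (expand (m # ms)) = g X (MI_tensor r X (m # ms))"
        by (rule retract_expand[OF is_omoduleD(2)[OF B X] gX hom_compose[OF L[OF X] nat_transD(1)[OF q X]] _ ms])
          (use Lg[OF X] \<eta>[OF X] in simp)
      then show "(q X \<circ> t X) (MI_tensor r X (m # ms)) = g X (MI_tensor r X (m # ms))"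
        using t(3)[OF X ms] by simp
    qed (use x in \<open>simp add: obj_MI\<close>)
    then show "q X (h X x) = g X x" using hX[OF X] by simp
  qed
qed

end

section \<open>Groups of natural transformations\<close>

lemma nat_transI:
  assumes "\<eta> \<in> extensional (orbits G F)"
    and "\<And>X. X \<in> orbits G F \<Longrightarrow> \<eta> X \<in> extensional (carrier (obj M X))"
    and "\<And>X. X \<in> orbits G F \<Longrightarrow> \<eta> X \<in> hom (obj M X) (obj N X)"
    and "\<And>X Y f y. \<lbrakk>X \<in> orbits G F; Y \<in> orbits G F; f \<in> orbit_maps G X Y; y \<in> carrier (obj M Y)\<rbrakk>
      \<Longrightarrow> \<eta> X (arr M X Y f y) = arr N X Y f (\<eta> Y y)"
  shows "\<eta> \<in> nat_trans G F M N"
  using assms hom_in_carrier[OF assms(3)] unfolding nat_trans_def PiE_def Pi_def by auto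

lemma omap_comp_apply:
  "\<lbrakk>X \<in> orbits G F; x \<in> carrier (obj L X)\<rbrakk> \<Longrightarrow> omap_comp G F L \<eta> \<theta> X x = \<eta> X (\<theta> X x)"
  by (simp add: omap_comp_def compose_eq)

lemma omod_Hom_apply:
  "\<lbrakk>X \<in> orbits G F; x \<in> carrier (obj M X)\<rbrakk> \<Longrightarrow>
    (\<eta> \<otimes>\<^bsub>omod_Hom G F M N\<^esub> \<theta>) X x = \<eta> X x \<otimes>\<^bsub>obj N X\<^esub> \<theta> X x"
  "\<lbrakk>X \<in> orbits G F; x \<in> carrier (obj M X)\<rbrakk> \<Longrightarrow> \<one>\<^bsub>omod_Hom G F M N\<^esub> X x = \<one>\<^bsub>obj N X\<^esub>"
  "carrier (omod_Hom G F M N) = nat_trans G F M N"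
  by (simp_all add: omod_Hom_def)

text \<open>All operations are pointwise. The record \<open>omod_Hom\<close> gives product and unit
  only, so the pointwise formula for the inverse is derived from uniqueness of inverses.\<close>

lemma
  assumes M: "is_omodule G F M" and N: "is_omodule G F N"
  shows comm_group_omod_Hom: "comm_group (omod_Hom G F M N)"
    and omod_Hom_inv: "\<lbrakk>\<eta> \<in> nat_trans G F M N; X \<in> orbits G F; x \<in> carrier (obj M X)\<rbrakk> \<Longrightarrow>
      (inv\<^bsub>omod_Hom G F M N\<^esub> \<eta>) X x = inv\<^bsub>obj N X\<^esub> (\<eta> X x)"
proof -
  let ?H = "omod_Hom G F M N"
  have cN: "comm_group (obj N X)" if "X \<in> orbits G F" for X by (rule is_omoduleD(1)[OF N that])
  have gM: "group (obj M X)" if "X \<in> orbits G F" for X by (rule is_omoduleD(2)[OF M that])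
  have arrN: "group_hom (obj N Y) (obj N X) (arr N X Y f)"
    if "X \<in> orbits G F" "Y \<in> orbits G F" "f \<in> orbit_maps G X Y" for X Y f
    using is_omoduleD(2)[OF N] is_omoduleD(3)[OF N] that by (simp add: group_hom_def group_hom_axioms_def)
  have one: "\<one>\<^bsub>?H\<^esub> \<in> nat_trans G F M N"
  proof (rule nat_transI)
    fix X assume X: "X \<in> orbits G F"
    interpret C: comm_group "obj N X" by (rule cN[OF X])
    interpret D: group "obj M X" by (rule gM[OF X])
    show "\<one>\<^bsub>?H\<^esub> X \<in> hom (obj M X) (obj N X)"
      by (rule homI) (simp_all add: omod_Hom_apply X)
  next
    fix X Y f y assume h: "X \<in> orbits G F" "Y \<in> orbits G F" "f \<in> orbit_maps G X Y" "y \<in> carrier (obj M Y)"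
    interpret A: group_hom "obj N Y" "obj N X" "arr N X Y f" by (rule arrN[OF h(1-3)])
    show "\<one>\<^bsub>?H\<^esub> X (arr M X Y f y) = arr N X Y f (\<one>\<^bsub>?H\<^esub> Y y)"
      using h is_omoduleD(4)[OF M h(1-4)] by (simp add: omod_Hom_apply)
  qed (simp_all add: omod_Hom_def)
  have mult: "\<eta> \<otimes>\<^bsub>?H\<^esub> \<theta> \<in> nat_trans G F M N" if \<eta>: "\<eta> \<in> nat_trans G F M N" and \<theta>: "\<theta> \<in> nat_trans G F M N" for \<eta> \<theta>
  proof (rule nat_transI)
    fix X assume X: "X \<in> orbits G F"
    interpret C: comm_group "obj N X" by (rule cN[OF X])
    interpret D: group "obj M X" by (rule gM[OF X])
    note n = nat_transD(3)[OF \<eta> X] nat_transD(3)[OF \<theta> X]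
    show "(\<eta> \<otimes>\<^bsub>?H\<^esub> \<theta>) X \<in> hom (obj M X) (obj N X)"
      by (rule homI)
        (simp_all add: omod_Hom_apply X n hom_mult[OF nat_transD(1)[OF \<eta> X]] hom_mult[OF nat_transD(1)[OF \<theta> X]] C.m_ac)
  next
    fix X Y f y assume h: "X \<in> orbits G F" "Y \<in> orbits G F" "f \<in> orbit_maps G X Y" "y \<in> carrier (obj M Y)"
    interpret A: group_hom "obj N Y" "obj N X" "arr N X Y f" by (rule arrN[OF h(1-3)])
    show "(\<eta> \<otimes>\<^bsub>?H\<^esub> \<theta>) X (arr M X Y f y) = arr N X Y f ((\<eta> \<otimes>\<^bsub>?H\<^esub> \<theta>) Y y)"
      using h is_omoduleD(4)[OF M h(1-4)] nat_transD(3)[OF \<eta> h(2,4)] nat_transD(3)[OF \<theta> h(2,4)]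
        nat_transD(4)[OF \<eta> h] nat_transD(4)[OF \<theta> h] by (simp add: omod_Hom_apply)
  qed (simp_all add: omod_Hom_def)
  have inv: "\<exists>\<theta>\<in>nat_trans G F M N. \<theta> \<otimes>\<^bsub>?H\<^esub> \<eta> = \<one>\<^bsub>?H\<^esub>" if \<eta>: "\<eta> \<in> nat_trans G F M N" for \<eta>
  proof -
    define \<theta> where "\<theta> = (\<lambda>X\<in>orbits G F. \<lambda>x\<in>carrier (obj M X). inv\<^bsub>obj N X\<^esub> (\<eta> X x))"
    have \<theta>: "\<theta> \<in> nat_trans G F M N"
    proof (rule nat_transI)
      fix X assume X: "X \<in> orbits G F"
      interpret C: comm_group "obj N X" by (rule cN[OF X])
      interpret D: group "obj M X" by (rule gM[OF X])
      show "\<theta> X \<in> hom (obj M X) (obj N X)"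
        by (rule homI) (simp_all add: \<theta>_def X nat_transD(3)[OF \<eta> X] hom_mult[OF nat_transD(1)[OF \<eta> X]] C.inv_mult)
    next
      fix X Y f y assume h: "X \<in> orbits G F" "Y \<in> orbits G F" "f \<in> orbit_maps G X Y" "y \<in> carrier (obj M Y)"
      interpret A: group_hom "obj N Y" "obj N X" "arr N X Y f" by (rule arrN[OF h(1-3)])
      show "\<theta> X (arr M X Y f y) = arr N X Y f (\<theta> Y y)"
        using h is_omoduleD(4)[OF M h(1-4)] nat_transD(3)[OF \<eta> h(2,4)] nat_transD(4)[OF \<eta> h] by (simp add: \<theta>_def)
    qed (simp_all add: \<theta>_def)
    moreover have "\<theta> \<otimes>\<^bsub>?H\<^esub> \<eta> = \<one>\<^bsub>?H\<^esub>"
    proof (rule nat_trans_eqI[OF mult[OF \<theta> \<eta>] one])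
      fix X x assume X: "X \<in> orbits G F" and x: "x \<in> carrier (obj M X)"
      interpret C: comm_group "obj N X" by (rule cN[OF X])
      show "(\<theta> \<otimes>\<^bsub>?H\<^esub> \<eta>) X x = \<one>\<^bsub>?H\<^esub> X x"
        using X x nat_transD(3)[OF \<eta> X x] by (simp add: omod_Hom_apply) (simp add: \<theta>_def)
    qed
    ultimately show ?thesis by blast
  qed
  show H: "comm_group ?H"
  proof (rule comm_groupI)
    fix \<eta> \<theta> assume "\<eta> \<in> carrier ?H" "\<theta> \<in> carrier ?H"
    then have \<eta>: "\<eta> \<in> nat_trans G F M N" and \<theta>: "\<theta> \<in> nat_trans G F M N" by (simp_all add: omod_Hom_apply)
    then show "\<eta> \<otimes>\<^bsub>?H\<^esub> \<theta> \<in> carrier ?H" using mult by (simp add: omod_Hom_apply)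
    show "\<eta> \<otimes>\<^bsub>?H\<^esub> \<theta> = \<theta> \<otimes>\<^bsub>?H\<^esub> \<eta>"
    proof (rule nat_trans_eqI[OF mult[OF \<eta> \<theta>] mult[OF \<theta> \<eta>]])
      fix X x assume X: "X \<in> orbits G F" and x: "x \<in> carrier (obj M X)"
      interpret C: comm_group "obj N X" by (rule cN[OF X])
      show "(\<eta> \<otimes>\<^bsub>?H\<^esub> \<theta>) X x = (\<theta> \<otimes>\<^bsub>?H\<^esub> \<eta>) X x"
        using X x nat_transD(3)[OF \<eta> X x] nat_transD(3)[OF \<theta> X x] by (simp add: omod_Hom_apply C.m_comm)
    qed
    fix \<zeta> assume "\<zeta> \<in> carrier ?H"
    then have \<zeta>: "\<zeta> \<in> nat_trans G F M N" by (simp add: omod_Hom_apply)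
    show "\<eta> \<otimes>\<^bsub>?H\<^esub> \<theta> \<otimes>\<^bsub>?H\<^esub> \<zeta> = \<eta> \<otimes>\<^bsub>?H\<^esub> (\<theta> \<otimes>\<^bsub>?H\<^esub> \<zeta>)"
    proof (rule nat_trans_eqI[OF mult[OF mult[OF \<eta> \<theta>] \<zeta>] mult[OF \<eta> mult[OF \<theta> \<zeta>]]])
      fix X x assume X: "X \<in> orbits G F" and x: "x \<in> carrier (obj M X)"
      interpret C: comm_group "obj N X" by (rule cN[OF X])
      show "(\<eta> \<otimes>\<^bsub>?H\<^esub> \<theta> \<otimes>\<^bsub>?H\<^esub> \<zeta>) X x = (\<eta> \<otimes>\<^bsub>?H\<^esub> (\<theta> \<otimes>\<^bsub>?H\<^esub> \<zeta>)) X x"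
        using X x nat_transD(3)[OF \<eta> X x] nat_transD(3)[OF \<theta> X x] nat_transD(3)[OF \<zeta> X x]
        by (simp add: omod_Hom_apply C.m_assoc)
    qed
  next
    fix \<eta> assume "\<eta> \<in> carrier ?H"
    then have \<eta>: "\<eta> \<in> nat_trans G F M N" by (simp add: omod_Hom_apply)
    show "\<one>\<^bsub>?H\<^esub> \<otimes>\<^bsub>?H\<^esub> \<eta> = \<eta>"
    proof (rule nat_trans_eqI[OF mult[OF one \<eta>] \<eta>])
      fix X x assume X: "X \<in> orbits G F" and x: "x \<in> carrier (obj M X)"
      interpret C: comm_group "obj N X" by (rule cN[OF X])
      show "(\<one>\<^bsub>?H\<^esub> \<otimes>\<^bsub>?H\<^esub> \<eta>) X x = \<eta> X x"
        using X x nat_transD(3)[OF \<eta> X x] by (simp add: omod_Hom_apply)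
    qed
    show "\<exists>\<theta>\<in>carrier ?H. \<theta> \<otimes>\<^bsub>?H\<^esub> \<eta> = \<one>\<^bsub>?H\<^esub>" using inv[OF \<eta>] by (simp add: omod_Hom_apply)
  qed (simp add: one omod_Hom_apply)
  interpret H: comm_group ?H by (rule H)
  show "(inv\<^bsub>?H\<^esub> \<eta>) X x = inv\<^bsub>obj N X\<^esub> (\<eta> X x)"
    if \<eta>: "\<eta> \<in> nat_trans G F M N" and X: "X \<in> orbits G F" and x: "x \<in> carrier (obj M X)" for \<eta> X x
  proof -
    interpret C: comm_group "obj N X" by (rule cN[OF X])
    have c: "inv\<^bsub>?H\<^esub> \<eta> \<in> nat_trans G F M N" using H.inv_closed[of \<eta>] \<eta> by (simp add: omod_Hom_apply)
    have "(inv\<^bsub>?H\<^esub> \<eta> \<otimes>\<^bsub>?H\<^esub> \<eta>) X x = \<one>\<^bsub>?H\<^esub> X x" using H.l_inv[of \<eta>] \<eta> by (simp add: omod_Hom_apply)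
    then show ?thesis
      using X x nat_transD(3)[OF \<eta> X x] nat_transD(3)[OF c X x] by (simp add: omod_Hom_apply C.inv_equality)
  qed
qed

text \<open>The maps to be lifted along, such as \<open>d r\<close> and \<open>incl \<pi> r\<close>,
  are in general onto only their images. Shrinking the target to the image of \<open>q\<close> gives
  a module onto which \<open>q\<close> is an epimorphism.\<close>

lemma projective_lifts:
  fixes E :: "('g, 'e) omodule" and B :: "('g, 'b) omodule" and P :: "('g, 'p) omodule"
  assumes G: "group G" and sub: "\<And>H. H \<in> F \<Longrightarrow> H \<subseteq> carrier G" and P: "projective G F P"
    and E: "is_omodule G F E" and B: "is_omodule G F B"
    and q: "q \<in> nat_trans G F E B" and g: "g \<in> nat_trans G F P B"
    and im: "\<And>X x. \<lbrakk>X \<in> orbits G F; x \<in> carrier (obj P X)\<rbrakk> \<Longrightarrow> g X x \<in> q X ` carrier (obj E X)"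
  obtains h where "h \<in> nat_trans G F P E"
    "\<And>X x. \<lbrakk>X \<in> orbits G F; x \<in> carrier (obj P X)\<rbrakk> \<Longrightarrow> q X (h X x) = g X x"
proof -
  define B' where "B' = \<lparr>obj = (\<lambda>X. (obj B X)\<lparr>carrier := q X ` carrier (obj E X)\<rparr>), arr = arr B\<rparr>"
  have c: "carrier (obj B' X) = q X ` carrier (obj E X)" "monoid.mult (obj B' X) = monoid.mult (obj B X)" for X
    by (simp_all add: B'_def)
  have ar: "arr B' = arr B" by (simp add: B'_def)
  have incl: "x \<in> carrier (obj B X)" if "x \<in> carrier (obj B' X)" "X \<in> orbits G F" for x X
    using that nat_transD(3)[OF q] by (auto simp: c)
  have img: "arr B X Y f y \<in> carrier (obj B' X)"
    if h: "X \<in> orbits G F" "Y \<in> orbits G F" "f \<in> orbit_maps G X Y" and y: "y \<in> carrier (obj B' Y)" for X Y f y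
  proof -
    obtain z where z: "z \<in> carrier (obj E Y)" "y = q Y z" using y by (auto simp: c)
    show ?thesis using nat_transD(4)[OF q h z(1)] is_omoduleD(4)[OF E h z(1)] z(2) by (metis c(1) imageI)
  qed
  have B': "is_omodule G F B'"
    unfolding is_omodule_def
  proof (intro conjI ballI)
    fix X assume X: "X \<in> orbits G F"
    interpret C: comm_group "obj B X" by (rule is_omoduleD(1)[OF B X])
    interpret q: group_hom "obj E X" "obj B X" "q X"
      using is_omoduleD(2)[OF E X] nat_transD(1)[OF q X] by (simp add: group_hom_def group_hom_axioms_def C.is_group)
    have "group (obj B' X)"
      using subgroup.subgroup_is_group[OF q.img_is_subgroup C.is_group] by (simp add: B'_def)
    then show "comm_group (obj B' X)"
      by (rule group.group_comm_groupI) (use incl[OF _ X] in \<open>simp add: c(2) C.m_comm\<close>)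
  next
    fix X Y f assume h: "X \<in> orbits G F" "Y \<in> orbits G F" "f \<in> orbit_maps G X Y"
    show "arr B' X Y f \<in> hom (obj B' Y) (obj B' X)"
      by (rule homI) (use img[OF h] incl[OF _ h(2)] hom_mult[OF is_omoduleD(3)[OF B h]] in \<open>simp_all add: c(2) ar\<close>)
  next
    fix X x assume "X \<in> orbits G F" "x \<in> carrier (obj B' X)"
    then show "arr B' X X (\<lambda>C\<in>X. C) x = x" using is_omoduleD(5)[OF B] incl unfolding ar by blast
  next
    fix X Y Z f g z
    assume h: "X \<in> orbits G F" "Y \<in> orbits G F" "Z \<in> orbits G F" "f \<in> orbit_maps G X Y" "g \<in> orbit_maps G Y Z"
      "z \<in> carrier (obj B' Z)"
    show "arr B' X Z (compose X g f) z = arr B' X Y f (arr B' Y Z g z)"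
      using is_omoduleD(6)[OF B h(1-5) incl[OF h(6,3)]] unfolding ar .
  qed
  have to_B': "\<eta> \<in> nat_trans G F L B'"
    if \<eta>: "\<eta> \<in> nat_trans G F L B" and im: "\<And>X x. \<lbrakk>X \<in> orbits G F; x \<in> carrier (obj L X)\<rbrakk> \<Longrightarrow> \<eta> X x \<in> q X ` carrier (obj E X)"
    for \<eta> and L :: "('g, 'l) omodule"
  proof (rule nat_transI)
    show "\<eta> \<in> extensional (orbits G F)" using \<eta> by (auto simp: nat_trans_def PiE_def)
    fix X assume X: "X \<in> orbits G F"
    show "\<eta> X \<in> extensional (carrier (obj L X))" by (rule nat_transD(2)[OF \<eta> X])
    show "\<eta> X \<in> hom (obj L X) (obj B' X)"
      by (rule homI) (use im[OF X] hom_mult[OF nat_transD(1)[OF \<eta> X]] in \<open>simp_all add: c\<close>)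
  qed (use nat_transD(4)[OF \<eta>] in \<open>simp add: ar\<close>)
  have "omap_epi G F E B' q" using to_B'[OF q] by (simp add: omap_epi_def c)
  moreover have "g \<in> nat_trans G F P B'" by (rule to_B'[OF g im])
  ultimately obtain h where h: "h \<in> nat_trans G F P E" "omap_comp G F P q h = g"
    using projective_lifts_against[OF G sub P E B'] unfolding lifts_against_def by blast
  show thesis
  proof (rule that[OF h(1)])
    fix X x assume "X \<in> orbits G F" "x \<in> carrier (obj P X)"
    then show "q X (h X x) = g X x" using omap_comp_apply[of X G F x P q h] h(2) by simp
  qed
qed

text \<open>\<open>\<phi>\<close> is \<open>\<psi>\<close>, followed by any preimage under
  \<open>q\<close>, followed by \<open>c\<close>. It will be used with \<open>q\<close> the
  differential and \<open>c\<close> a cocycle, so no separate module for the image of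
  \<open>q\<close> is formed.\<close>

lemma nat_trans_factor:
  assumes L: "is_omodule G F L" and K: "is_omodule G F K" and A: "is_omodule G F A" and M: "is_omodule G F M"
    and q: "q \<in> nat_trans G F A K" and c: "c \<in> nat_trans G F A M" and \<psi>: "\<psi> \<in> nat_trans G F L K"
    and ker: "\<And>X x. \<lbrakk>X \<in> orbits G F; x \<in> carrier (obj A X); q X x = \<one>\<^bsub>obj K X\<^esub>\<rbrakk> \<Longrightarrow> c X x = \<one>\<^bsub>obj M X\<^esub>"
    and im: "\<And>X t. \<lbrakk>X \<in> orbits G F; t \<in> carrier (obj L X)\<rbrakk> \<Longrightarrow> \<psi> X t \<in> q X ` carrier (obj A X)"
  obtains \<phi> where "\<phi> \<in> nat_trans G F L M"
    "\<And>X t x. \<lbrakk>X \<in> orbits G F; t \<in> carrier (obj L X); x \<in> carrier (obj A X); \<psi> X t = q X x\<rbrakk> \<Longrightarrow> \<phi> X t = c X x"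
proof -
  have wd: "c X x = c X y" if X: "X \<in> orbits G F" and x: "x \<in> carrier (obj A X)" and y: "y \<in> carrier (obj A X)"
    and eq: "q X x = q X y" for X x y
  proof -
    interpret C: comm_group "obj M X" by (rule is_omoduleD(1)[OF M X])
    interpret Q: group_hom "obj A X" "obj K X" "q X"
      using is_omoduleD(2)[OF A X] is_omoduleD(2)[OF K X] nat_transD(1)[OF q X] by (simp add: group_hom_def group_hom_axioms_def)
    interpret c: group_hom "obj A X" "obj M X" "c X"
      using is_omoduleD(2)[OF A X] nat_transD(1)[OF c X] by (simp add: group_hom_def group_hom_axioms_def C.is_group)
    have "q X (x \<otimes>\<^bsub>obj A X\<^esub> inv\<^bsub>obj A X\<^esub> y) = \<one>\<^bsub>obj K X\<^esub>" using x y eq by simp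
    then have "c X (x \<otimes>\<^bsub>obj A X\<^esub> inv\<^bsub>obj A X\<^esub> y) = \<one>\<^bsub>obj M X\<^esub>" using ker[OF X] x y by simp
    then have "c X x \<otimes>\<^bsub>obj M X\<^esub> inv\<^bsub>obj M X\<^esub> c X y = \<one>\<^bsub>obj M X\<^esub>" using x y by simp
    then show ?thesis using x y by (metis C.inv_closed C.inv_equality C.inv_inv c.hom_closed)
  qed
  \<comment> \<open>The preimages are chosen pointwise and are neither additive nor natural in
    general; \<open>wd\<close> makes the value of \<open>c\<close> independent of the
    choice.\<close>
  define p where "p X t = (SOME x. x \<in> carrier (obj A X) \<and> \<psi> X t = q X x)" for X t
  have p: "p X t \<in> carrier (obj A X)" "\<psi> X t = q X (p X t)" if "X \<in> orbits G F" "t \<in> carrier (obj L X)" for X t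
    using someI_ex[of "\<lambda>x. x \<in> carrier (obj A X) \<and> \<psi> X t = q X x"] im[OF that] unfolding p_def by blast+
  define \<phi> where "\<phi> = (\<lambda>X\<in>orbits G F. \<lambda>t\<in>carrier (obj L X). c X (p X t))"
  have val: "\<phi> X t = c X x"
    if X: "X \<in> orbits G F" and t: "t \<in> carrier (obj L X)" and x: "x \<in> carrier (obj A X)" and eq: "\<psi> X t = q X x" for X t x
    using wd[OF X p(1)[OF X t] x] p(2)[OF X t] eq X t by (simp add: \<phi>_def)
  have "\<phi> \<in> nat_trans G F L M"
  proof (rule nat_transI)
    fix X assume X: "X \<in> orbits G F"
    interpret A: group "obj A X" by (rule is_omoduleD(2)[OF A X])
    interpret L: group "obj L X" by (rule is_omoduleD(2)[OF L X])
    show "\<phi> X \<in> hom (obj L X) (obj M X)"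
    proof (rule homI)
      fix s t assume s: "s \<in> carrier (obj L X)" and t: "t \<in> carrier (obj L X)"
      have "\<psi> X (s \<otimes>\<^bsub>obj L X\<^esub> t) = q X (p X s \<otimes>\<^bsub>obj A X\<^esub> p X t)"
        using hom_mult[OF nat_transD(1)[OF \<psi> X] s t] hom_mult[OF nat_transD(1)[OF q X]] p[OF X s] p[OF X t] by simp
      then have "\<phi> X (s \<otimes>\<^bsub>obj L X\<^esub> t) = c X (p X s \<otimes>\<^bsub>obj A X\<^esub> p X t)"
        using val[OF X] p[OF X s] p[OF X t] s t by simp
      then show "\<phi> X (s \<otimes>\<^bsub>obj L X\<^esub> t) = \<phi> X s \<otimes>\<^bsub>obj M X\<^esub> \<phi> X t"
        using hom_mult[OF nat_transD(1)[OF c X]] p[OF X s] p[OF X t] val[OF X s] val[OF X t] by simp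
    qed (use val[OF X _ p(1)[OF X] p(2)[OF X]] nat_transD(3)[OF c X] p(1)[OF X] in simp)
  next
    fix X Y f t assume h: "X \<in> orbits G F" "Y \<in> orbits G F" "f \<in> orbit_maps G X Y" and t: "t \<in> carrier (obj L Y)"
    note pt = p[OF h(2) t]
    have "\<psi> X (arr L X Y f t) = q X (arr A X Y f (p Y t))"
      using nat_transD(4)[OF \<psi> h t] nat_transD(4)[OF q h pt(1)] pt(2) by simp
    then have "\<phi> X (arr L X Y f t) = c X (arr A X Y f (p Y t))"
      by (rule val[OF h(1) is_omoduleD(4)[OF L h t] is_omoduleD(4)[OF A h pt(1)]])
    then show "\<phi> X (arr L X Y f t) = arr M X Y f (\<phi> Y t)"
      using nat_transD(4)[OF c h pt(1)] val[OF h(2) t pt] by simp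
  qed (simp_all add: \<phi>_def)
  then show thesis using val by (rule that)
qed

text \<open>In positive degree the coboundaries are the image of a homomorphism; being a subgroup
  they can be absorbed into a coset.\<close>

lemma coboundaries_subgroup:
  assumes P: "\<And>r. is_omodule G F (P r)" and d: "\<And>r. d r \<in> nat_trans G F (P (Suc r)) (P r)" and M: "is_omodule G F M"
  shows "subgroup (coboundaries G F P d M (Suc k)) (omod_Hom G F (P (Suc k)) M)"
proof -
  let ?A = "omod_Hom G F (P k) M" and ?B = "omod_Hom G F (P (Suc k)) M"
  interpret A: comm_group ?A by (rule comm_group_omod_Hom[OF P M])
  interpret B: comm_group ?B by (rule comm_group_omod_Hom[OF P M])
  have cl: "cobdry G F P d k \<eta> \<in> nat_trans G F (P (Suc k)) M" if "\<eta> \<in> nat_trans G F (P k) M" for \<eta>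
    unfolding cobdry_def by (rule nat_trans_omap_comp[OF d that P])
  have "cobdry G F P d k \<in> hom ?A ?B"
  proof (rule homI)
    fix \<eta> \<theta> assume "\<eta> \<in> carrier ?A" "\<theta> \<in> carrier ?A"
    then have h: "\<eta> \<in> nat_trans G F (P k) M" "\<theta> \<in> nat_trans G F (P k) M" "\<eta> \<otimes>\<^bsub>?A\<^esub> \<theta> \<in> nat_trans G F (P k) M"
      using A.m_closed[of \<eta> \<theta>] by (simp_all add: omod_Hom_apply)
    show "cobdry G F P d k (\<eta> \<otimes>\<^bsub>?A\<^esub> \<theta>) = cobdry G F P d k \<eta> \<otimes>\<^bsub>?B\<^esub> cobdry G F P d k \<theta>"
    proof (rule nat_trans_eqI[OF cl[OF h(3)]])
      show "cobdry G F P d k \<eta> \<otimes>\<^bsub>?B\<^esub> cobdry G F P d k \<theta> \<in> nat_trans G F (P (Suc k)) M"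
        using B.m_closed cl[OF h(1)] cl[OF h(2)] by (simp add: omod_Hom_apply)
    qed (simp add: cobdry_def omap_comp_apply omod_Hom_apply nat_transD(3)[OF d])
  qed (simp add: omod_Hom_apply cl)
  then interpret h: group_hom ?A ?B "cobdry G F P d k"
    by (simp add: group_hom_def group_hom_axioms_def A.is_group B.is_group)
  show ?thesis using h.img_is_subgroup by (simp add: coboundaries_def)
qed

section \<open>Lifting and comparing resolutions\<close>

context discrete_group
begin

lemma is_omodule_const_Z: "is_omodule GG \<D> const_Z"
  by (simp add: is_omodule_def const_Z_def hom_def abelian_integer_group)

text \<open>The empty product has a single generating tuple and no relations, so a class is
  determined by one integer coefficient.\<close>

lemma
  shows I_pow_0_to_Z_nat_trans: "I_pow_0_to_Z \<pi> \<in> nat_trans GG \<D> (I_pow \<pi> 0) const_Z"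
    and I_pow_0_to_Z_surj: "X \<in> Orb \<Longrightarrow> z \<in> I_pow_0_to_Z \<pi> X ` carrier (obj (I_pow \<pi> 0) X)"
    and I_pow_0_to_Z_inj: "\<lbrakk>X \<in> Orb; T \<in> carrier (obj (I_pow \<pi> 0) X); I_pow_0_to_Z \<pi> X T = 0\<rbrakk> \<Longrightarrow>
      T = \<one>\<^bsub>obj (I_pow \<pi> 0) X\<^esub>"
proof -
  let ?F = "free_Abelian_group {[]} :: ('a mpi_elem list \<Rightarrow>\<^sub>0 int) monoid"
  let ?t = "\<lambda>T\<in>carrier (tensor ([] :: 'a mpi_elem monoid list)). the_elem (coeff_sum ` T)"
  have g: "\<forall>A\<in>set ([] :: 'a mpi_elem monoid list). group A" by simp
  note lift = tensor_lift[OF g abelian_integer_group, simplified, OF coeff_sum_hom]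
  have hom: "?t \<in> hom (tensor []) integer_group" by (rule lift(2))
  have cl: "tensor_class [] c \<in> carrier (tensor [])" if "Poly_Mapping.keys c \<subseteq> {[]}" for c :: "'a mpi_elem list \<Rightarrow>\<^sub>0 int"
    using hom_in_carrier[OF tensor_class_hom[OF g]] that by simp
  have val: "?t (tensor_class [] c) = coeff_sum c" if "Poly_Mapping.keys c \<subseteq> {[]}" for c
    using lift(1)[OF that] cl[OF that] by simp
  have eq: "I_pow_0_to_Z \<pi> X = ?t" if "X \<in> Orb" for X
    using that by (simp add: I_pow_0_to_Z_def obj_I_pow)
  show "I_pow_0_to_Z \<pi> \<in> nat_trans GG \<D> (I_pow \<pi> 0) const_Z"
    unfolding I_pow_def
  proof (rule tensor_nat_transI[OF Is_omodules(1) is_omodule_const_Z])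
    show "I_pow_0_to_Z \<pi> \<in> extensional Orb" by (simp add: I_pow_0_to_Z_def)
  qed (use eq hom in \<open>simp_all add: const_Z_def\<close>)
  fix X assume X: "X \<in> Orb"
  show "z \<in> I_pow_0_to_Z \<pi> X ` carrier (obj (I_pow \<pi> 0) X)" for z
  proof -
    have k: "Poly_Mapping.keys (frag_cmul z (frag_of [])) \<subseteq> {[] :: 'a mpi_elem list}"
      using keys_cmul[of z "frag_of []"] by simp
    have "I_pow_0_to_Z \<pi> X (tensor_class [] (frag_cmul z (frag_of []))) = z"
      using val[OF k] eq[OF X] by (simp add: coeff_sum_cmul)
    moreover have "tensor_class [] (frag_cmul z (frag_of [])) \<in> carrier (obj (I_pow \<pi> 0) X)"
      using cl[OF k] by (simp add: obj_I_pow)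
    ultimately show ?thesis by (metis imageI)
  qed
  show "T = \<one>\<^bsub>obj (I_pow \<pi> 0) X\<^esub>"
    if T: "T \<in> carrier (obj (I_pow \<pi> 0) X)" and z: "I_pow_0_to_Z \<pi> X T = 0" for T
  proof -
    obtain c where c: "T = tensor_class [] c" "Poly_Mapping.keys c \<subseteq> {[]}"
      using T carrier_tensor[OF g] by (auto simp: obj_I_pow)
    have "Poly_Mapping.lookup c [] = 0"
      using z val[OF c(2)] eq[OF X] coeff_sum_superset[OF _ c(2)] c(1) by simp
    then have "c = 0" using c(2) by (metis in_keys_iff keys_eq_empty subset_singletonD singletonI)
    then show ?thesis
      using hom_one[OF tensor_class_hom[OF g]] comm_group_tensor[OF g] c(1) by (simp add: obj_I_pow comm_group_def)
  qed
qed

text \<open>Exactness over X read off from the splitting: \<open>\<sigma>\<close> is a right inverse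
  of the augmentation, \<open>\<rho>\<close> a left inverse of the inclusion, and together they
  decompose the middle term.\<close>

lemma
  assumes X: "X \<in> Orb"
  shows aug_surj: "s \<in> carrier (obj (I_pow \<pi> r) X) \<Longrightarrow> s \<in> aug_tensor \<pi> r X ` carrier (obj (MI \<pi> r) X)"
    and aug_kernel: "\<lbrakk>t \<in> carrier (obj (MI \<pi> r) X); aug_tensor \<pi> r X t = \<one>\<^bsub>obj (I_pow \<pi> r) X\<^esub>\<rbrakk>
      \<Longrightarrow> t \<in> incl \<pi> r X ` carrier (obj (I_pow \<pi> (Suc r)) X)"
    and aug_incl: "s \<in> carrier (obj (I_pow \<pi> (Suc r)) X) \<Longrightarrow> aug_tensor \<pi> r X (incl \<pi> r X s) = \<one>\<^bsub>obj (I_pow \<pi> r) X\<^esub>"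
    and incl_inj: "\<lbrakk>s \<in> carrier (obj (I_pow \<pi> (Suc r)) X); incl \<pi> r X s = \<one>\<^bsub>obj (MI \<pi> r) X\<^esub>\<rbrakk>
      \<Longrightarrow> s = \<one>\<^bsub>obj (I_pow \<pi> (Suc r)) X\<^esub>"
proof -
  let ?I = "tensor (Ibs r X)" and ?J = "tensor (Ibs (Suc r) X)" and ?M = "tensor (MIbs r X)"
  interpret I: comm_group ?I by (rule comm_group_I_pow)
  interpret J: comm_group ?J by (rule comm_group_I_pow)
  interpret M: comm_group ?M by (rule comm_group_MI)
  have inc: "incl \<pi> r X \<in> hom ?J ?M"
    using nat_transD(1)[OF incl_nat_trans X] by (simp add: obj_MI obj_I_pow)
  obtain \<sigma> \<rho> where s:
    "\<sigma> \<in> hom ?I ?M" "\<rho> \<in> hom ?M ?J"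
    "\<And>s. s \<in> carrier ?I \<Longrightarrow> aug_tensor \<pi> r X (\<sigma> s) = s"
    "\<And>s. s \<in> carrier ?J \<Longrightarrow> \<rho> (incl \<pi> r X s) = s"
    "\<And>s. s \<in> carrier ?J \<Longrightarrow> aug_tensor \<pi> r X (incl \<pi> r X s) = \<one>\<^bsub>?I\<^esub>"
    "\<And>s. s \<in> carrier ?M \<Longrightarrow> incl \<pi> r X (\<rho> s) \<otimes>\<^bsub>?M\<^esub> \<sigma> (aug_tensor \<pi> r X s) = s"
    by (rule split_exact[OF X, of r]) blast
  show "s \<in> carrier (obj (I_pow \<pi> r) X) \<Longrightarrow> s \<in> aug_tensor \<pi> r X ` carrier (obj (MI \<pi> r) X)"
    using s(3)[of s] hom_in_carrier[OF s(1), of s] unfolding obj_I_pow obj_MI by (metis imageI)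
  show "aug_tensor \<pi> r X (incl \<pi> r X s) = \<one>\<^bsub>obj (I_pow \<pi> r) X\<^esub>" if "s \<in> carrier (obj (I_pow \<pi> (Suc r)) X)"
    using s(5)[of s] that unfolding obj_I_pow by blast
  show "t \<in> incl \<pi> r X ` carrier (obj (I_pow \<pi> (Suc r)) X)"
    if "t \<in> carrier (obj (MI \<pi> r) X)" "aug_tensor \<pi> r X t = \<one>\<^bsub>obj (I_pow \<pi> r) X\<^esub>"
  proof -
    have t: "t \<in> carrier ?M" "aug_tensor \<pi> r X t = \<one>\<^bsub>?I\<^esub>" using that by (simp_all add: obj_MI obj_I_pow)
    have "incl \<pi> r X (\<rho> t) = t"
      using s(6)[OF t(1)] t(2) hom_one[OF s(1) I.is_group M.is_group] hom_in_carrier[OF inc hom_in_carrier[OF s(2) t(1)]]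
      by simp
    then show ?thesis using hom_in_carrier[OF s(2) t(1)] unfolding obj_I_pow by (metis imageI)
  qed
  show "s = \<one>\<^bsub>obj (I_pow \<pi> (Suc r)) X\<^esub>"
    if "s \<in> carrier (obj (I_pow \<pi> (Suc r)) X)" "incl \<pi> r X s = \<one>\<^bsub>obj (MI \<pi> r) X\<^esub>"
    using s(4)[of s] that hom_one[OF s(2) M.is_group J.is_group] unfolding obj_I_pow obj_MI by simp
qed

end

section \<open>Comparison of the spliced sequence with a given projective resolution\<close>

locale resolved_group = discrete_group \<pi> for \<pi> :: "('a, 'm) monoid_scheme" +
  fixes P :: "nat \<Rightarrow> ('a \<times> 'a, 'p) omodule" and d :: "nat \<Rightarrow> ('a \<times> 'a, 'p, 'p) omap"
    and e :: "('a \<times> 'a, 'p, int) omap"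
  assumes res: "projective_resolution GG \<D> P d e"
begin

abbreviation "Pb r X \<equiv> obj (P r) X"

lemma P_projective: "projective GG \<D> (P r)"
  and P_omod: "is_omodule GG \<D> (P r)"
  and d_nat: "d r \<in> nat_trans GG \<D> (P (Suc r)) (P r)"
  and e_nat: "e \<in> nat_trans GG \<D> (P 0) const_Z"
  using res by (auto simp: projective_resolution_def projective_def omap_epi_def)

lemma e_surj: "X \<in> Orb \<Longrightarrow> z \<in> e X ` carrier (Pb 0 X)"
  using res by (simp add: projective_resolution_def omap_epi_def const_Z_def)

text \<open>Degree zero is phrased with the unit of \<open>const_Z\<close> instead of 0, so that
  both statements match the exactness hypothesis of \<open>comparison_step\<close>.\<close>

lemma d_exact_0: "X \<in> Orb \<Longrightarrow> d 0 X ` carrier (Pb (Suc 0) X) = {x \<in> carrier (Pb 0 X). e X x = \<one>\<^bsub>obj const_Z X\<^esub>}"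
  and d_exact: "X \<in> Orb \<Longrightarrow> d (Suc r) X ` carrier (Pb (Suc (Suc r)) X) =
    {x \<in> carrier (Pb (Suc r) X). d r X x = \<one>\<^bsub>Pb r X\<^esub>}"
  using res by (simp_all add: projective_resolution_def kernel_def)

lemma P_lifts:
  fixes E :: "('a \<times> 'a, 'e) omodule" and B :: "('a \<times> 'a, 'b) omodule"
  assumes "is_omodule GG \<D> E" "is_omodule GG \<D> B" "q \<in> nat_trans GG \<D> E B" "g \<in> nat_trans GG \<D> (P r) B"
    and "\<And>X x. \<lbrakk>X \<in> Orb; x \<in> carrier (Pb r X)\<rbrakk> \<Longrightarrow> g X x \<in> q X ` carrier (obj E X)"
  obtains h where "h \<in> nat_trans GG \<D> (P r) E" "\<And>X x. \<lbrakk>X \<in> Orb; x \<in> carrier (Pb r X)\<rbrakk> \<Longrightarrow> q X (h X x) = g X x"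
  by (rule projective_lifts[OF group_GG D_subset P_projective assms]; (assumption | rule that; blast))

lemma P_group: "X \<in> Orb \<Longrightarrow> comm_group (Pb r X)"
  by (rule is_omoduleD(1)[OF P_omod])

lemma nat_trans_one:
  assumes "is_omodule GG \<D> M" "is_omodule GG \<D> N" "\<eta> \<in> nat_trans GG \<D> M N" "X \<in> Orb"
  shows "\<eta> X \<one>\<^bsub>obj M X\<^esub> = \<one>\<^bsub>obj N X\<^esub>"
  by (rule hom_one[OF nat_transD(1)[OF assms(3,4)] is_omoduleD(2)[OF assms(1,4)] is_omoduleD(2)[OF assms(2,4)]])

lemma d_d: "\<lbrakk>X \<in> Orb; y \<in> carrier (Pb (Suc (Suc r)) X)\<rbrakk> \<Longrightarrow> d r X (d (Suc r) X y) = \<one>\<^bsub>Pb r X\<^esub>"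
  using d_exact by blast

text \<open>The pointwise cocycle condition, also imposed on the term of a chain homotopy that comes
  from the preceding degree.\<close>

definition is_cocycle :: "nat \<Rightarrow> ('a \<times> 'a, 'b) omodule \<Rightarrow> ('a \<times> 'a, 'p, 'b) omap \<Rightarrow> bool"
  where "is_cocycle r M u \<longleftrightarrow> u \<in> nat_trans GG \<D> (P r) M \<and>
    (\<forall>X\<in>Orb. \<forall>y\<in>carrier (Pb (Suc r) X). u X (d r X y) = \<one>\<^bsub>obj M X\<^esub>)"

text \<open>One degree of a chain lift, organized by the short exact sequences instead of the
  splices: \<open>f\<close> lifts \<open>u\<close> through the augmentation, and \<open>u'\<close>
  is the induced map into its kernel.\<close>

definition lift_square where
  "lift_square r u f u' \<longleftrightarrow> f \<in> nat_trans GG \<D> (P r) (MI \<pi> r) \<and>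
    (\<forall>X\<in>Orb. \<forall>x\<in>carrier (Pb r X). aug_tensor \<pi> r X (f X x) = u X x) \<and>
    (\<forall>X\<in>Orb. \<forall>y\<in>carrier (Pb (Suc r) X). incl \<pi> r X (u' X y) = f X (d r X y))"

text \<open>Projectivity of \<open>P r\<close> gives \<open>f\<close>. As \<open>u\<close> is a
  cocycle, \<open>f\<close> after \<open>d r\<close> is killed by the augmentation, so exactness and
  projectivity of \<open>P (Suc r)\<close> give \<open>u'\<close>. Injectivity of
  \<open>incl \<pi> r\<close> turns d d = 0 into the cocycle condition for
  \<open>u'\<close>.\<close>

lemma lift_square_exists:
  assumes "is_cocycle r (I_pow \<pi> r) u"
  shows "\<exists>u'. is_cocycle (Suc r) (I_pow \<pi> (Suc r)) u' \<and> (\<exists>f. lift_square r u f u')"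
proof -
  have u: "u \<in> nat_trans GG \<D> (P r) (I_pow \<pi> r)"
    and ud: "\<And>X y. \<lbrakk>X \<in> Orb; y \<in> carrier (Pb (Suc r) X)\<rbrakk> \<Longrightarrow> u X (d r X y) = \<one>\<^bsub>obj (I_pow \<pi> r) X\<^esub>"
    using assms by (auto simp: is_cocycle_def)
  obtain f where f: "f \<in> nat_trans GG \<D> (P r) (MI \<pi> r)"
    "\<And>X x. \<lbrakk>X \<in> Orb; x \<in> carrier (Pb r X)\<rbrakk> \<Longrightarrow> aug_tensor \<pi> r X (f X x) = u X x"
    by (rule P_lifts[OF is_omodule_MI is_omodule_I_pow aug_nat_trans u]) (use aug_surj nat_transD(3)[OF u] in blast)+
  let ?fd = "omap_comp GG \<D> (P (Suc r)) f (d r)"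
  have fd: "?fd \<in> nat_trans GG \<D> (P (Suc r)) (MI \<pi> r)" by (rule nat_trans_omap_comp[OF d_nat f(1) P_omod])
  have "?fd X y \<in> incl \<pi> r X ` carrier (obj (I_pow \<pi> (Suc r)) X)" if X: "X \<in> Orb" and y: "y \<in> carrier (Pb (Suc r) X)" for X y
    using f(2)[OF X nat_transD(3)[OF d_nat X y]] ud[OF X y]
    by (intro aug_kernel[OF X nat_transD(3)[OF fd X y]]) (simp add: omap_comp_apply[OF X y])
  from P_lifts[OF is_omodule_I_pow is_omodule_MI incl_nat_trans fd this]
  obtain u' where u': "u' \<in> nat_trans GG \<D> (P (Suc r)) (I_pow \<pi> (Suc r))"
    "\<And>X y. \<lbrakk>X \<in> Orb; y \<in> carrier (Pb (Suc r) X)\<rbrakk> \<Longrightarrow> incl \<pi> r X (u' X y) = ?fd X y"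
    by blast
  have "u' X (d (Suc r) X y) = \<one>\<^bsub>obj (I_pow \<pi> (Suc r)) X\<^esub>" if X: "X \<in> Orb" and y: "y \<in> carrier (Pb (Suc (Suc r)) X)" for X y
  proof (rule incl_inj[OF X])
    note dy = nat_transD(3)[OF d_nat X y]
    show "u' X (d (Suc r) X y) \<in> carrier (obj (I_pow \<pi> (Suc r)) X)" by (rule nat_transD(3)[OF u'(1) X dy])
    show "incl \<pi> r X (u' X (d (Suc r) X y)) = \<one>\<^bsub>obj (MI \<pi> r) X\<^esub>"
      using u'(2)[OF X dy] d_d[OF X y] nat_trans_one[OF P_omod is_omodule_MI f(1) X]
      by (simp add: omap_comp_apply[OF X dy])
  qed
  then show ?thesis
    using u' f omap_comp_apply unfolding is_cocycle_def lift_square_def by (metis (no_types, lifting))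
qed

text \<open>\<open>u_class\<close> picks its representative by \<open>SOME\<close>, so existence is
  what gives that representative any properties.\<close>

lemma chain_lift_exists: "\<exists>u f. chain_lift \<pi> P d e (Suc n) f u"
proof -
  obtain u0 where u0: "u0 \<in> nat_trans GG \<D> (P 0) (I_pow \<pi> 0)"
    "\<And>X x. \<lbrakk>X \<in> Orb; x \<in> carrier (Pb 0 X)\<rbrakk> \<Longrightarrow> I_pow_0_to_Z \<pi> X (u0 X x) = e X x"
    by (rule P_lifts[OF is_omodule_I_pow is_omodule_const_Z I_pow_0_to_Z_nat_trans e_nat]) (use I_pow_0_to_Z_surj in blast)+
  have u0d: "is_cocycle 0 (I_pow \<pi> 0) u0"
    unfolding is_cocycle_def
  proof (intro conjI ballI u0(1))
    fix X y assume X: "X \<in> Orb" and y: "y \<in> carrier (Pb (Suc 0) X)"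
    note dy = nat_transD(3)[OF d_nat X y]
    have "e X (d 0 X y) = 0" using d_exact_0[OF X] y by (auto simp: const_Z_def)
    then show "u0 X (d 0 X y) = \<one>\<^bsub>obj (I_pow \<pi> 0) X\<^esub>"
      using u0(2)[OF X dy] by (intro I_pow_0_to_Z_inj[OF X nat_transD(3)[OF u0(1) X dy]]) simp
  qed
  \<comment> \<open>The recursion runs over the maps into the powers of I. The clause for
    \<open>r = 0\<close> pins down the start, without which the lift need not cover the identity of
    Z.\<close>
  have "\<exists>u. \<forall>r. (is_cocycle r (I_pow \<pi> r) (u r) \<and> (r = 0 \<longrightarrow> u r = u0)) \<and> (\<exists>f. lift_square r (u r) f (u (Suc r)))"
    by (rule dependent_nat_choice) (use u0d lift_square_exists in auto)
  then obtain u where u: "\<And>r. is_cocycle r (I_pow \<pi> r) (u r)" "u 0 = u0"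
    and "\<forall>r. \<exists>f. lift_square r (u r) f (u (Suc r))" by blast
  from choice[OF this(3)] obtain f where f: "\<And>r. lift_square r (u r) (f r) (u (Suc r))" by blast
  have un: "u r \<in> nat_trans GG \<D> (P r) (I_pow \<pi> r)" for r using u(1)[of r] by (simp add: is_cocycle_def)
  have fn: "f r \<in> nat_trans GG \<D> (P r) (MI \<pi> r)"
    and aug_f: "\<lbrakk>X \<in> Orb; x \<in> carrier (Pb r X)\<rbrakk> \<Longrightarrow> aug_tensor \<pi> r X (f r X x) = u r X x"
    and incl_u: "\<lbrakk>X \<in> Orb; y \<in> carrier (Pb (Suc r) X)\<rbrakk> \<Longrightarrow> incl \<pi> r X (u (Suc r) X y) = f r X (d r X y)" for r X x y
    using f[of r] by (auto simp: lift_square_def)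
  have "splice_aug \<pi> \<in> nat_trans GG \<D> (MI \<pi> 0) const_Z"
    unfolding splice_aug_def by (rule nat_trans_omap_comp[OF aug_nat_trans I_pow_0_to_Z_nat_trans is_omodule_MI])
  then have 1: "omap_comp GG \<D> (P 0) (splice_aug \<pi>) (f 0) = e"
    using aug_f[of _ _ 0] u0(2) nat_transD(3)[OF fn] u(2)
    by (intro nat_trans_eqI[OF nat_trans_omap_comp[OF fn _ P_omod] e_nat])
      (simp_all add: omap_comp_apply splice_aug_def)
  have sp: "splice \<pi> r \<in> nat_trans GG \<D> (MI \<pi> (Suc r)) (MI \<pi> r)" for r
    unfolding splice_def by (rule nat_trans_omap_comp[OF aug_nat_trans incl_nat_trans is_omodule_MI])
  have 2: "omap_comp GG \<D> (P (Suc r)) (splice \<pi> r) (f (Suc r)) = omap_comp GG \<D> (P (Suc r)) (f r) (d r)" for r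
    using aug_f[of _ _ "Suc r"] incl_u[of _ _ r] nat_transD(3)[OF fn]
    by (intro nat_trans_eqI[OF nat_trans_omap_comp[OF fn sp P_omod] nat_trans_omap_comp[OF d_nat fn P_omod]])
      (simp add: omap_comp_apply splice_def)
  have 3: "omap_comp GG \<D> (P (Suc n)) (incl \<pi> n) (u (Suc n)) = omap_comp GG \<D> (P (Suc n)) (f n) (d n)"
    using incl_u[of _ _ n]
    by (intro nat_trans_eqI[OF nat_trans_omap_comp[OF un incl_nat_trans P_omod] nat_trans_omap_comp[OF d_nat fn P_omod]])
      (simp add: omap_comp_apply)
  interpret H: comm_group "omod_Hom GG \<D> (P (Suc (Suc n))) (I_pow \<pi> (Suc n))"
    by (rule comm_group_omod_Hom[OF P_omod is_omodule_I_pow])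
  have 4: "omap_comp GG \<D> (P (Suc (Suc n))) (u (Suc n)) (d (Suc n)) = \<one>\<^bsub>omod_Hom GG \<D> (P (Suc (Suc n))) (I_pow \<pi> (Suc n))\<^esub>"
    using u(1)[of "Suc n"] H.one_closed
    by (intro nat_trans_eqI[OF nat_trans_omap_comp[OF d_nat un P_omod]])
      (auto simp add: omap_comp_apply omod_Hom_apply is_cocycle_def)
  show ?thesis
    unfolding chain_lift_def Let_def
    by (rule exI[of _ "u (Suc n)"], rule exI[of _ f]) (use un fn 1 2 3 4 in simp)
qed

text \<open>One degree of the chain map back to \<open>P\<close> and of the homotopy together. Here
  \<open>q\<close> is the previous differential, or the augmentation in degree zero, which is why
  \<open>K\<close> has its own carrier type; \<open>w\<close> is the previous homotopy after the
  differential. Writing groups additively, \<open>fw\<close> says that \<psi> after the augmentation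
  and f equals q(id + w), and the conclusion has the same shape one degree higher.\<close>

lemma comparison_step:
  fixes K :: "('a \<times> 'a, 'k) omodule"
  assumes K: "is_omodule GG \<D> K" and q: "q \<in> nat_trans GG \<D> (P r) K"
    and ex: "\<And>X. X \<in> Orb \<Longrightarrow> d r X ` carrier (Pb (Suc r) X) = {x \<in> carrier (Pb r X). q X x = \<one>\<^bsub>obj K X\<^esub>}"
    and \<psi>: "\<psi> \<in> nat_trans GG \<D> (I_pow \<pi> r) K"
    and im: "\<And>X t. \<lbrakk>X \<in> Orb; t \<in> carrier (obj (I_pow \<pi> r) X)\<rbrakk> \<Longrightarrow> \<psi> X t \<in> q X ` carrier (Pb r X)"
    and f: "f \<in> nat_trans GG \<D> (P r) (MI \<pi> r)"
    and w: "is_cocycle r (P r) w"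
    and fw: "\<And>X x. \<lbrakk>X \<in> Orb; x \<in> carrier (Pb r X)\<rbrakk> \<Longrightarrow>
      \<psi> X (aug_tensor \<pi> r X (f X x)) = q X (x \<otimes>\<^bsub>Pb r X\<^esub> w X x)"
    and v: "v \<in> nat_trans GG \<D> (P (Suc r)) (I_pow \<pi> (Suc r))"
    and iv: "\<And>X y. \<lbrakk>X \<in> Orb; y \<in> carrier (Pb (Suc r) X)\<rbrakk> \<Longrightarrow> incl \<pi> r X (v X y) = f X (d r X y)"
  obtains \<psi>' s where "\<psi>' \<in> nat_trans GG \<D> (I_pow \<pi> (Suc r)) (P r)" "s \<in> nat_trans GG \<D> (P r) (P (Suc r))"
    "\<And>X t. \<lbrakk>X \<in> Orb; t \<in> carrier (obj (I_pow \<pi> (Suc r)) X)\<rbrakk> \<Longrightarrow> \<psi>' X t \<in> d r X ` carrier (Pb (Suc r) X)"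
    "\<And>X y. \<lbrakk>X \<in> Orb; y \<in> carrier (Pb (Suc r) X)\<rbrakk> \<Longrightarrow>
      \<psi>' X (v X y) = d r X (y \<otimes>\<^bsub>Pb (Suc r) X\<^esub> s X (d r X y))"
proof -
  note comp = nat_trans_omap_comp
  let ?pa = "omap_comp GG \<D> (MI \<pi> r) \<psi> (aug_tensor \<pi> r)"
  have pa: "?pa \<in> nat_trans GG \<D> (MI \<pi> r) K" by (rule comp[OF aug_nat_trans \<psi> is_omodule_MI])
  \<comment> \<open>\<open>g\<close> is the degree r component of the chain map back to
    \<open>P\<close>; its restriction along \<open>incl \<pi> r\<close> is the new map on the next
    power of I.\<close>
  obtain g where g: "g \<in> nat_trans GG \<D> (MI \<pi> r) (P r)"
    and qg: "\<And>X x. \<lbrakk>X \<in> Orb; x \<in> carrier (obj (MI \<pi> r) X)\<rbrakk> \<Longrightarrow> q X (g X x) = ?pa X x"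
    by (rule MI_lifts[OF P_omod K q pa]) (use im nat_transD(3)[OF aug_nat_trans] in \<open>auto simp: omap_comp_apply\<close>)
  let ?\<psi> = "omap_comp GG \<D> (I_pow \<pi> (Suc r)) g (incl \<pi> r)"
  have \<psi>': "?\<psi> \<in> nat_trans GG \<D> (I_pow \<pi> (Suc r)) (P r)" by (rule comp[OF incl_nat_trans g is_omodule_I_pow])
  have wn: "w \<in> nat_trans GG \<D> (P r) (P r)"
    and wd: "\<And>X y. \<lbrakk>X \<in> Orb; y \<in> carrier (Pb (Suc r) X)\<rbrakk> \<Longrightarrow> w X (d r X y) = \<one>\<^bsub>Pb r X\<^esub>"
    using w by (auto simp: is_cocycle_def)
  let ?H = "omod_Hom GG \<D> (P r) (P r)"
  interpret H: comm_group ?H by (rule comm_group_omod_Hom[OF P_omod P_omod])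
  define i where "i = (\<lambda>X\<in>Orb. \<lambda>x\<in>carrier (Pb r X). x)"
  have i: "i \<in> nat_trans GG \<D> (P r) (P r)"
  proof (rule nat_transI)
    fix X assume X: "X \<in> Orb"
    interpret C: comm_group "Pb r X" by (rule P_group[OF X])
    show "i X \<in> hom (Pb r X) (Pb r X)" using X by (simp add: i_def hom_def)
  qed (use is_omoduleD(4)[OF P_omod] in \<open>simp_all add: i_def\<close>)
  have gf: "omap_comp GG \<D> (P r) g f \<in> nat_trans GG \<D> (P r) (P r)" by (rule comp[OF f g P_omod])
  \<comment> \<open>Additively, \<theta> = g f - (id + w). It is killed by \<open>q\<close>, so by
    exactness it lifts along \<open>d r\<close>, and the lift is the new homotopy component
    \<open>s\<close>.\<close>
  define \<theta> where "\<theta> = omap_comp GG \<D> (P r) g f \<otimes>\<^bsub>?H\<^esub> inv\<^bsub>?H\<^esub> (i \<otimes>\<^bsub>?H\<^esub> w)"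
  have iw: "i \<otimes>\<^bsub>?H\<^esub> w \<in> nat_trans GG \<D> (P r) (P r)" using H.m_closed[of i w] i wn by (simp add: omod_Hom_apply)
  have \<theta>: "\<theta> \<in> nat_trans GG \<D> (P r) (P r)"
    using H.m_closed[OF _ H.inv_closed, of "omap_comp GG \<D> (P r) g f" "i \<otimes>\<^bsub>?H\<^esub> w"] iw gf
    unfolding \<theta>_def by (simp add: omod_Hom_apply)
  have \<theta>v: "\<theta> X x = g X (f X x) \<otimes>\<^bsub>Pb r X\<^esub> inv\<^bsub>Pb r X\<^esub> (x \<otimes>\<^bsub>Pb r X\<^esub> w X x)" if "X \<in> Orb" "x \<in> carrier (Pb r X)" for X x
    using that omod_Hom_inv[OF P_omod P_omod iw that] unfolding \<theta>_def
    by (simp add: omod_Hom_apply omap_comp_apply) (simp add: i_def)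
  have "\<theta> X x \<in> d r X ` carrier (Pb (Suc r) X)" if X: "X \<in> Orb" and x: "x \<in> carrier (Pb r X)" for X x
  proof -
    interpret C: comm_group "Pb r X" by (rule P_group[OF X])
    interpret Q: group_hom "Pb r X" "obj K X" "q X"
      using is_omoduleD(2)[OF K X] nat_transD(1)[OF q X] by (simp add: group_hom_def group_hom_axioms_def C.is_group)
    note c = nat_transD(3)[OF f X x] nat_transD(3)[OF wn X x]
    have "q X (\<theta> X x) = q X (g X (f X x)) \<otimes>\<^bsub>obj K X\<^esub> inv\<^bsub>obj K X\<^esub> q X (x \<otimes>\<^bsub>Pb r X\<^esub> w X x)"
      using \<theta>v[OF X x] c x nat_transD(3)[OF g X c(1)] by (simp del: Q.hom_mult add: Q.hom_mult[of _ "inv\<^bsub>_\<^esub> _"])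
    also have "q X (g X (f X x)) = q X (x \<otimes>\<^bsub>Pb r X\<^esub> w X x)"
      using qg[OF X c(1)] fw[OF X x] by (simp add: omap_comp_apply[OF X c(1)])
    also have "\<dots> \<otimes>\<^bsub>obj K X\<^esub> inv\<^bsub>obj K X\<^esub> \<dots> = \<one>\<^bsub>obj K X\<^esub>"
      using c x by (intro Q.H.r_inv) simp
    finally show ?thesis using ex[OF X] nat_transD(3)[OF \<theta> X x] by blast
  qed
  from P_lifts[OF P_omod P_omod d_nat \<theta> this]
  obtain s where s: "s \<in> nat_trans GG \<D> (P r) (P (Suc r))"
    "\<And>X x. \<lbrakk>X \<in> Orb; x \<in> carrier (Pb r X)\<rbrakk> \<Longrightarrow> d r X (s X x) = \<theta> X x" by blast
  show thesis
  proof (rule that[OF \<psi>' s(1)])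
    fix X t assume X: "X \<in> Orb" and t: "t \<in> carrier (obj (I_pow \<pi> (Suc r)) X)"
    note it = nat_transD(3)[OF incl_nat_trans X t]
    have "q X (?\<psi> X t) = \<one>\<^bsub>obj K X\<^esub>"
      using qg[OF X it] aug_incl[OF X t] nat_trans_one[OF is_omodule_I_pow K \<psi> X]
      by (simp add: omap_comp_apply[OF X it] omap_comp_apply[OF X t])
    then show "?\<psi> X t \<in> d r X ` carrier (Pb (Suc r) X)"
      using ex[OF X] nat_transD(3)[OF \<psi>' X t] by blast
  next
    fix X y assume X: "X \<in> Orb" and y: "y \<in> carrier (Pb (Suc r) X)"
    interpret C: comm_group "Pb r X" by (rule P_group[OF X])
    note dy = nat_transD(3)[OF d_nat X y]
    note fdy = nat_transD(3)[OF f X dy]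
    have "?\<psi> X (v X y) = g X (f X (d r X y))"
      using iv[OF X y] by (simp add: omap_comp_apply[OF X nat_transD(3)[OF v X y]])
    \<comment> \<open>On boundaries the term \<open>w\<close> vanishes by its cocycle condition,
      which leaves d s d = g f d - d.\<close>
    moreover have "d r X (s X (d r X y)) = g X (f X (d r X y)) \<otimes>\<^bsub>Pb r X\<^esub> inv\<^bsub>Pb r X\<^esub> d r X y"
      using s(2)[OF X dy] \<theta>v[OF X dy] wd[OF X y] dy by simp
    ultimately have "?\<psi> X (v X y) = d r X y \<otimes>\<^bsub>Pb r X\<^esub> d r X (s X (d r X y))"
      using dy nat_transD(3)[OF g X fdy] C.m_lcomm[of "d r X y" "g X (f X (d r X y))" "inv\<^bsub>Pb r X\<^esub> d r X y"] by simp
    then show "?\<psi> X (v X y) = d r X (y \<otimes>\<^bsub>Pb (Suc r) X\<^esub> s X (d r X y))"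
      using hom_mult[OF nat_transD(1)[OF d_nat X] y nat_transD(3)[OF s(1) X dy]] by simp
  qed
qed

lemma chain_lift_D:
  assumes "chain_lift \<pi> P d e (Suc n) f u"
  shows "\<And>r. r \<le> n \<Longrightarrow> f r \<in> nat_trans GG \<D> (P r) (MI \<pi> r)"
    and "u \<in> nat_trans GG \<D> (P (Suc n)) (I_pow \<pi> (Suc n))"
    and "\<And>X x. \<lbrakk>X \<in> Orb; x \<in> carrier (Pb 0 X)\<rbrakk> \<Longrightarrow> I_pow_0_to_Z \<pi> X (aug_tensor \<pi> 0 X (f 0 X x)) = e X x"
    and "\<And>r X y. \<lbrakk>r < n; X \<in> Orb; y \<in> carrier (Pb (Suc r) X)\<rbrakk> \<Longrightarrow>
      incl \<pi> r X (aug_tensor \<pi> (Suc r) X (f (Suc r) X y)) = f r X (d r X y)"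
    and "\<And>X y. \<lbrakk>X \<in> Orb; y \<in> carrier (Pb (Suc n) X)\<rbrakk> \<Longrightarrow> incl \<pi> n X (u X y) = f n X (d n X y)"
proof -
  show f: "\<And>r. r \<le> n \<Longrightarrow> f r \<in> nat_trans GG \<D> (P r) (MI \<pi> r)"
    and "u \<in> nat_trans GG \<D> (P (Suc n)) (I_pow \<pi> (Suc n))"
    using assms by (simp_all add: chain_lift_def Let_def)
  have 0: "omap_comp GG \<D> (P 0) (splice_aug \<pi>) (f 0) = e"
    and 1: "\<And>r. r < n \<Longrightarrow> omap_comp GG \<D> (P (Suc r)) (splice \<pi> r) (f (Suc r)) = omap_comp GG \<D> (P (Suc r)) (f r) (d r)"
    and 2: "omap_comp GG \<D> (P (Suc n)) (incl \<pi> n) u = omap_comp GG \<D> (P (Suc n)) (f n) (d n)"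
    using assms by (simp_all add: chain_lift_def Let_def)
  fix X assume X: "X \<in> Orb"
  show "I_pow_0_to_Z \<pi> X (aug_tensor \<pi> 0 X (f 0 X x)) = e X x" if x: "x \<in> carrier (Pb 0 X)" for x
    using fun_cong[OF fun_cong[OF 0], of X x] nat_transD(3)[OF f[of 0] X x]
    by (simp add: omap_comp_apply X x splice_aug_def)
  show "incl \<pi> n X (u X y) = f n X (d n X y)" if y: "y \<in> carrier (Pb (Suc n) X)" for y
    using fun_cong[OF fun_cong[OF 2], of X y] by (simp add: omap_comp_apply X y)
  fix r assume r: "r < n"
  show "incl \<pi> r X (aug_tensor \<pi> (Suc r) X (f (Suc r) X y)) = f r X (d r X y)" if y: "y \<in> carrier (Pb (Suc r) X)" for y
    using fun_cong[OF fun_cong[OF 1[OF r]], of X y] nat_transD(3)[OF f[of "Suc r"] X y] r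
    by (simp add: omap_comp_apply X y splice_def)
qed

text \<open>\<open>\<psi>\<close> is the restriction of a chain map back to P, and s is the top degree part of a
  chain homotopy from the identity of P to the round trip.\<close>

lemma comparison:
  assumes ch: "chain_lift \<pi> P d e (Suc n) f u"
  obtains \<psi> s where "\<psi> \<in> nat_trans GG \<D> (I_pow \<pi> (Suc n)) (P n)" "s \<in> nat_trans GG \<D> (P n) (P (Suc n))"
    "\<And>X t. \<lbrakk>X \<in> Orb; t \<in> carrier (obj (I_pow \<pi> (Suc n)) X)\<rbrakk> \<Longrightarrow> \<psi> X t \<in> d n X ` carrier (Pb (Suc n) X)"
    "\<And>X y. \<lbrakk>X \<in> Orb; y \<in> carrier (Pb (Suc n) X)\<rbrakk> \<Longrightarrow> \<psi> X (u X y) = d n X (y \<otimes>\<^bsub>Pb (Suc n) X\<^esub> s X (d n X y))"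
proof -
  note f = chain_lift_D[OF ch]
  \<comment> \<open>The maps into the powers of I underlying the chain lift. In top degree the lift
    supplies \<open>u\<close> itself; below, they are recovered from the augmentation, so one
    induction covers all degrees.\<close>
  define v where "v r = (if r = Suc n then u else omap_comp GG \<D> (P r) (aug_tensor \<pi> r) (f r))" for r
  have vn: "v r \<in> nat_trans GG \<D> (P r) (I_pow \<pi> r)" if "r \<le> Suc n" for r
    using that f(2) nat_trans_omap_comp[OF f(1) aug_nat_trans P_omod, of r] by (simp add: v_def)
  have iv: "incl \<pi> r X (v (Suc r) X y) = f r X (d r X y)"
    if "r \<le> n" "X \<in> Orb" "y \<in> carrier (Pb (Suc r) X)" for r X y
    using that f(4,5) by (auto simp: v_def omap_comp_apply)
  have av: "aug_tensor \<pi> r X (f r X x) = v r X x" if "r \<le> n" "X \<in> Orb" "x \<in> carrier (Pb r X)" for r X x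
    using that by (simp add: v_def omap_comp_apply)
  have "\<exists>\<psi>\<in>nat_trans GG \<D> (I_pow \<pi> (Suc r)) (P r). \<exists>s\<in>nat_trans GG \<D> (P r) (P (Suc r)).
      (\<forall>X\<in>Orb. \<forall>t\<in>carrier (obj (I_pow \<pi> (Suc r)) X). \<psi> X t \<in> d r X ` carrier (Pb (Suc r) X)) \<and>
      (\<forall>X\<in>Orb. \<forall>y\<in>carrier (Pb (Suc r) X). \<psi> X (v (Suc r) X y) = d r X (y \<otimes>\<^bsub>Pb (Suc r) X\<^esub> s X (d r X y)))"
    if "r \<le> n" for r
    using that
  proof (induction r)
    case 0
    interpret H: comm_group "omod_Hom GG \<D> (P 0) (P 0)" by (rule comm_group_omod_Hom[OF P_omod P_omod])
    \<comment> \<open>In degree zero there is no preceding homotopy, so its term is trivial.\<close>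
    let ?w = "\<one>\<^bsub>omod_Hom GG \<D> (P 0) (P 0)\<^esub>"
    have w: "is_cocycle 0 (P 0) ?w"
      using H.one_closed nat_transD(3)[OF d_nat[of 0]] by (simp add: is_cocycle_def omod_Hom_apply)
    have fw: "I_pow_0_to_Z \<pi> X (aug_tensor \<pi> 0 X (f 0 X x)) = e X (x \<otimes>\<^bsub>Pb 0 X\<^esub> ?w X x)"
      if "X \<in> Orb" "x \<in> carrier (Pb 0 X)" for X x
      using f(3)[OF that] that P_group[OF that(1), of 0] by (simp add: omod_Hom_apply comm_group_def group.is_monoid)
    show ?case
      by (rule comparison_step[OF is_omodule_const_Z e_nat d_exact_0 I_pow_0_to_Z_nat_trans e_surj f(1) w fw vn iv]) (use 0 in blast)+
  next
    case (Suc r)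
    then obtain \<psi> s where \<psi>: "\<psi> \<in> nat_trans GG \<D> (I_pow \<pi> (Suc r)) (P r)" and s: "s \<in> nat_trans GG \<D> (P r) (P (Suc r))"
      and im: "\<And>X t. \<lbrakk>X \<in> Orb; t \<in> carrier (obj (I_pow \<pi> (Suc r)) X)\<rbrakk> \<Longrightarrow> \<psi> X t \<in> d r X ` carrier (Pb (Suc r) X)"
      and eq: "\<And>X y. \<lbrakk>X \<in> Orb; y \<in> carrier (Pb (Suc r) X)\<rbrakk> \<Longrightarrow>
        \<psi> X (v (Suc r) X y) = d r X (y \<otimes>\<^bsub>Pb (Suc r) X\<^esub> s X (d r X y))"
      by (auto simp: Suc_le_eq)
    \<comment> \<open>The homotopy of the preceding degree after the differential; it is a cocycle
      because d d = 0.\<close>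
    let ?w = "omap_comp GG \<D> (P (Suc r)) s (d r)"
    have w: "is_cocycle (Suc r) (P (Suc r)) ?w"
      using nat_trans_omap_comp[OF d_nat s P_omod] nat_transD(3)[OF d_nat] d_d nat_trans_one[OF P_omod P_omod s]
      by (simp add: is_cocycle_def omap_comp_apply)
    have fw: "\<psi> X (aug_tensor \<pi> (Suc r) X (f (Suc r) X x)) = d r X (x \<otimes>\<^bsub>Pb (Suc r) X\<^esub> ?w X x)"
      if "X \<in> Orb" "x \<in> carrier (Pb (Suc r) X)" for X x
      using av[OF Suc.prems that] eq[OF that] that by (simp add: omap_comp_apply)
    show ?case
      by (rule comparison_step[OF P_omod d_nat d_exact \<psi> im f(1)[OF Suc.prems] w fw vn iv[OF Suc.prems]])
        (use Suc.prems in blast)+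
  qed
  from this[of n] show thesis
    using that by (auto simp: v_def)
qed

lemma cohomology_class_eqI:
  assumes M: "is_omodule GG \<D> M" and c: "c \<in> nat_trans GG \<D> (P (Suc k)) M" and b: "b \<in> nat_trans GG \<D> (P k) M"
    and \<eta>: "\<eta> \<in> nat_trans GG \<D> (P (Suc k)) M"
    and eq: "\<And>X x. \<lbrakk>X \<in> Orb; x \<in> carrier (Pb (Suc k) X)\<rbrakk> \<Longrightarrow> \<eta> X x = b X (d k X x) \<otimes>\<^bsub>obj M X\<^esub> c X x"
  shows "cohomology_class GG \<D> P d M (Suc k) \<eta> = cohomology_class GG \<D> P d M (Suc k) c"
proof -
  let ?H = "omod_Hom GG \<D> (P (Suc k)) M" and ?N = "coboundaries GG \<D> P d M (Suc k)"
  interpret H: comm_group ?H by (rule comm_group_omod_Hom[OF P_omod M])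
  have N: "subgroup ?N ?H" by (rule coboundaries_subgroup[where d = d, OF P_omod d_nat M])
  let ?b = "cobdry GG \<D> P d k b"
  have bN: "?b \<in> ?N" using b by (simp add: coboundaries_def omod_Hom_apply)
  then have bH: "?b \<in> carrier ?H" using subgroup.mem_carrier[OF N] by blast
  have cH: "c \<in> carrier ?H" using c by (simp add: omod_Hom_apply)
  have "\<eta> = ?b \<otimes>\<^bsub>?H\<^esub> c"
  proof (rule nat_trans_eqI[OF \<eta>])
    show "?b \<otimes>\<^bsub>?H\<^esub> c \<in> nat_trans GG \<D> (P (Suc k)) M" using H.m_closed[OF bH cH] by (simp add: omod_Hom_apply)
  qed (simp add: eq omod_Hom_apply cobdry_def omap_comp_apply)
  then show ?thesis
    using H.coset_mult_assoc[OF subgroup.subset[OF N] bH cH] H.coset_join2[OF bH N bN]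
    by (simp add: cohomology_class_def)
qed

lemma coeff_map_u_class_surj:
  assumes M: "is_omodule GG \<D> M" and \<alpha>: "\<alpha> \<in> carrier (bredon_cohomology GG \<D> P d M (Suc n))"
  shows "\<exists>\<phi>\<in>nat_trans GG \<D> (I_pow \<pi> (Suc n)) M. coeff_map GG \<D> P d M (Suc n) \<phi> (u_class \<pi> P d e (Suc n)) = \<alpha>"
proof -
  obtain c where c: "c \<in> nat_trans GG \<D> (P (Suc n)) M"
    and cc: "cobdry GG \<D> P d (Suc n) c = \<one>\<^bsub>omod_Hom GG \<D> (P (Suc (Suc n))) M\<^esub>"
    and \<alpha>c: "\<alpha> = cohomology_class GG \<D> P d M (Suc n) c"
    using \<alpha> by (auto simp: bredon_cohomology_def FactGroup_def RCOSETS_def cohomology_class_def r_coset_def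
        cocycles_def kernel_def omod_Hom_apply(3))
  have cd: "c X (d (Suc n) X y) = \<one>\<^bsub>obj M X\<^esub>" if "X \<in> Orb" "y \<in> carrier (Pb (Suc (Suc n)) X)" for X y
    using fun_cong[OF fun_cong[OF cc], of X y] that by (simp add: cobdry_def omap_comp_apply omod_Hom_apply)
  define u where "u = (SOME u. \<exists>f. chain_lift \<pi> P d e (Suc n) f u)"
  obtain f where ch: "chain_lift \<pi> P d e (Suc n) f u"
    using someI_ex[OF chain_lift_exists[of n]] unfolding u_def by blast
  note u = chain_lift_D(2)[OF ch]
  obtain \<psi> s where \<psi>: "\<psi> \<in> nat_trans GG \<D> (I_pow \<pi> (Suc n)) (P n)" and s: "s \<in> nat_trans GG \<D> (P n) (P (Suc n))"
    and im: "\<And>X t. \<lbrakk>X \<in> Orb; t \<in> carrier (obj (I_pow \<pi> (Suc n)) X)\<rbrakk> \<Longrightarrow> \<psi> X t \<in> d n X ` carrier (Pb (Suc n) X)"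
    and \<psi>u: "\<And>X y. \<lbrakk>X \<in> Orb; y \<in> carrier (Pb (Suc n) X)\<rbrakk> \<Longrightarrow> \<psi> X (u X y) = d n X (y \<otimes>\<^bsub>Pb (Suc n) X\<^esub> s X (d n X y))"
    by (rule comparison[OF ch]) blast
  \<comment> \<open>By exactness of \<open>P\<close> the kernel of \<open>d n\<close> consists of
    boundaries, where the cocycle \<open>c\<close> vanishes; hence \<open>c\<close> factors through
    the image of \<open>d n\<close>.\<close>
  have ker: "c X x = \<one>\<^bsub>obj M X\<^esub>" if X: "X \<in> Orb" and x: "x \<in> carrier (Pb (Suc n) X)" "d n X x = \<one>\<^bsub>Pb n X\<^esub>" for X x
  proof -
    have "x \<in> d (Suc n) X ` carrier (Pb (Suc (Suc n)) X)" using d_exact[OF X] x by blast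
    then show ?thesis using cd[OF X] by blast
  qed
  obtain \<phi> where \<phi>: "\<phi> \<in> nat_trans GG \<D> (I_pow \<pi> (Suc n)) M"
    and \<phi>c: "\<And>X t x. \<lbrakk>X \<in> Orb; t \<in> carrier (obj (I_pow \<pi> (Suc n)) X); x \<in> carrier (Pb (Suc n) X); \<psi> X t = d n X x\<rbrakk> \<Longrightarrow> \<phi> X t = c X x"
    by (rule nat_trans_factor[OF is_omodule_I_pow P_omod P_omod M d_nat c \<psi> ker im]) blast+
  let ?I = "omod_Hom GG \<D> (P (Suc n)) (I_pow \<pi> (Suc n))" and ?K = "omod_Hom GG \<D> (P n) M"
  interpret I: comm_group ?I by (rule comm_group_omod_Hom[OF P_omod is_omodule_I_pow])
  interpret I': comm_group "omod_Hom GG \<D> (P n) (I_pow \<pi> (Suc n))" by (rule comm_group_omod_Hom[OF P_omod is_omodule_I_pow])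
  interpret K: comm_group ?K by (rule comm_group_omod_Hom[OF P_omod M])
  \<comment> \<open>\<open>coeff_map\<close> takes \<open>the_elem\<close> over a whole coset, so
    every representative of the canonical class must be shown to go to
    \<open>\<alpha>\<close>.\<close>
  have cls: "cohomology_class GG \<D> P d M (Suc n) (omap_comp GG \<D> (P (Suc n)) \<phi> g) = \<alpha>"
    if g: "g \<in> u_class \<pi> P d e (Suc n)" for g
  proof -
    obtain b where b: "b \<in> nat_trans GG \<D> (P n) (I_pow \<pi> (Suc n))" and gb: "g = cobdry GG \<D> P d n b \<otimes>\<^bsub>?I\<^esub> u"
      using g unfolding u_class_def cohomology_class_def u_def[symmetric] r_coset_def coboundaries_def
      by (auto simp: omod_Hom_apply(3))
    have bd: "cobdry GG \<D> P d n b \<in> nat_trans GG \<D> (P (Suc n)) (I_pow \<pi> (Suc n))"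
      unfolding cobdry_def by (rule nat_trans_omap_comp[OF d_nat b P_omod])
    have gn: "g \<in> nat_trans GG \<D> (P (Suc n)) (I_pow \<pi> (Suc n))"
      using I.m_closed[of "cobdry GG \<D> P d n b" u] bd u by (simp add: gb omod_Hom_apply(3))
    have \<phi>b: "omap_comp GG \<D> (P n) \<phi> b \<in> nat_trans GG \<D> (P n) M" by (rule nat_trans_omap_comp[OF b \<phi> P_omod])
    have cs: "omap_comp GG \<D> (P n) c s \<in> nat_trans GG \<D> (P n) M" by (rule nat_trans_omap_comp[OF s c P_omod])
    \<comment> \<open>The cochain whose coboundary measures the difference from \<open>c\<close>:
      \<phi> b accounts for the chosen representative \<open>g\<close>, and c s for the homotopy,
      since \<phi>(u x) = c(x) + c(s(d x)) additively.\<close>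
    have B: "omap_comp GG \<D> (P n) \<phi> b \<otimes>\<^bsub>?K\<^esub> omap_comp GG \<D> (P n) c s \<in> nat_trans GG \<D> (P n) M"
      using K.m_closed[of "omap_comp GG \<D> (P n) \<phi> b" "omap_comp GG \<D> (P n) c s"] \<phi>b cs by (simp add: omod_Hom_apply(3))
    show ?thesis
      unfolding \<alpha>c
    proof (rule cohomology_class_eqI[OF M c B nat_trans_omap_comp[OF gn \<phi> P_omod]])
      fix X x assume X: "X \<in> Orb" and x: "x \<in> carrier (Pb (Suc n) X)"
      interpret M: comm_group "obj M X" by (rule is_omoduleD(1)[OF M X])
      interpret Q: comm_group "Pb (Suc n) X" by (rule P_group[OF X])
      note dx = nat_transD(3)[OF d_nat X x]
      note bdx = nat_transD(3)[OF b X dx] and ux = nat_transD(3)[OF u X x] and sdx = nat_transD(3)[OF s X dx]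
      have "\<phi> X (u X x) = c X x \<otimes>\<^bsub>obj M X\<^esub> c X (s X (d n X x))"
        using \<phi>c[OF X ux _ \<psi>u[OF X x]] hom_mult[OF nat_transD(1)[OF c X] x sdx] Q.m_closed[OF x sdx] by simp
      moreover have "omap_comp GG \<D> (P (Suc n)) \<phi> g X x = \<phi> X (b X (d n X x)) \<otimes>\<^bsub>obj M X\<^esub> \<phi> X (u X x)"
        using hom_mult[OF nat_transD(1)[OF \<phi> X] bdx ux]
        by (simp add: omap_comp_apply X x gb omod_Hom_apply cobdry_def)
      ultimately show "omap_comp GG \<D> (P (Suc n)) \<phi> g X x =
          (omap_comp GG \<D> (P n) \<phi> b \<otimes>\<^bsub>?K\<^esub> omap_comp GG \<D> (P n) c s) X (d n X x) \<otimes>\<^bsub>obj M X\<^esub> c X x"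
        using nat_transD(3)[OF \<phi> X bdx] nat_transD(3)[OF c X sdx] nat_transD(3)[OF c X x]
        by (simp add: omod_Hom_apply omap_comp_apply X dx M.m_ac)
    qed
  qed
  \<comment> \<open>Nonemptiness of the class turns the constancy just shown into a singleton
    image.\<close>
  have "coboundaries GG \<D> P d (I_pow \<pi> (Suc n)) (Suc n) \<noteq> {}"
    using I'.one_closed by (auto simp: coboundaries_def)
  then have "u_class \<pi> P d e (Suc n) \<noteq> {}"
    by (auto simp: u_class_def cohomology_class_def r_coset_def)
  then have "(\<lambda>g. cohomology_class GG \<D> P d M (Suc n) (omap_comp GG \<D> (P (Suc n)) \<phi> g)) ` u_class \<pi> P d e (Suc n) = {\<alpha>}"
    using cls by auto
  then have "coeff_map GG \<D> P d M (Suc n) \<phi> (u_class \<pi> P d e (Suc n)) = \<alpha>"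
    unfolding coeff_map_def by simp
  then show ?thesis using \<phi> by blast
qed

end

theorem theorem5p1:
  fixes \<pi> :: "('a, 'm) monoid_scheme" and n :: nat
    and P :: "nat \<Rightarrow> ('a \<times> 'a, 'p) omodule"
    and d :: "nat \<Rightarrow> ('a \<times> 'a, 'p, 'p) omap"
    and e :: "('a \<times> 'a, 'p, int) omap"
    and M :: "('a \<times> 'a, 'b) omodule"
    and \<alpha> :: "('a \<times> 'a, 'p, 'b) omap set"
  assumes "group \<pi>"
    and "n \<ge> 1"
    and "projective_resolution (\<pi> \<times>\<times> \<pi>) (diag_family \<pi>) P d e"
    and "is_omodule (\<pi> \<times>\<times> \<pi>) (diag_family \<pi>) M"
    and "\<alpha> \<in> carrier (bredon_cohomology (\<pi> \<times>\<times> \<pi>) (diag_family \<pi>) P d M n)"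
  shows "\<exists>\<phi> \<in> nat_trans (\<pi> \<times>\<times> \<pi>) (diag_family \<pi>) (I_pow \<pi> n) M.
    coeff_map (\<pi> \<times>\<times> \<pi>) (diag_family \<pi>) P d M n \<phi> (u_class \<pi> P d e n) = \<alpha>"
proof -
  interpret resolved_group \<pi> P d e
    using assms(1,3) by (simp add: resolved_group_def discrete_group_def resolved_group_axioms_def)
  obtain m where "n = Suc m" using assms(2) by (cases n) auto
  then show ?thesis using coeff_map_u_class_surj[OF assms(4), of \<alpha> m] assms(5) by simp
qed

end
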